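(* Let $K$ be a field, let $E_1,E_2$ be directed graphs, and let $X_{E_i}\subseteq\mathrm{Reg}(E_i)$ for $i=1,2$. Suppose that the relative Cohn path algebras $C_K^{X_{E_1}}(E_1)$ and $C_K^{X_{E_2}}(E_2)$ are finite-dimensional and isomorphic as $K$-algebras. Let $Q$ be the prime field of $K$ and $\bar{Q}$ its algebraic closure. Then for any field $K'$ of the same characteristic as $K$ such that $\bar{Q}\subseteq K'$, we have $C_{K'}^{X_{E_1}}(E_1)\cong C_{K'}^{X_{E_2}}(E_2)$ as $K'$-algebras.
   Context: A directed graph $E=(E^0,E^1,r,s)$ consists of two sets $E^0$ (vertices) and $E^1$ (edges) and functions $r,s\colon E^1\to E^0$. A vertex $v$ is regular if $s^{-1}(v)$ is a finite non-empty set; $\mathrm{Reg}(E)$ is the set of regular vertices. For a commutative unital ring $R$ and a subset $X\subseteq\mathrm{Reg}(E)$, the Cohn path algebra of $E$ relative to $X$, denoted $C_R^{X}(E)$, is the free (associative, not necessarily unital) $R$-algebra generated by $E^0\cup E^1\cup\{e^*: e\in E^1\}$ subject to the relations: (V) $vw=\delta_{v,w}v$ for $v,w\in E^0$; (E1) $s(e)e=er(e)=e$ for $e\in E^1$; (E2) $r(e)e^*=e^*s(e)=e^*$ for $e\in E^1$; (CK1) $e^*f=\delta_{e,f}r(e)$ for $e,f\in E^1$; (XCK2) $v=\sum_{e\in s^{-1}(v)}ee^*$ for every $v\in X$. *)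

theory Defs
  imports
    "Graph_Theory.Digraph"
    "Jordan_Normal_Form.VS_Connect"
    "HOL-Algebra.Algebraic_Closure"
    "HOL-Algebra.Generated_Fields"
    "HOL-Library.Poly_Mapping"
begin

text \<open>
  Algebras here are associative but not necessarily unital, so they are carried by the record type
  \<^typ>\<open>('r, 'a) module\<close>, whose ring part supplies a multiplication, but not by the locale
  \<^locale>\<open>algebra\<close> (which demands a commutative unital one).  The field \<^const>\<open>one\<close> of the
  records below is left unspecified and never used.
\<close>

subsection \<open>Ideals, quotients and isomorphisms of non-unital algebras\<close>

inductive_set generated_ideal ::
    "('r, 'c) ring_scheme \<Rightarrow> ('r, 'a, 'd) module_scheme \<Rightarrow> 'a set \<Rightarrow> 'a set"
  for R and A (structure) and T where
  zero: "\<zero> \<in> generated_ideal R A T"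
| incl: "t \<in> T \<Longrightarrow> t \<in> generated_ideal R A T"
| add: "x \<in> generated_ideal R A T \<Longrightarrow> y \<in> generated_ideal R A T \<Longrightarrow>
    x \<oplus> y \<in> generated_ideal R A T"
| smult: "c \<in> carrier R \<Longrightarrow> x \<in> generated_ideal R A T \<Longrightarrow> c \<odot> x \<in> generated_ideal R A T"
| mult_left: "a \<in> carrier A \<Longrightarrow> x \<in> generated_ideal R A T \<Longrightarrow> a \<otimes> x \<in> generated_ideal R A T"
| mult_right: "a \<in> carrier A \<Longrightarrow> x \<in> generated_ideal R A T \<Longrightarrow> x \<otimes> a \<in> generated_ideal R A T"

definition quotient_algebra ::
    "('r, 'a, 'd) module_scheme \<Rightarrow> 'a set \<Rightarrow> ('r, 'a set) module" where
  "quotient_algebra A I =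
    \<lparr>carrier = a_rcosets\<^bsub>A\<^esub> I, monoid.mult = rcoset_mult A I, one = undefined,
     zero = I, add = set_add A, smult = (\<lambda>c C. \<Union>x\<in>C. a_r_coset A I (c \<odot>\<^bsub>A\<^esub> x))\<rparr>"

definition algebra_isomorphic ::
    "('r, 'c) ring_scheme \<Rightarrow> ('r, 'a, 'd) module_scheme \<Rightarrow> ('r, 'b, 'e) module_scheme \<Rightarrow> bool" where
  "algebra_isomorphic R A B \<longleftrightarrow>
    (\<exists>\<phi> \<in> module_hom R A B. bij_betw \<phi> (carrier A) (carrier B) \<and>
      (\<forall>x\<in>carrier A. \<forall>y\<in>carrier A. \<phi> (x \<otimes>\<^bsub>A\<^esub> y) = \<phi> x \<otimes>\<^bsub>B\<^esub> \<phi> y))"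


subsection \<open>The free non-unital algebra\<close>

text \<open>
  The basis consists of the nonempty words over the generating set \<open>S\<close>; words multiply by
  concatenation.
\<close>

definition free_mult ::
    "('g list \<Rightarrow>\<^sub>0 'r::comm_ring_1) \<Rightarrow> ('g list \<Rightarrow>\<^sub>0 'r) \<Rightarrow> ('g list \<Rightarrow>\<^sub>0 'r)" where
  "free_mult f g = (\<Sum>u\<in>Poly_Mapping.keys f. \<Sum>v\<in>Poly_Mapping.keys g.
     Poly_Mapping.single (u @ v) (Poly_Mapping.lookup f u * Poly_Mapping.lookup g v))"

definition free_algebra :: "'g set \<Rightarrow> ('r::comm_ring_1, 'g list \<Rightarrow>\<^sub>0 'r) module" where
  "free_algebra S =
    \<lparr>carrier = {f. Poly_Mapping.keys f \<subseteq> lists S - {[]}}, monoid.mult = free_mult, one = undefined,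
     zero = 0, add = (+), smult = (\<lambda>c. Poly_Mapping.map (\<lambda>x. c * x))\<rparr>"


subsection \<open>Relative Cohn path algebras\<close>

text \<open>
  Source and range of an edge \<open>e\<close> are \<^term>\<open>tail E e\<close> and \<^term>\<open>head E e\<close>.
\<close>

definition regular_verts :: "('v, 'e) pre_digraph \<Rightarrow> 'v set" where
  "regular_verts E = {v \<in> verts E. finite (out_arcs E v) \<and> out_arcs E v \<noteq> {}}"

datatype ('v, 'e) cohn_gen = Vert 'v | Edge 'e | Ghost 'e

definition cohn_gens :: "('v, 'e) pre_digraph \<Rightarrow> ('v, 'e) cohn_gen set" where
  "cohn_gens E = Vert ` verts E \<union> Edge ` arcs E \<union> Ghost ` arcs E"

abbreviation word :: "'g list \<Rightarrow> 'g list \<Rightarrow>\<^sub>0 'r::comm_ring_1" where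
  "word w \<equiv> Poly_Mapping.single w 1"

text \<open>
  A relation \<open>a = b\<close> is represented by the relator \<open>a - b\<close>.
\<close>

inductive_set cohn_relators ::
    "('v, 'e) pre_digraph \<Rightarrow> 'v set \<Rightarrow> (('v, 'e) cohn_gen list \<Rightarrow>\<^sub>0 'r::comm_ring_1) set"
  for E XE where
  V: "v \<in> verts E \<Longrightarrow> w \<in> verts E \<Longrightarrow>
    word [Vert v, Vert w] - (if v = w then word [Vert v] else 0) \<in> cohn_relators E XE"
| E1_source: "e \<in> arcs E \<Longrightarrow>
    word [Vert (tail E e), Edge e] - word [Edge e] \<in> cohn_relators E XE"
| E1_range: "e \<in> arcs E \<Longrightarrow>
    word [Edge e, Vert (head E e)] - word [Edge e] \<in> cohn_relators E XE"
| E2_range: "e \<in> arcs E \<Longrightarrow>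
    word [Vert (head E e), Ghost e] - word [Ghost e] \<in> cohn_relators E XE"
| E2_source: "e \<in> arcs E \<Longrightarrow>
    word [Ghost e, Vert (tail E e)] - word [Ghost e] \<in> cohn_relators E XE"
| CK1: "e \<in> arcs E \<Longrightarrow> f \<in> arcs E \<Longrightarrow>
    word [Ghost e, Edge f] - (if e = f then word [Vert (head E e)] else 0) \<in> cohn_relators E XE"
| XCK2: "v \<in> XE \<Longrightarrow>
    word [Vert v] - (\<Sum>e\<in>out_arcs E v. word [Edge e, Ghost e]) \<in> cohn_relators E XE"

definition cohn_path_algebra ::
    "'r::comm_ring_1 itself \<Rightarrow> ('v, 'e) pre_digraph \<Rightarrow> 'v set \<Rightarrow>
     ('r, (('v, 'e) cohn_gen list \<Rightarrow>\<^sub>0 'r) set) module" where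
  "cohn_path_algebra TYPE('r) E XE =
    quotient_algebra (free_algebra (cohn_gens E))
      (generated_ideal (class_ring :: 'r ring) (free_algebra (cohn_gens E)) (cohn_relators E XE))"


subsection \<open>Prime fields\<close>

definition prime_field :: "('a, 'b) ring_scheme \<Rightarrow> ('a, 'b) ring_scheme" where
  "prime_field K = K\<lparr>carrier := generate_field K {}\<rparr>"


subsection \<open>Well-definedness\<close>

text \<open>
  The free algebra is associative, the coset operations do not depend on representatives, and the
  relative Cohn path algebra over a field is a vector space.
\<close>

lemma free_mult_alt:
  assumes "finite A" "Poly_Mapping.keys f \<subseteq> A" "finite B" "Poly_Mapping.keys g \<subseteq> B"
  shows "free_mult f g = (\<Sum>u\<in>A. \<Sum>v\<in>B.
     Poly_Mapping.single (u @ v) (Poly_Mapping.lookup f u * Poly_Mapping.lookup g v))"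
proof -
  have "free_mult f g = (\<Sum>u\<in>Poly_Mapping.keys f. \<Sum>v\<in>B.
     Poly_Mapping.single (u @ v) (Poly_Mapping.lookup f u * Poly_Mapping.lookup g v))"
    unfolding free_mult_def using assms
    by (intro sum.cong sum.mono_neutral_left refl) (auto simp: in_keys_iff)
  also have "\<dots> = (\<Sum>u\<in>A. \<Sum>v\<in>B.
     Poly_Mapping.single (u @ v) (Poly_Mapping.lookup f u * Poly_Mapping.lookup g v))"
    using assms by (intro sum.mono_neutral_left) (auto simp: in_keys_iff)
  finally show ?thesis .
qed

lemma free_mult_add_left: "free_mult (f + f') g = free_mult f g + free_mult f' g"
proof -
  let ?A = "Poly_Mapping.keys f \<union> Poly_Mapping.keys f'"
  have "Poly_Mapping.keys (f + f') \<subseteq> ?A" by (rule Poly_Mapping.keys_add)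
  then show ?thesis
    by (simp add: free_mult_alt[of ?A _ "Poly_Mapping.keys g"]
      lookup_add distrib_right single_add sum.distrib)
qed

lemma free_mult_add_right: "free_mult f (g + g') = free_mult f g + free_mult f g'"
proof -
  let ?A = "Poly_Mapping.keys g \<union> Poly_Mapping.keys g'"
  have "Poly_Mapping.keys (g + g') \<subseteq> ?A" by (rule Poly_Mapping.keys_add)
  then show ?thesis
    by (simp add: free_mult_alt[of "Poly_Mapping.keys f" _ ?A]
      lookup_add distrib_left single_add sum.distrib)
qed

lemma free_mult_0 [simp]: "free_mult 0 g = 0" "free_mult f 0 = 0"
  by (simp_all add: free_mult_def)

lemma free_mult_sum_left: "free_mult (sum f I) g = (\<Sum>i\<in>I. free_mult (f i) g)"
  by (induction I rule: infinite_finite_induct) (simp_all add: free_mult_add_left)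

lemma free_mult_sum_right: "free_mult g (sum f I) = (\<Sum>i\<in>I. free_mult g (f i))"
  by (induction I rule: infinite_finite_induct) (simp_all add: free_mult_add_right)

lemma free_mult_single [simp]:
  "free_mult (Poly_Mapping.single u a) (Poly_Mapping.single v b) = Poly_Mapping.single (u @ v) (a * b)"
  by (subst free_mult_alt[of "{u}" _ "{v}"]) auto

lemma sum_single_keys: "(\<Sum>u\<in>Poly_Mapping.keys f. Poly_Mapping.single u (Poly_Mapping.lookup f u)) = f"
proof (rule poly_mapping_eqI)
  fix k
  have "Poly_Mapping.lookup (\<Sum>u\<in>Poly_Mapping.keys f. Poly_Mapping.single u (Poly_Mapping.lookup f u)) k
    = (\<Sum>u\<in>Poly_Mapping.keys f. if u = k then Poly_Mapping.lookup f u else 0)"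
    by (simp only: lookup_sum lookup_single when_def)
  also have "\<dots> = Poly_Mapping.lookup f k" by (simp add: in_keys_iff)
  finally show "Poly_Mapping.lookup (\<Sum>u\<in>Poly_Mapping.keys f. Poly_Mapping.single u (Poly_Mapping.lookup f u)) k
    = Poly_Mapping.lookup f k" .
qed

lemma free_mult_assoc: "free_mult (free_mult f g) h = free_mult f (free_mult g h)"
proof -
  have "free_mult (free_mult (\<Sum>u\<in>A. Poly_Mapping.single u (a u)) (\<Sum>u\<in>B. Poly_Mapping.single u (b u))) (\<Sum>u\<in>C. Poly_Mapping.single u (c u))
   = free_mult (\<Sum>u\<in>A. Poly_Mapping.single u (a u)) (free_mult (\<Sum>u\<in>B. Poly_Mapping.single u (b u)) (\<Sum>u\<in>C. Poly_Mapping.single u (c u)))"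
   for A B C and a b c :: "'a list \<Rightarrow> 'b"
  by (simp only: free_mult_sum_left free_mult_sum_right free_mult_single append_assoc mult.assoc)
  from this[of "Poly_Mapping.lookup f" "Poly_Mapping.keys f" "Poly_Mapping.lookup g" "Poly_Mapping.keys g" "Poly_Mapping.lookup h" "Poly_Mapping.keys h"]
  show ?thesis by (simp only: sum_single_keys)
qed

lemma smult_conv: "Poly_Mapping.map (\<lambda>x. c * x) f = free_mult (Poly_Mapping.single [] c) f"
proof -
  have *: "free_mult (Poly_Mapping.single [] c) f
    = (\<Sum>u\<in>Poly_Mapping.keys f. Poly_Mapping.single u (c * Poly_Mapping.lookup f u))"
    using free_mult_alt[of "{[]}" "Poly_Mapping.single [] c" "Poly_Mapping.keys f" f] by simp
  show ?thesis unfolding *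
  proof (rule poly_mapping_eqI)
    fix k
    have "Poly_Mapping.lookup (\<Sum>u\<in>Poly_Mapping.keys f. Poly_Mapping.single u (c * Poly_Mapping.lookup f u)) k
    = (\<Sum>u\<in>Poly_Mapping.keys f. if u = k then c * Poly_Mapping.lookup f u else 0)"
      by (simp only: lookup_sum lookup_single when_def)
    also have "\<dots> = c * Poly_Mapping.lookup f k" by (simp add: in_keys_iff)
    also have "\<dots> = Poly_Mapping.lookup (Poly_Mapping.map (\<lambda>x. c * x) f) k"
      by (simp add: Poly_Mapping.map.rep_eq when_def)
    finally show "Poly_Mapping.lookup (Poly_Mapping.map (\<lambda>x. c * x) f) k = Poly_Mapping.lookup (\<Sum>u\<in>Poly_Mapping.keys f. Poly_Mapping.single u (c * Poly_Mapping.lookup f u)) k"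
      by (rule sym)
  qed
qed

lemma keys_sum_closed:
  assumes "\<And>i. i \<in> I \<Longrightarrow> Poly_Mapping.keys (f i) \<subseteq> W"
  shows "Poly_Mapping.keys (sum f I) \<subseteq> W"
  using assms
proof (induction I rule: infinite_finite_induct)
  case (insert i I)
  then have "Poly_Mapping.keys (f i) \<union> Poly_Mapping.keys (sum f I) \<subseteq> W" by simp
  then show ?case
    using insert subset_trans[OF Poly_Mapping.keys_add[of "f i" "sum f I"]] by simp
qed simp_all

lemma keys_free_mult:
  assumes "\<And>u v. u \<in> Poly_Mapping.keys f \<Longrightarrow> v \<in> Poly_Mapping.keys g \<Longrightarrow> u @ v \<in> W"
  shows "Poly_Mapping.keys (free_mult f g) \<subseteq> W"
  unfolding free_mult_def by (intro keys_sum_closed) (simp add: assms)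

lemma free_mult_closed:
  assumes "f \<in> carrier (free_algebra S)" "g \<in> carrier (free_algebra S)"
  shows "free_mult f g \<in> carrier (free_algebra S)"
proof -
  have "Poly_Mapping.keys f \<subseteq> lists S - {[]}" "Poly_Mapping.keys g \<subseteq> lists S - {[]}"
    using assms by (simp_all add: free_algebra_def)
  then have "Poly_Mapping.keys (free_mult f g) \<subseteq> lists S - {[]}"
    by (intro keys_free_mult) auto
  then show ?thesis by (simp add: free_algebra_def)
qed

lemma module_free_algebra:
  "module (class_ring :: 'r::comm_ring_1 ring) (free_algebra S :: ('r, 'g list \<Rightarrow>\<^sub>0 'r) module)"
    (is "module ?R ?F")
proof -
  have carr: "x \<in> carrier ?F \<longleftrightarrow> Poly_Mapping.keys x \<subseteq> lists S - {[]}" for x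
    by (simp add: free_algebra_def)
  have add: "x + y \<in> carrier ?F" if "x \<in> carrier ?F" "y \<in> carrier ?F" for x y
  proof -
    have "Poly_Mapping.keys x \<union> Poly_Mapping.keys y \<subseteq> lists S - {[]}" using that carr by simp
    then show ?thesis using subset_trans[OF Poly_Mapping.keys_add[of x y]] carr by simp
  qed
  have ops: "x \<oplus>\<^bsub>?F\<^esub> y = x + y" "c \<odot>\<^bsub>?F\<^esub> x = free_mult (Poly_Mapping.single [] c) x" "\<zero>\<^bsub>?F\<^esub> = 0"
    for x y c
    by (simp_all add: free_algebra_def smult_conv)
  have smult: "c \<odot>\<^bsub>?F\<^esub> x \<in> carrier ?F" if "x \<in> carrier ?F" for c x
    using that unfolding carr ops by (intro keys_free_mult) (auto split: if_splits)
  have neg: "\<exists>y\<in>carrier ?F. y \<oplus>\<^bsub>?F\<^esub> x = \<zero>\<^bsub>?F\<^esub>" if "x \<in> carrier ?F" for x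
    using that by (intro bexI[of _ "-x"]) (simp_all add: carr ops)
  have one: "1 \<odot>\<^bsub>?F\<^esub> x = x" for x
    unfolding ops(2) smult_conv[symmetric]
    by (rule poly_mapping_eqI) (simp add: Poly_Mapping.map.rep_eq when_def)
  have assoc: "(a * b) \<odot>\<^bsub>?F\<^esub> x = a \<odot>\<^bsub>?F\<^esub> (b \<odot>\<^bsub>?F\<^esub> x)" for a b x
    unfolding ops free_mult_assoc[symmetric] by simp
  have grp: "abelian_group ?F"
    by (rule abelian_groupI) (use neg add in \<open>simp_all add: ops add_ac carr\<close>)
  show ?thesis
  proof (rule moduleI)
    show "cring ?R" ..
    show "abelian_group ?F" by (rule grp)
  qed (simp_all add: smult one assoc, simp_all add: ops free_mult_add_left free_mult_add_right single_add)
qed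

lemma free_algebra_mult: "x \<otimes>\<^bsub>free_algebra S\<^esub> y = free_mult x y"
  by (simp add: free_algebra_def)

lemma smult_free_mult:
  fixes x y :: "'g list \<Rightarrow>\<^sub>0 'r::comm_ring_1"
  shows "c \<odot>\<^bsub>free_algebra S\<^esub> (x \<otimes>\<^bsub>free_algebra S\<^esub> y) = (c \<odot>\<^bsub>free_algebra S\<^esub> x) \<otimes>\<^bsub>free_algebra S\<^esub> y"
  by (simp add: free_algebra_def smult_conv free_mult_assoc)

lemma cohn_relators_closed:
  assumes "wf_digraph E" "XE \<subseteq> regular_verts E"
  shows "(cohn_relators E XE :: (('v, 'e) cohn_gen list \<Rightarrow>\<^sub>0 'r::comm_ring_1) set)
    \<subseteq> carrier (free_algebra (cohn_gens E))"
    (is "_ \<subseteq> carrier ?F")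
proof
  interpret wf_digraph E by fact
  have carr: "x \<in> carrier ?F \<longleftrightarrow> Poly_Mapping.keys x \<subseteq> lists (cohn_gens E) - {[]}" for x
    by (simp add: free_algebra_def)
  have minus: "x - y \<in> carrier ?F" if "x \<in> carrier ?F" "y \<in> carrier ?F" for x y
  proof -
    have "Poly_Mapping.keys x \<union> Poly_Mapping.keys y \<subseteq> lists (cohn_gens E) - {[]}" using that carr by simp
    then show ?thesis using subset_trans[OF keys_diff[of x y]] carr by simp
  qed
  have word: "word w \<in> carrier ?F" if "w \<noteq> []" "set w \<subseteq> cohn_gens E" for w
    using that by (auto simp: carr)
  have zero: "0 \<in> carrier ?F" by (simp add: carr)
  have sum: "sum f I \<in> carrier ?F" if "\<And>i. i \<in> I \<Longrightarrow> f i \<in> carrier ?F" for f and I :: "'e set"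
    using that unfolding carr by (rule keys_sum_closed)
  have gens: "v \<in> verts E \<Longrightarrow> Vert v \<in> cohn_gens E" "e \<in> arcs E \<Longrightarrow> Edge e \<in> cohn_gens E"
    "e \<in> arcs E \<Longrightarrow> Ghost e \<in> cohn_gens E" for v e
    by (simp_all add: cohn_gens_def)
  fix x :: "('v, 'e) cohn_gen list \<Rightarrow>\<^sub>0 'r"
  assume "x \<in> cohn_relators E XE"
  then show "x \<in> carrier ?F"
  proof cases
    case (XCK2 v)
    then have "v \<in> verts E" using assms(2) by (auto simp: regular_verts_def)
    then show ?thesis unfolding XCK2(1)
      by (intro minus word sum) (auto simp: out_arcs_def gens)
  qed (simp_all add: minus word zero gens)
qed

lemma generated_ideal_closed:
  assumes "module R A" "T \<subseteq> carrier A"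
    and "\<And>x y. x \<in> carrier A \<Longrightarrow> y \<in> carrier A \<Longrightarrow> x \<otimes>\<^bsub>A\<^esub> y \<in> carrier A"
  shows "generated_ideal R A T \<subseteq> carrier A"
proof
  interpret module R A by fact
  fix x assume "x \<in> generated_ideal R A T"
  then show "x \<in> carrier A" by induction (use assms(2,3) in auto)
qed

lemma generated_ideal_abelian_subgroup:
  assumes "module R A" "T \<subseteq> carrier A"
    and "\<And>x y. x \<in> carrier A \<Longrightarrow> y \<in> carrier A \<Longrightarrow> x \<otimes>\<^bsub>A\<^esub> y \<in> carrier A"
  shows "abelian_subgroup (generated_ideal R A T) A"
proof -
  interpret module R A by fact
  note closed = generated_ideal_closed[OF assms]
  have "\<ominus>\<^bsub>A\<^esub> x \<in> generated_ideal R A T" if "x \<in> generated_ideal R A T" for x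
  proof -
    have "(\<ominus>\<^bsub>R\<^esub> \<one>\<^bsub>R\<^esub>) \<odot>\<^bsub>A\<^esub> x \<in> generated_ideal R A T"
      using that by (intro generated_ideal.smult) auto
    moreover have "(\<ominus>\<^bsub>R\<^esub> \<one>\<^bsub>R\<^esub>) \<odot>\<^bsub>A\<^esub> x = \<ominus>\<^bsub>A\<^esub> x"
      using that closed by (subst smult_l_minus) auto
    ultimately show ?thesis by simp
  qed
  then have "subgroup (generated_ideal R A T) (add_monoid A)"
    using closed generated_ideal.zero[of A R T]
    by (intro group.subgroupI) (auto simp: a_group a_inv_def intro: generated_ideal.add)
  then show ?thesis
    by (intro abelian_subgroupI3) (auto simp: additive_subgroup_def M.abelian_group_axioms)
qed

lemma quotient_algebra_coset_ops:
  assumes "module R A" "T \<subseteq> carrier A"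
    and mult: "\<And>x y. x \<in> carrier A \<Longrightarrow> y \<in> carrier A \<Longrightarrow> x \<otimes>\<^bsub>A\<^esub> y \<in> carrier A"
    and "x \<in> carrier A"
  defines "I \<equiv> generated_ideal R A T"
  shows "y \<in> carrier A \<Longrightarrow> set_add A (a_r_coset A I x) (a_r_coset A I y) = a_r_coset A I (x \<oplus>\<^bsub>A\<^esub> y)"
    and "c \<in> carrier R \<Longrightarrow>
      c \<odot>\<^bsub>quotient_algebra A I\<^esub> (a_r_coset A I x) = a_r_coset A I (c \<odot>\<^bsub>A\<^esub> x)"
    and "\<lbrakk>y \<in> carrier A;
      \<And>x y z. x \<in> carrier A \<Longrightarrow> y \<in> carrier A \<Longrightarrow> z \<in> carrier A \<Longrightarrow> (x \<oplus>\<^bsub>A\<^esub> y) \<otimes>\<^bsub>A\<^esub> z = x \<otimes>\<^bsub>A\<^esub> z \<oplus>\<^bsub>A\<^esub> y \<otimes>\<^bsub>A\<^esub> z;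
      \<And>x y z. x \<in> carrier A \<Longrightarrow> y \<in> carrier A \<Longrightarrow> z \<in> carrier A \<Longrightarrow> z \<otimes>\<^bsub>A\<^esub> (x \<oplus>\<^bsub>A\<^esub> y) = z \<otimes>\<^bsub>A\<^esub> x \<oplus>\<^bsub>A\<^esub> z \<otimes>\<^bsub>A\<^esub> y\<rbrakk> \<Longrightarrow>
      rcoset_mult A I (a_r_coset A I x) (a_r_coset A I y) = a_r_coset A I (x \<otimes>\<^bsub>A\<^esub> y)"
proof -
  interpret module R A by fact
  interpret I: abelian_subgroup I A
    unfolding I_def by (rule generated_ideal_abelian_subgroup[OF assms(1-3)])
  have coset: "\<exists>i\<in>I. x' = i \<oplus>\<^bsub>A\<^esub> x" if "x' \<in> a_r_coset A I x" for x x'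
    using that by (simp add: a_r_coset_def r_coset_def)
  have eq: "a_r_coset A I (i \<oplus>\<^bsub>A\<^esub> x) = a_r_coset A I x" if "i \<in> I" "x \<in> carrier A" for i x
    using M.a_coset_add_assoc[OF I.a_subset I.a_Hcarr[OF that(1)] that(2)]
    by (simp only: I.a_rcos_const[OF that(1)])
  show "y \<in> carrier A \<Longrightarrow> set_add A (a_r_coset A I x) (a_r_coset A I y) = a_r_coset A I (x \<oplus>\<^bsub>A\<^esub> y)"
    using assms(4) by (rule I.a_rcos_sum)
  show "c \<odot>\<^bsub>quotient_algebra A I\<^esub> (a_r_coset A I x) = a_r_coset A I (c \<odot>\<^bsub>A\<^esub> x)" if c: "c \<in> carrier R"
  proof -
    have "a_r_coset A I (c \<odot>\<^bsub>A\<^esub> x') = a_r_coset A I (c \<odot>\<^bsub>A\<^esub> x)" if x': "x' \<in> a_r_coset A I x" for x'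
    proof -
      obtain i where i: "i \<in> I" "x' = i \<oplus>\<^bsub>A\<^esub> x" using coset[OF x'] by blast
      then have "c \<odot>\<^bsub>A\<^esub> x' = c \<odot>\<^bsub>A\<^esub> i \<oplus>\<^bsub>A\<^esub> c \<odot>\<^bsub>A\<^esub> x"
        using c assms(4) I.a_Hcarr by (simp add: smult_r_distr)
      moreover have "c \<odot>\<^bsub>A\<^esub> i \<in> I" using i c unfolding I_def by (intro generated_ideal.smult)
      ultimately show ?thesis using eq c assms(4) by simp
    qed
    moreover have "x \<in> a_r_coset A I x" using assms(4) by (rule I.a_rcos_self)
    ultimately have "(\<Union>x'\<in>a_r_coset A I x. a_r_coset A I (c \<odot>\<^bsub>A\<^esub> x')) = a_r_coset A I (c \<odot>\<^bsub>A\<^esub> x)"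
      by blast
    then show ?thesis unfolding quotient_algebra_def by simp
  qed
  show "rcoset_mult A I (a_r_coset A I x) (a_r_coset A I y) = a_r_coset A I (x \<otimes>\<^bsub>A\<^esub> y)"
    if y: "y \<in> carrier A"
      and l: "\<And>x y z. x \<in> carrier A \<Longrightarrow> y \<in> carrier A \<Longrightarrow> z \<in> carrier A \<Longrightarrow> (x \<oplus>\<^bsub>A\<^esub> y) \<otimes>\<^bsub>A\<^esub> z = x \<otimes>\<^bsub>A\<^esub> z \<oplus>\<^bsub>A\<^esub> y \<otimes>\<^bsub>A\<^esub> z"
      and r: "\<And>x y z. x \<in> carrier A \<Longrightarrow> y \<in> carrier A \<Longrightarrow> z \<in> carrier A \<Longrightarrow> z \<otimes>\<^bsub>A\<^esub> (x \<oplus>\<^bsub>A\<^esub> y) = z \<otimes>\<^bsub>A\<^esub> x \<oplus>\<^bsub>A\<^esub> z \<otimes>\<^bsub>A\<^esub> y"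
  proof -
    have "a_r_coset A I (x' \<otimes>\<^bsub>A\<^esub> y') = a_r_coset A I (x \<otimes>\<^bsub>A\<^esub> y)"
      if x': "x' \<in> a_r_coset A I x" and y': "y' \<in> a_r_coset A I y" for x' y'
    proof -
      obtain i where i: "i \<in> I" "x' = i \<oplus>\<^bsub>A\<^esub> x" using coset[OF x'] by blast
      obtain j where j: "j \<in> I" "y' = j \<oplus>\<^bsub>A\<^esub> y" using coset[OF y'] by blast
      have carr: "i \<in> carrier A" "j \<in> carrier A" using i j I.a_Hcarr by auto
      have y'c: "y' \<in> carrier A" using j carr y by simp
      have "a_r_coset A I (x' \<otimes>\<^bsub>A\<^esub> y') = a_r_coset A I (i \<otimes>\<^bsub>A\<^esub> y' \<oplus>\<^bsub>A\<^esub> x \<otimes>\<^bsub>A\<^esub> y')"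
        using i carr assms(4) y'c by (simp add: l)
      also have "\<dots> = a_r_coset A I (x \<otimes>\<^bsub>A\<^esub> y')"
        using i(1) y'c assms(4) mult unfolding I_def
        by (intro eq[unfolded I_def] generated_ideal.mult_right) auto
      also have "\<dots> = a_r_coset A I (x \<otimes>\<^bsub>A\<^esub> j \<oplus>\<^bsub>A\<^esub> x \<otimes>\<^bsub>A\<^esub> y)"
        using j carr assms(4) y by (simp add: r)
      also have "\<dots> = a_r_coset A I (x \<otimes>\<^bsub>A\<^esub> y)"
        using j(1) y assms(4) mult unfolding I_def
        by (intro eq[unfolded I_def] generated_ideal.mult_left) auto
      finally show ?thesis .
    qed
    moreover have "x \<in> a_r_coset A I x" "y \<in> a_r_coset A I y"
      using assms(4) y by (auto intro: I.a_rcos_self)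
    ultimately show ?thesis unfolding rcoset_mult_def by blast
  qed
qed

lemma module_quotient_algebra:
  assumes "module R A" "T \<subseteq> carrier A"
    and mult: "\<And>x y. x \<in> carrier A \<Longrightarrow> y \<in> carrier A \<Longrightarrow> x \<otimes>\<^bsub>A\<^esub> y \<in> carrier A"
  shows "module R (quotient_algebra A (generated_ideal R A T))"
proof -
  interpret module R A by fact
  define I where "I = generated_ideal R A T"
  interpret I: abelian_subgroup I A
    unfolding I_def by (rule generated_ideal_abelian_subgroup[OF assms])
  let ?Q = "quotient_algebra A I"
  let ?c = "a_r_coset A I"
  have sm: "c \<odot>\<^bsub>?Q\<^esub> ?c x = ?c (c \<odot>\<^bsub>A\<^esub> x)" if "c \<in> carrier R" "x \<in> carrier A" for c x
    unfolding I_def by (rule quotient_algebra_coset_ops(2)) (use assms that in auto)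
  have carr: "carrier ?Q = ?c ` carrier A"
    by (auto simp: quotient_algebra_def A_RCOSETS_def RCOSETS_def a_r_coset_def)
  have add: "?c x \<oplus>\<^bsub>?Q\<^esub> ?c y = ?c (x \<oplus>\<^bsub>A\<^esub> y)" if "x \<in> carrier A" "y \<in> carrier A" for x y
    using I.a_rcos_sum[OF that] by (simp add: quotient_algebra_def)
  have zero: "\<zero>\<^bsub>?Q\<^esub> = ?c \<zero>\<^bsub>A\<^esub>"
    using I.a_rcos_const[OF I.zero_closed] by (simp add: quotient_algebra_def)
  have "module R ?Q"
  proof (intro moduleI abelian_groupI)
    show "cring R" ..
    show "\<exists>y\<in>carrier ?Q. y \<oplus>\<^bsub>?Q\<^esub> x = \<zero>\<^bsub>?Q\<^esub>" if "x \<in> carrier ?Q" for x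
    proof -
      obtain x' where "x' \<in> carrier A" "x = ?c x'" using \<open>x \<in> carrier ?Q\<close> carr by auto
      then show ?thesis
        by (intro bexI[of _ "?c (\<ominus>\<^bsub>A\<^esub> x')"]) (auto simp: carr add zero M.l_neg)
    qed
  qed (auto simp: carr add zero sm M.a_assoc M.a_comm M.a_lcomm smult_l_distr smult_r_distr smult_assoc1)
  then show ?thesis unfolding I_def .
qed

theorem vectorspace_cohn_path_algebra:
  assumes "wf_digraph E" "XE \<subseteq> regular_verts E"
  shows "vectorspace class_ring (cohn_path_algebra TYPE('k::field) E XE)"
proof -
  have "module class_ring (cohn_path_algebra TYPE('k) E XE)"
    unfolding cohn_path_algebra_def
    by (intro module_quotient_algebra module_free_algebra cohn_relators_closed assms)
      (simp add: free_mult_closed free_algebra_mult)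
  then show ?thesis
    by (intro vectorspace.intro) (simp_all add: class_field)
qed

end

theory Submission
  imports Defs "Graph_Theory.Arc_Walk" "HOL-Library.Function_Algebras"
begin

text \<open>
  A finite-dimensional relative Cohn path algebra is a direct sum of full matrix algebras whose sizes
  are read off from the graph, and the coefficient ring enters only as the ring of matrix entries.

  Let \<open>C\<close> be the algebra of \<open>(E, X)\<close> over some ring.  If \<open>E\<close> has only finitely many walks (in
  particular no cycles), then for walks \<open>p\<close>, \<open>q\<close> with a common end \<open>v \<notin> X\<close> the elements
  \<open>p (v - \<Sum> e e\<^sup>*) q\<^sup>*\<close>, with \<open>e\<close> ranging over the edges leaving \<open>v\<close>, multiply like matrix units.  They
  span: a vertex is the sum of its own defect \<open>v - \<Sum> e e\<^sup>*\<close> (which vanishes for \<open>v \<in> X\<close>) and of the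
  \<open>e e\<^sup>*\<close>, and this can be iterated until the walks run out.  They are independent because \<open>C\<close> acts on
  the functions on the set of those walks that end outside \<open>X\<close>.  Hence \<open>C\<close> is the sum, over the
  vertices \<open>v \<notin> X\<close>, of the algebras of \<open>n(v) \<times> n(v)\<close> matrices, where \<open>n(v)\<close> is the number of walks
  that end in \<open>v\<close> (\<open>cohn_path_algebra_isomorphic_block_matrix_algebra\<close>).

  Finite dimension forces finitely many walks, since distinct walks are linearly independent in \<open>C\<close>
  (\<open>fin_dim_cohn_path_algebra_imp_finite_walks\<close>).  This is again seen from an action of \<open>C\<close> on
  functions, this time on an infinite set of points that carry an integer degree, so that walks of
  different lengths are told apart.  Both actions come from branching systems, which are treated
  uniformly.

  Over a field, the multiset of the sizes \<open>n(v)\<close> is an isomorphism invariant of the sum of matrix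
  algebras: the units of the blocks are the minimal central idempotents, and the dimension of a block is
  the square of its size (\<open>block_matrix_algebra_iso_imp_bij\<close>).  So an isomorphism over one field yields a
  bijection between the two sets of walks that respects the blocks, and reindexing along this bijection is
  an isomorphism over every other coefficient ring (\<open>block_matrix_algebra_change_of_rings\<close>).
\<close>

section \<open>Arithmetic in the free algebra\<close>

lemma free_mult_word_Nil [simp]: "free_mult (word []) f = f" "free_mult f (word []) = f"
proof -
  have *: "\<And>u. Poly_Mapping.single u (Poly_Mapping.lookup f u) = free_mult (word []) (Poly_Mapping.single u (Poly_Mapping.lookup f u))"
     "\<And>u. Poly_Mapping.single u (Poly_Mapping.lookup f u) = free_mult (Poly_Mapping.single u (Poly_Mapping.lookup f u)) (word [])"
    by simp_all
  show "free_mult (word []) f = f"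
    by (subst (1 2) sum_single_keys[of f, symmetric]) (simp add: free_mult_sum_right)
  show "free_mult f (word []) = f"
    by (subst (1 2) sum_single_keys[of f, symmetric]) (simp add: free_mult_sum_left)
qed

lemma free_mult_single_Nil_commute:
  "free_mult f (Poly_Mapping.single [] c) = free_mult (Poly_Mapping.single [] c) f"
proof -
  have "free_mult (\<Sum>u\<in>A. Poly_Mapping.single u (a u)) (Poly_Mapping.single [] c)
      = free_mult (Poly_Mapping.single [] c) (\<Sum>u\<in>A. Poly_Mapping.single u (a u))" for A and a :: "'a list \<Rightarrow> 'b"
    by (simp add: free_mult_sum_left free_mult_sum_right mult.commute)
  from this[of "Poly_Mapping.lookup f" "Poly_Mapping.keys f"] show ?thesis
    by (simp only: sum_single_keys)
qed

lemma free_mult_minus_left: "free_mult (- f) g = - free_mult f g"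
  using free_mult_add_left[of "-f" f g] by (simp add: eq_neg_iff_add_eq_0)

lemma free_mult_minus_right: "free_mult f (- g) = - free_mult f g"
  using free_mult_add_right[of f "-g" g] by (simp add: eq_neg_iff_add_eq_0)

lemma free_mult_diff_left: "free_mult (f - f') g = free_mult f g - free_mult f' g"
  using free_mult_add_left[of f "-f'" g] by (simp add: free_mult_minus_left)

lemma free_mult_diff_right: "free_mult f (g - g') = free_mult f g - free_mult f g'"
  using free_mult_add_right[of f g "-g'"] by (simp add: free_mult_minus_right)

section \<open>Isomorphisms of algebras\<close>

definition algebra_iso where
  "algebra_iso R A B \<phi> \<longleftrightarrow> \<phi> \<in> module_hom R A B \<and> bij_betw \<phi> (carrier A) (carrier B) \<and>
     (\<forall>x\<in>carrier A. \<forall>y\<in>carrier A. \<phi> (x \<otimes>\<^bsub>A\<^esub> y) = \<phi> x \<otimes>\<^bsub>B\<^esub> \<phi> y)"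

lemma algebra_isomorphic_iff: "algebra_isomorphic R A B \<longleftrightarrow> (\<exists>\<phi>. algebra_iso R A B \<phi>)"
  by (auto simp: algebra_isomorphic_def algebra_iso_def)

lemma algebra_isoI:
  assumes "\<And>x y. x \<in> carrier A \<Longrightarrow> y \<in> carrier A \<Longrightarrow> \<phi> (x \<oplus>\<^bsub>A\<^esub> y) = \<phi> x \<oplus>\<^bsub>B\<^esub> \<phi> y"
    and "\<And>c x. c \<in> carrier R \<Longrightarrow> x \<in> carrier A \<Longrightarrow> \<phi> (c \<odot>\<^bsub>A\<^esub> x) = c \<odot>\<^bsub>B\<^esub> \<phi> x"
    and "\<And>x y. x \<in> carrier A \<Longrightarrow> y \<in> carrier A \<Longrightarrow> \<phi> (x \<otimes>\<^bsub>A\<^esub> y) = \<phi> x \<otimes>\<^bsub>B\<^esub> \<phi> y"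
    and "bij_betw \<phi> (carrier A) (carrier B)"
  shows "algebra_iso R A B \<phi>"
  unfolding algebra_iso_def module_hom_def using assms by (auto simp: bij_betw_def)

lemma algebra_isoD:
  assumes "algebra_iso R A B \<phi>"
  shows "bij_betw \<phi> (carrier A) (carrier B)"
    and "x \<in> carrier A \<Longrightarrow> \<phi> x \<in> carrier B"
    and "x \<in> carrier A \<Longrightarrow> y \<in> carrier A \<Longrightarrow> \<phi> (x \<oplus>\<^bsub>A\<^esub> y) = \<phi> x \<oplus>\<^bsub>B\<^esub> \<phi> y"
    and "c \<in> carrier R \<Longrightarrow> x \<in> carrier A \<Longrightarrow> \<phi> (c \<odot>\<^bsub>A\<^esub> x) = c \<odot>\<^bsub>B\<^esub> \<phi> x"
    and "x \<in> carrier A \<Longrightarrow> y \<in> carrier A \<Longrightarrow> \<phi> (x \<otimes>\<^bsub>A\<^esub> y) = \<phi> x \<otimes>\<^bsub>B\<^esub> \<phi> y"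
  using assms unfolding algebra_iso_def module_hom_def by auto

lemma algebra_isomorphic_trans:
  assumes "algebra_isomorphic R A B" "algebra_isomorphic R B C"
  shows "algebra_isomorphic R A C"
proof -
  obtain \<phi> \<psi> where \<phi>: "algebra_iso R A B \<phi>" and \<psi>: "algebra_iso R B C \<psi>"
    using assms by (auto simp: algebra_isomorphic_iff)
  have "algebra_iso R A C (\<psi> \<circ> \<phi>)"
    by (rule algebra_isoI)
      (simp_all add: algebra_isoD[OF \<phi>] algebra_isoD[OF \<psi>] bij_betw_trans[OF algebra_isoD(1)[OF \<phi>] algebra_isoD(1)[OF \<psi>]])
  then show ?thesis by (auto simp: algebra_isomorphic_iff)
qed

lemma algebra_iso_inv_into:
  assumes \<phi>: "algebra_iso R A B \<phi>"
    and closed: "\<And>x y. x \<in> carrier A \<Longrightarrow> y \<in> carrier A \<Longrightarrow> x \<oplus>\<^bsub>A\<^esub> y \<in> carrier A"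
      "\<And>c x. c \<in> carrier R \<Longrightarrow> x \<in> carrier A \<Longrightarrow> c \<odot>\<^bsub>A\<^esub> x \<in> carrier A"
      "\<And>x y. x \<in> carrier A \<Longrightarrow> y \<in> carrier A \<Longrightarrow> x \<otimes>\<^bsub>A\<^esub> y \<in> carrier A"
  shows "algebra_iso R B A (inv_into (carrier A) \<phi>)" (is "algebra_iso R B A ?\<psi>")
proof (rule algebra_isoI)
  note bij = algebra_isoD(1)[OF \<phi>]
  show "bij_betw ?\<psi> (carrier B) (carrier A)" using bij by (rule bij_betw_inv_into)
  have \<psi>: "?\<psi> y \<in> carrier A" "\<phi> (?\<psi> y) = y" if "y \<in> carrier B" for y
    using that bij unfolding bij_betw_def by (auto intro: inv_into_into f_inv_into_f)
  have eqI: "?\<psi> y = x" if "x \<in> carrier A" "\<phi> x = y" for x y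
    using that bij by (auto simp: bij_betw_def)
  show "?\<psi> (x \<oplus>\<^bsub>B\<^esub> y) = ?\<psi> x \<oplus>\<^bsub>A\<^esub> ?\<psi> y" if "x \<in> carrier B" "y \<in> carrier B" for x y
    by (rule eqI) (simp_all add: \<psi> closed that algebra_isoD[OF \<phi>])
  show "?\<psi> (c \<odot>\<^bsub>B\<^esub> y) = c \<odot>\<^bsub>A\<^esub> ?\<psi> y" if "c \<in> carrier R" "y \<in> carrier B" for c y
    by (rule eqI) (simp_all add: \<psi> closed that algebra_isoD[OF \<phi>])
  show "?\<psi> (x \<otimes>\<^bsub>B\<^esub> y) = ?\<psi> x \<otimes>\<^bsub>A\<^esub> ?\<psi> y" if "x \<in> carrier B" "y \<in> carrier B" for x y
    by (rule eqI) (simp_all add: \<psi> closed that algebra_isoD[OF \<phi>])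
qed

lemma algebra_isomorphic_sym:
  assumes "algebra_isomorphic R A B"
    and "\<And>x y. x \<in> carrier A \<Longrightarrow> y \<in> carrier A \<Longrightarrow> x \<oplus>\<^bsub>A\<^esub> y \<in> carrier A"
    and "\<And>c x. c \<in> carrier R \<Longrightarrow> x \<in> carrier A \<Longrightarrow> c \<odot>\<^bsub>A\<^esub> x \<in> carrier A"
    and "\<And>x y. x \<in> carrier A \<Longrightarrow> y \<in> carrier A \<Longrightarrow> x \<otimes>\<^bsub>A\<^esub> y \<in> carrier A"
  shows "algebra_isomorphic R B A"
  using assms(1) algebra_iso_inv_into[OF _ assms(2-)] unfolding algebra_isomorphic_iff by blast

text \<open>
  The first isomorphism theorem for algebras without unit.
\<close>

lemma quotient_algebra_isomorphic:
  fixes R (structure) and A and B and T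
  defines "I \<equiv> generated_ideal R A T"
  assumes "module R A" and "T \<subseteq> carrier A"
    and mult: "\<And>x y. x \<in> carrier A \<Longrightarrow> y \<in> carrier A \<Longrightarrow> x \<otimes>\<^bsub>A\<^esub> y \<in> carrier A"
    and distl: "\<And>x y z. x \<in> carrier A \<Longrightarrow> y \<in> carrier A \<Longrightarrow> z \<in> carrier A \<Longrightarrow> (x \<oplus>\<^bsub>A\<^esub> y) \<otimes>\<^bsub>A\<^esub> z = x \<otimes>\<^bsub>A\<^esub> z \<oplus>\<^bsub>A\<^esub> y \<otimes>\<^bsub>A\<^esub> z"
    and distr: "\<And>x y z. x \<in> carrier A \<Longrightarrow> y \<in> carrier A \<Longrightarrow> z \<in> carrier A \<Longrightarrow> z \<otimes>\<^bsub>A\<^esub> (x \<oplus>\<^bsub>A\<^esub> y) = z \<otimes>\<^bsub>A\<^esub> x \<oplus>\<^bsub>A\<^esub> z \<otimes>\<^bsub>A\<^esub> y"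
    and \<psi>_add: "\<And>x y. x \<in> carrier A \<Longrightarrow> y \<in> carrier A \<Longrightarrow> \<psi> (x \<oplus>\<^bsub>A\<^esub> y) = \<psi> x \<oplus>\<^bsub>B\<^esub> \<psi> y"
    and \<psi>_smult: "\<And>c x. c \<in> carrier R \<Longrightarrow> x \<in> carrier A \<Longrightarrow> \<psi> (c \<odot>\<^bsub>A\<^esub> x) = c \<odot>\<^bsub>B\<^esub> \<psi> x"
    and \<psi>_mult: "\<And>x y. x \<in> carrier A \<Longrightarrow> y \<in> carrier A \<Longrightarrow> \<psi> (x \<otimes>\<^bsub>A\<^esub> y) = \<psi> x \<otimes>\<^bsub>B\<^esub> \<psi> y"
    and surj: "\<psi> ` carrier A = carrier B"
    and kernel: "\<And>x y. x \<in> carrier A \<Longrightarrow> y \<in> carrier A \<Longrightarrow> \<psi> x = \<psi> y \<longleftrightarrow> x \<ominus>\<^bsub>A\<^esub> y \<in> I"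
  shows "algebra_isomorphic R (quotient_algebra A I) B"
proof -
  interpret module R A by fact
  interpret I: abelian_subgroup I A
    unfolding I_def by (rule generated_ideal_abelian_subgroup) (use assms in auto)
  let ?Q = "quotient_algebra A I"
  let ?c = "a_r_coset A I"
  note ops = quotient_algebra_coset_ops[OF \<open>module R A\<close> \<open>T \<subseteq> carrier A\<close> mult, folded I_def]
  have carr: "carrier ?Q = ?c ` carrier A"
    by (auto simp: quotient_algebra_def A_RCOSETS_def RCOSETS_def a_r_coset_def)
  have coset_eq: "?c x = ?c y \<longleftrightarrow> \<psi> x = \<psi> y" if "x \<in> carrier A" "y \<in> carrier A" for x y
  proof -
    have "?c x = ?c y \<longleftrightarrow> x \<in> ?c y"
      using that using M.a_repr_independence[OF _ _ I.a_subgroup] I.a_rcos_self by metis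
    also have "\<dots> \<longleftrightarrow> x \<ominus>\<^bsub>A\<^esub> y \<in> I"
      using that I.a_rcos_module by (simp add: a_minus_def)
    finally show ?thesis using kernel[OF that] by simp
  qed
  define \<phi> where "\<phi> C = \<psi> (SOME x. x \<in> carrier A \<and> ?c x = C)" for C
  have \<phi>: "\<phi> (?c x) = \<psi> x" if "x \<in> carrier A" for x
  proof -
    have "(SOME y. y \<in> carrier A \<and> ?c y = ?c x) \<in> carrier A \<and> ?c (SOME y. y \<in> carrier A \<and> ?c y = ?c x) = ?c x"
      by (rule someI[of _ x]) (use that in auto)
    then show ?thesis unfolding \<phi>_def using coset_eq that by blast
  qed
  have plus: "?c x \<oplus>\<^bsub>?Q\<^esub> ?c y = ?c (x \<oplus>\<^bsub>A\<^esub> y)" if "x \<in> carrier A" "y \<in> carrier A" for x y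
    using I.a_rcos_sum[OF that] by (simp add: quotient_algebra_def)
  have times: "?c x \<otimes>\<^bsub>?Q\<^esub> ?c y = ?c (x \<otimes>\<^bsub>A\<^esub> y)" if "x \<in> carrier A" "y \<in> carrier A" for x y
    using ops(3)[OF _ _ that distl distr] by (simp add: quotient_algebra_def)
  have scale: "c \<odot>\<^bsub>?Q\<^esub> ?c x = ?c (c \<odot>\<^bsub>A\<^esub> x)" if "c \<in> carrier R" "x \<in> carrier A" for x c
    by (rule ops(2)) (use that in auto)
  have "algebra_iso R ?Q B \<phi>"
  proof (rule algebra_isoI)
    show "bij_betw \<phi> (carrier ?Q) (carrier B)"
      unfolding bij_betw_def inj_on_def
      using surj by (auto simp: carr \<phi> coset_eq image_image)
  qed (use surj in \<open>auto simp: carr \<phi> plus times scale mult \<psi>_add \<psi>_smult \<psi>_mult\<close>)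
  then show ?thesis by (auto simp: algebra_isomorphic_iff)
qed

section \<open>Linear independence of functions\<close>

interpretation fun_space: vector_space "\<lambda>(c::'k::field) (f::'a \<Rightarrow> 'k) a. c * f a"
  by standard (auto simp: fun_eq_iff algebra_simps)

lemma sum_fun_apply: "(\<Sum>i\<in>I. f i) x = (\<Sum>i\<in>I. f i x)"
  by (induction I rule: infinite_finite_induct) auto

text \<open>
  The exchange lemma for families instead of sets of vectors: independence of the family includes its
  injectivity, so that the index set itself can be counted.
\<close>

lemma card_le_of_independent_family:
  fixes k :: "'i \<Rightarrow> 'a \<Rightarrow> 'k::field"
  assumes "finite T" "\<And>i. i \<in> S \<Longrightarrow> k i \<in> fun_space.span T"
    and indep: "\<And>J c i. finite J \<Longrightarrow> J \<subseteq> S \<Longrightarrow> (\<And>a. (\<Sum>i\<in>J. c i * k i a) = 0) \<Longrightarrow> i \<in> J \<Longrightarrow> c i = 0"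
  shows "finite S \<and> card S \<le> card T"
proof -
  have inj: "inj_on k S"
  proof
    fix i j assume ij: "i \<in> S" "j \<in> S" "k i = k j"
    show "i = j"
    proof (rule ccontr)
      assume "i \<noteq> j"
      then have "(1::'k) = 0"
        using indep[of "{i, j}" "\<lambda>l. if l = i then 1 else -1" i] ij by auto
      then show False by simp
    qed
  qed
  have "fun_space.independent (k ` S)"
    unfolding fun_space.independent_explicit_finite_subsets
  proof (intro allI impI ballI)
    fix U u v assume U: "U \<subseteq> k ` S" "finite U" and sum: "(\<Sum>v\<in>U. (\<lambda>a. u v * v a)) = 0" and v: "v \<in> U"
    obtain J where J: "J \<subseteq> S" "U = k ` J" using U(1) by (auto simp: subset_image_iff)
    have injJ: "inj_on k J" using inj J(1) by (rule inj_on_subset)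
    then have fin: "finite J" using U(2) J(2) by (simp add: finite_image_iff)
    obtain i where i: "i \<in> J" "v = k i" using v J(2) by auto
    have "(\<Sum>i\<in>J. u (k i) * k i a) = 0" for a
      using fun_cong[OF sum, of a] by (simp add: J(2) sum.reindex[OF injJ] sum_fun_apply)
    from indep[OF fin J(1) this i(1)] show "u v = 0" using i(2) by simp
  qed
  then have "finite (k ` S) \<and> card (k ` S) \<le> card T"
    using assms(1,2) by (intro fun_space.independent_span_bound) auto
  then show ?thesis using inj by (simp add: card_image finite_image_iff)
qed

section \<open>Branching systems\<close>

text \<open>
  If every word \<open>u\<close> acts on points by a relation \<open>\<rho> u\<close>, then a linear combination of words acts on
  functions on the points, and its kernel lists the matrix entries of this operator.
\<close>

definition rel_kernel :: "('w \<Rightarrow> ('x \<times> 'x) set) \<Rightarrow> ('w \<Rightarrow>\<^sub>0 'r::comm_ring_1) \<Rightarrow> 'x \<Rightarrow> 'x \<Rightarrow> 'r" where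
  "rel_kernel \<rho> f x y = (\<Sum>u\<in>Poly_Mapping.keys f. if (x, y) \<in> \<rho> u then Poly_Mapping.lookup f u else 0)"

lemma rel_kernel_alt:
  assumes "finite A" "Poly_Mapping.keys f \<subseteq> A"
  shows "rel_kernel \<rho> f x y = (\<Sum>u\<in>A. if (x, y) \<in> \<rho> u then Poly_Mapping.lookup f u else 0)"
  unfolding rel_kernel_def using assms by (intro sum.mono_neutral_left) (auto simp: in_keys_iff)

lemma rel_kernel_add: "rel_kernel \<rho> (f + g) x y = rel_kernel \<rho> f x y + rel_kernel \<rho> g x y"
proof -
  let ?A = "Poly_Mapping.keys f \<union> Poly_Mapping.keys g"
  have "Poly_Mapping.keys (f + g) \<subseteq> ?A" by (rule Poly_Mapping.keys_add)
  then have "rel_kernel \<rho> (f + g) x y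
      = (\<Sum>u\<in>?A. if (x, y) \<in> \<rho> u then Poly_Mapping.lookup f u + Poly_Mapping.lookup g u else 0)"
    by (simp add: rel_kernel_alt[of ?A] lookup_add cong: if_cong)
  also have "\<dots> = rel_kernel \<rho> f x y + rel_kernel \<rho> g x y"
    unfolding rel_kernel_alt[of ?A f, simplified] rel_kernel_alt[of ?A g, simplified] sum.distrib[symmetric]
    by (intro sum.cong) auto
  finally show ?thesis .
qed

lemma rel_kernel_0 [simp]: "rel_kernel \<rho> 0 x y = 0"
  by (simp add: rel_kernel_def)

lemma rel_kernel_sum: "rel_kernel \<rho> (\<Sum>i\<in>I. f i) x y = (\<Sum>i\<in>I. rel_kernel \<rho> (f i) x y)"
  by (induction I rule: infinite_finite_induct) (simp_all add: rel_kernel_add)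

lemma rel_kernel_uminus: "rel_kernel \<rho> (- f) x y = - rel_kernel \<rho> f x y"
  using rel_kernel_add[of \<rho> "-f" f x y] by (simp add: eq_neg_iff_add_eq_0)

lemma rel_kernel_diff: "rel_kernel \<rho> (f - g) x y = rel_kernel \<rho> f x y - rel_kernel \<rho> g x y"
  using rel_kernel_add[of \<rho> f "-g" x y] by (simp add: rel_kernel_uminus)

lemma rel_kernel_single [simp]: "rel_kernel \<rho> (Poly_Mapping.single u c) x y = (if (x, y) \<in> \<rho> u then c else 0)"
  by (subst rel_kernel_alt[of "{u}"]) auto

text \<open>
  The points with source \<open>v\<close> form a set \<open>D v\<close>, and \<open>ext e\<close> embeds \<open>D (head e)\<close> into \<open>D (tail e)\<close>, with
  disjoint images for different edges.  For \<open>v \<in> XE\<close> the images of the edges leaving \<open>v\<close> exhaust \<open>D v\<close>.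
  These are exactly the conditions under which the relations of the Cohn path algebra hold when a vertex
  acts as the identity of \<open>D v\<close>, an edge as \<open>ext e\<close>, and a ghost edge as the partial inverse of \<open>ext e\<close>.
\<close>

locale branching_system = wf_digraph E for E :: "('v, 'e) pre_digraph" +
  fixes XE :: "'v set" and \<Omega> :: "'x set" and src :: "'x \<Rightarrow> 'v" and ext :: "'e \<Rightarrow> 'x \<Rightarrow> 'x"
  assumes XE_regular: "XE \<subseteq> regular_verts E"
    and ext_closed: "\<lbrakk>e \<in> arcs E; y \<in> \<Omega>; src y = head E e\<rbrakk> \<Longrightarrow> ext e y \<in> \<Omega>"
    and src_ext: "\<lbrakk>e \<in> arcs E; y \<in> \<Omega>; src y = head E e\<rbrakk> \<Longrightarrow> src (ext e y) = tail E e"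
    and ext_inj: "\<lbrakk>e \<in> arcs E; y \<in> \<Omega>; src y = head E e; e' \<in> arcs E; y' \<in> \<Omega>; src y' = head E e';
      ext e y = ext e' y'\<rbrakk> \<Longrightarrow> e = e' \<and> y = y'"
    and ext_cover: "\<lbrakk>x \<in> \<Omega>; src x \<in> XE\<rbrakk> \<Longrightarrow>
      \<exists>e\<in>out_arcs E (src x). \<exists>y\<in>\<Omega>. src y = head E e \<and> x = ext e y"
begin

fun gen_rel :: "('v, 'e) cohn_gen \<Rightarrow> ('x \<times> 'x) set" where
  "gen_rel (Vert v) = {(x, x) | x. x \<in> \<Omega> \<and> src x = v}"
| "gen_rel (Edge e) = {(ext e y, y) | y. e \<in> arcs E \<and> y \<in> \<Omega> \<and> src y = head E e}"
| "gen_rel (Ghost e) = {(y, ext e y) | y. e \<in> arcs E \<and> y \<in> \<Omega> \<and> src y = head E e}"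

primrec word_rel :: "('v, 'e) cohn_gen list \<Rightarrow> ('x \<times> 'x) set" where
  "word_rel [] = Id_on \<Omega>"
| "word_rel (g # u) = gen_rel g O word_rel u"

abbreviation K :: "(('v, 'e) cohn_gen list \<Rightarrow>\<^sub>0 'r::comm_ring_1) \<Rightarrow> 'x \<Rightarrow> 'x \<Rightarrow> 'r" where
  "K \<equiv> rel_kernel word_rel"

lemma gen_rel_subset: "gen_rel g \<subseteq> \<Omega> \<times> \<Omega>"
  by (cases g) (auto simp: ext_closed)

lemma gen_rel_unique:
  "(x, y) \<in> gen_rel g \<Longrightarrow> (x, y') \<in> gen_rel g \<Longrightarrow> y = y'"
  "(x, y) \<in> gen_rel g \<Longrightarrow> (x', y) \<in> gen_rel g \<Longrightarrow> x = x'"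
  by (cases g; auto dest: ext_inj)+

lemma word_rel_subset: "word_rel u \<subseteq> \<Omega> \<times> \<Omega>"
proof (induction u)
  case (Cons g u)
  then show ?case using gen_rel_subset[of g] by auto
qed auto

lemma word_rel_unique_right: "(x, y) \<in> word_rel u \<Longrightarrow> (x, y') \<in> word_rel u \<Longrightarrow> y = y'"
proof (induction u arbitrary: x)
  case (Cons g u)
  then show ?case by (auto dest: gen_rel_unique(1))
qed auto

lemma word_rel_unique_left: "(x, y) \<in> word_rel u \<Longrightarrow> (x', y) \<in> word_rel u \<Longrightarrow> x = x'"
proof (induction u arbitrary: x x')
  case (Cons g u)
  from Cons.prems obtain z where z: "(x, z) \<in> gen_rel g" "(z, y) \<in> word_rel u" by auto
  from Cons.prems obtain z' where z': "(x', z') \<in> gen_rel g" "(z', y) \<in> word_rel u" by auto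
  have "z = z'" using Cons.IH z z' by blast
  then show ?case using gen_rel_unique(2) z z' by blast
qed auto

lemma word_rel_append: "word_rel (u @ v) = word_rel u O word_rel v"
proof (induction u)
  case Nil
  show ?case using word_rel_subset[of v] by auto
qed (simp add: O_assoc)

lemma word_rel_singleton [simp]: "word_rel [g] = gen_rel g"
  using gen_rel_subset[of g] by auto

lemma word_rel_pair [simp]: "word_rel [g, h] = gen_rel g O gen_rel h"
  using word_rel_append[of "[g]" "[h]"] unfolding append.simps word_rel_singleton .

text \<open>
  Words act by partial injections, so multiplying by a word from the left moves the rows of a kernel.
  No finiteness of the set of points is required, in contrast to a general matrix product.
\<close>

lemma K_mult_single_left:
  "(x, z) \<in> word_rel u \<Longrightarrow> K (free_mult (Poly_Mapping.single u c) f) x y = c * K f z y"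
  "x \<notin> Domain (word_rel u) \<Longrightarrow> K (free_mult (Poly_Mapping.single u c) f) x y = 0"
proof -
  have eq: "K (free_mult (Poly_Mapping.single u c) f) x y
      = (\<Sum>v\<in>Poly_Mapping.keys f. if (x, y) \<in> word_rel u O word_rel v then c * Poly_Mapping.lookup f v else 0)"
    by (subst free_mult_alt[of "{u}" _ "Poly_Mapping.keys f"]) (auto simp: rel_kernel_sum word_rel_append)
  show "K (free_mult (Poly_Mapping.single u c) f) x y = c * K f z y" if "(x, z) \<in> word_rel u"
  proof -
    have "(x, y) \<in> word_rel u O word_rel v \<longleftrightarrow> (z, y) \<in> word_rel v" for v
      using that word_rel_unique_right by blast
    then show ?thesis
      unfolding eq by (auto simp: rel_kernel_def sum_distrib_left intro!: sum.cong)
  qed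
  show "K (free_mult (Poly_Mapping.single u c) f) x y = 0" if "x \<notin> Domain (word_rel u)"
    unfolding eq using that by (intro sum.neutral) auto
qed

lemma K_mult_single_right:
  "(z, y) \<in> word_rel u \<Longrightarrow> K (free_mult f (Poly_Mapping.single u c)) x y = K f x z * c"
  "y \<notin> Range (word_rel u) \<Longrightarrow> K (free_mult f (Poly_Mapping.single u c)) x y = 0"
proof -
  have eq: "K (free_mult f (Poly_Mapping.single u c)) x y
      = (\<Sum>v\<in>Poly_Mapping.keys f. if (x, y) \<in> word_rel v O word_rel u then Poly_Mapping.lookup f v * c else 0)"
    by (subst free_mult_alt[of "Poly_Mapping.keys f" _ "{u}"]) (auto simp: rel_kernel_sum word_rel_append)
  show "K (free_mult f (Poly_Mapping.single u c)) x y = K f x z * c" if "(z, y) \<in> word_rel u"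
  proof -
    have "(x, y) \<in> word_rel v O word_rel u \<longleftrightarrow> (x, z) \<in> word_rel v" for v
      using that word_rel_unique_left by blast
    then show ?thesis
      unfolding eq by (auto simp: rel_kernel_def sum_distrib_right intro!: sum.cong)
  qed
  show "K (free_mult f (Poly_Mapping.single u c)) x y = 0" if "y \<notin> Range (word_rel u)"
    unfolding eq using that by (intro sum.neutral) auto
qed

lemma K_smult: "K (Poly_Mapping.map (\<lambda>x. c * x) f) x y = c * K f x y"
proof (cases "x \<in> \<Omega>")
  case True
  then show ?thesis
    unfolding smult_conv by (intro K_mult_single_left(1)) auto
next
  case False
  then have "K f x y = 0"
    unfolding rel_kernel_def using word_rel_subset by (intro sum.neutral) auto
  then show ?thesis
    unfolding smult_conv using False by (subst K_mult_single_left(2)) auto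
qed

lemma K_mult_zero:
  assumes "K f = (\<lambda>_ _. 0)"
  shows "K (free_mult a f) = (\<lambda>_ _. 0)" "K (free_mult f a) = (\<lambda>_ _. 0)"
proof -
  have "K (free_mult (Poly_Mapping.single u c) f) x y = 0" for u c x y
    using assms K_mult_single_left[where x=x and u=u and c=c and f=f and y=y] by (cases "x \<in> Domain (word_rel u)") auto
  then have "K (free_mult (\<Sum>u\<in>Poly_Mapping.keys a. Poly_Mapping.single u (Poly_Mapping.lookup a u)) f) x y = 0" for x y
    by (simp add: free_mult_sum_left rel_kernel_sum)
  then show "K (free_mult a f) = (\<lambda>_ _. 0)" by (simp add: sum_single_keys fun_eq_iff)
  have "K (free_mult f (Poly_Mapping.single u c)) x y = 0" for u c x y
    using assms K_mult_single_right[where x=x and u=u and c=c and f=f and y=y] by (cases "y \<in> Range (word_rel u)") auto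
  then have "K (free_mult f (\<Sum>u\<in>Poly_Mapping.keys a. Poly_Mapping.single u (Poly_Mapping.lookup a u))) x y = 0" for x y
    by (simp add: free_mult_sum_right rel_kernel_sum)
  then show "K (free_mult f a) = (\<lambda>_ _. 0)" by (simp add: sum_single_keys fun_eq_iff)
qed

text \<open>
  The operator of \<open>v - \<Sum> e e\<^sup>*\<close> is the projection to those points of \<open>D v\<close> that are not an extension
  along any edge.
\<close>

lemma K_vertex_defect:
  fixes x y
  defines "d v \<equiv> (word [Vert v] - (\<Sum>e\<in>out_arcs E v. word [Edge e, Ghost e]) :: ('v, 'e) cohn_gen list \<Rightarrow>\<^sub>0 'r::comm_ring_1)"
  assumes fin: "finite (out_arcs E v)"
  shows "K (d v) x y = (if x = y \<and> x \<in> \<Omega> \<and> src x = v \<and>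
    \<not> (\<exists>e\<in>out_arcs E v. \<exists>z\<in>\<Omega>. src z = head E e \<and> x = ext e z) then 1 else 0)"
proof -
  have rel: "(x, y) \<in> gen_rel (Edge e) O gen_rel (Ghost e) \<longleftrightarrow>
      x = y \<and> (\<exists>z\<in>\<Omega>. src z = head E e \<and> x = ext e z)" if "e \<in> out_arcs E v" for e
    using that by auto
  have eq: "K (d v) x y = (if x = y \<and> x \<in> \<Omega> \<and> src x = v then 1 else 0)
      - (\<Sum>e\<in>out_arcs E v. if x = y \<and> (\<exists>z\<in>\<Omega>. src z = head E e \<and> x = ext e z) then 1 else 0)"
    unfolding d_def rel_kernel_diff rel_kernel_sum using rel
    by (intro arg_cong2[of _ _ _ _ "(-)"] sum.cong) (auto simp del: word_rel.simps(2))
  show ?thesis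
  proof (cases "x = y \<and> (\<exists>e\<in>out_arcs E v. \<exists>z\<in>\<Omega>. src z = head E e \<and> x = ext e z)")
    case True
    then obtain e z where e: "e \<in> out_arcs E v" and z: "z \<in> \<Omega>" "src z = head E e" "x = ext e z" by blast
    have "(\<Sum>e'\<in>out_arcs E v. if x = y \<and> (\<exists>z\<in>\<Omega>. src z = head E e' \<and> x = ext e' z) then 1 else 0)
        = (\<Sum>e'\<in>out_arcs E v. if e' = e then 1 else (0::'r))"
    proof (intro sum.cong refl)
      fix e' assume e': "e' \<in> out_arcs E v"
      have "(\<exists>z\<in>\<Omega>. src z = head E e' \<and> x = ext e' z) \<longleftrightarrow> e' = e"
        using e e' z ext_inj by auto
      then show "(if x = y \<and> (\<exists>z\<in>\<Omega>. src z = head E e' \<and> x = ext e' z) then 1 else 0) = (if e' = e then 1 else (0::'r))"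
        using True by simp
    qed
    also have "\<dots> = 1" using fin e by simp
    finally show ?thesis
      unfolding eq using True e z ext_closed src_ext by auto
  next
    case False
    then have "(\<Sum>e\<in>out_arcs E v. if x = y \<and> (\<exists>z\<in>\<Omega>. src z = head E e \<and> x = ext e z) then 1 else 0) = (0::'r)"
      by (intro sum.neutral) auto
    then show ?thesis unfolding eq using False by auto
  qed
qed

lemma K_relator:
  assumes "f \<in> cohn_relators E XE"
  shows "K f = (\<lambda>_ _. 0)"
proof -
  note two = word_rel_pair
  show ?thesis
    using assms
  proof cases
    case (V v w)
    have "gen_rel (Vert v) O gen_rel (Vert w) = (if v = w then gen_rel (Vert v) else {})" by auto
    then show ?thesis unfolding V(1) by (auto simp: fun_eq_iff rel_kernel_diff two simp del: word_rel.simps(2))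
  next
    case (E1_source e)
    have "gen_rel (Vert (tail E e)) O gen_rel (Edge e) = gen_rel (Edge e)"
      using ext_closed src_ext by auto
    then show ?thesis unfolding E1_source(1) by (simp add: fun_eq_iff rel_kernel_diff two del: word_rel.simps(2) gen_rel.simps)
  next
    case (E1_range e)
    have "gen_rel (Edge e) O gen_rel (Vert (head E e)) = gen_rel (Edge e)" by auto
    then show ?thesis unfolding E1_range(1) by (simp add: fun_eq_iff rel_kernel_diff two del: word_rel.simps(2) gen_rel.simps)
  next
    case (E2_range e)
    have "gen_rel (Vert (head E e)) O gen_rel (Ghost e) = gen_rel (Ghost e)" by auto
    then show ?thesis unfolding E2_range(1) by (simp add: fun_eq_iff rel_kernel_diff two del: word_rel.simps(2) gen_rel.simps)
  next
    case (E2_source e)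
    have "gen_rel (Ghost e) O gen_rel (Vert (tail E e)) = gen_rel (Ghost e)"
      using ext_closed src_ext by auto
    then show ?thesis unfolding E2_source(1) by (simp add: fun_eq_iff rel_kernel_diff two del: word_rel.simps(2) gen_rel.simps)
  next
    case (CK1 e f)
    have "gen_rel (Ghost e) O gen_rel (Edge f) = (if e = f then gen_rel (Vert (head E e)) else {})"
      using CK1(2,3) ext_inj by (auto; blast)
    then show ?thesis unfolding CK1(1) by (simp add: fun_eq_iff rel_kernel_diff two del: word_rel.simps(2) gen_rel.simps)
  next
    case (XCK2 v)
    then have "finite (out_arcs E v)" using XE_regular by (auto simp: regular_verts_def)
    then show ?thesis unfolding XCK2(1) using ext_cover XCK2(2) by (auto simp: fun_eq_iff K_vertex_defect)
  qed
qed

lemma K_ideal: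
  assumes "f \<in> generated_ideal class_ring (free_algebra (cohn_gens E)) (cohn_relators E XE)"
  shows "K f = (\<lambda>_ _. 0)"
  using assms
proof induction
  case zero
  show ?case by (simp add: free_algebra_def fun_eq_iff)
next
  case (incl t)
  then show ?case by (rule K_relator)
next
  case (add x y)
  then show ?case by (simp add: free_algebra_def rel_kernel_add fun_eq_iff)
next
  case (smult c x)
  then show ?case by (simp add: free_algebra_def K_smult fun_eq_iff)
next
  case (mult_left a x)
  then show ?case by (simp add: free_algebra_mult K_mult_zero)
next
  case (mult_right a x)
  then show ?case by (simp add: free_algebra_mult K_mult_zero)
qed

end

section \<open>Walks are linearly independent\<close>

text \<open>
  The start vertex is recorded so that the trivial walks at different vertices are different.
\<close>

definition walks :: "('v, 'e) pre_digraph \<Rightarrow> ('v \<times> 'e list) set" where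
  "walks E = {(u, es) | u es. \<exists>v. pre_digraph.awalk E u es v}"

definition walk_end :: "('v, 'e) pre_digraph \<Rightarrow> 'v \<times> 'e list \<Rightarrow> 'v" where
  "walk_end E p = last (pre_digraph.awalk_verts E (fst p) (snd p))"

context wf_digraph
begin

lemma walks_Nil [simp]: "(u, []) \<in> walks G \<longleftrightarrow> u \<in> verts G"
  by (auto simp: walks_def awalk_Nil_iff)

lemma walks_Cons [simp]: "(u, e # es) \<in> walks G \<longleftrightarrow> e \<in> arcs G \<and> u = tail G e \<and> (head G e, es) \<in> walks G"
  by (auto simp: walks_def awalk_Cons_iff)

lemma walk_end_Nil [simp]: "walk_end G (u, []) = u"
  by (simp add: walk_end_def)

lemma walk_end_Cons [simp]: "walk_end G (u, e # es) = walk_end G (head G e, es)"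
  by (simp add: walk_end_def)

lemma walks_verts:
  "(u, es) \<in> walks G \<Longrightarrow> u \<in> verts G"
  "(u, es) \<in> walks G \<Longrightarrow> walk_end G (u, es) \<in> verts G"
  "(u, es) \<in> walks G \<Longrightarrow> set es \<subseteq> arcs G"
  by (induction es arbitrary: u) auto

end

context branching_system
begin

text \<open>
  Every walk acts nontrivially: each point at its end can be pulled back along its edges.
\<close>

lemma word_rel_walk_exists:
  assumes "(u, es) \<in> walks E" "y \<in> \<Omega>" "src y = walk_end E (u, es)"
  shows "\<exists>x. (x, y) \<in> word_rel (Vert u # map Edge es)"
  using assms
proof (induction es arbitrary: u)
  case (Cons e es)
  then have "(head E e, es) \<in> walks E" "src y = walk_end E (head E e, es)" by simp_all
  then obtain x where "(x, y) \<in> word_rel (Vert (head E e) # map Edge es)"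
    using Cons.IH Cons.prems(2) by blast
  then have x: "x \<in> \<Omega>" "src x = head E e" "(x, y) \<in> word_rel (map Edge es)" by auto
  then have "(ext e x, y) \<in> word_rel (map Edge (e # es))" using Cons.prems(1) by auto
  moreover have "ext e x \<in> \<Omega>" "src (ext e x) = u" using x Cons.prems(1) ext_closed src_ext by auto
  ultimately show ?case by (intro exI[of _ "ext e x"]) auto
qed auto

lemma word_rel_edges_inj:
  assumes "length es = length es'" "(x, y) \<in> word_rel (map Edge es)" "(x, y') \<in> word_rel (map Edge es')"
  shows "es = es'"
  using assms by (induction es es' arbitrary: x rule: list_induct2) (auto dest: ext_inj)

text \<open>
  The degree of the points recovers the length of a walk from the pairs of points that it relates;
  among the walks of one length, disjointness of the images of different edges recovers the edges
  themselves.  Hence no pair of points is related by two walks, and each coefficient of a linear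
  combination of walks is an entry of its kernel.
\<close>

lemma walk_kernels_independent:
  fixes deg :: "'x \<Rightarrow> int" and c :: "'v \<times> 'e list \<Rightarrow> 'r::comm_ring_1"
  assumes deg: "\<And>e y. deg (ext e y) = deg y + 1"
    and surj: "verts E \<subseteq> src ` \<Omega>"
    and J: "finite J" "J \<subseteq> walks E"
    and sum: "\<And>x y. (\<Sum>(u, es)\<in>J. c (u, es) * K (word (Vert u # map Edge es)) x y) = 0"
    and p: "p \<in> J"
  shows "c p = 0"
proof -
  have deg_word: "deg x = deg y + int (length es)" if "(x, y) \<in> word_rel (map Edge es)" for x y es
    using that by (induction es arbitrary: x) (auto simp: deg)
  obtain u es where p_eq: "p = (u, es)" by (cases p)
  then have walk: "(u, es) \<in> walks E" using p J by auto
  then obtain y where y: "y \<in> \<Omega>" "src y = walk_end E (u, es)" using walks_verts(2) surj by (metis image_iff subsetD)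
  then obtain x where x: "(x, y) \<in> word_rel (Vert u # map Edge es)"
    using word_rel_walk_exists walk by blast
  have only: "u' = u \<and> es' = es" if "(x, y) \<in> word_rel (Vert u' # map Edge es')" for u' es'
  proof -
    have "(x, y) \<in> word_rel (map Edge es)" "(x, y) \<in> word_rel (map Edge es')" "u' = u"
      using x that by auto
    then show ?thesis using deg_word[of x y es] deg_word[of x y es'] word_rel_edges_inj[of es es' x y y] by auto
  qed
  have "(\<Sum>(u, es)\<in>J. c (u, es) * K (word (Vert u # map Edge es)) x y) = (\<Sum>q\<in>J. if q = p then c q else 0)"
  proof (rule sum.cong[OF refl])
    fix q assume "q \<in> J"
    obtain u' es' where q: "q = (u', es')" by (cases q)
    have "(x, y) \<in> word_rel (Vert u' # map Edge es') \<longleftrightarrow> q = p"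
      using only[of u' es'] x unfolding q p_eq by blast
    then show "(case q of (u, es) \<Rightarrow> c (u, es) * K (word (Vert u # map Edge es)) x y) = (if q = p then c q else 0)"
      unfolding q by (simp del: word_rel.simps)
  qed
  then show "c p = 0" using sum[of x y] J(1) p by simp
qed

end

text \<open>
  At a vertex in \<open>X\<close>, the copies of the set of lists that belong to the outgoing edges have to fill one
  copy of it.  This is possible since a set of edges is no larger than the infinite set of lists over it.
\<close>

lemma infinite_list_absorbs_factor:
  assumes "S \<noteq> {}"
  shows "\<exists>h :: 'e \<Rightarrow> 'e list \<Rightarrow> 'e list. bij_betw (\<lambda>(e, l). h e l) (S \<times> UNIV) UNIV"
proof -
  have inf: "\<not> finite (UNIV :: 'e list set)" by (rule infinite_UNIV_listI)
  have le: "(card_of S, card_of (UNIV :: 'e list set)) \<in> ordLeq"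
    by (rule card_of_ordLeqI[of "\<lambda>e. [e]"]) (auto intro: inj_onI)
  from conjunct2[OF card_of_Times_infinite[OF inf assms le]]
  have "\<exists>f. bij_betw f (S \<times> (UNIV :: 'e list set)) (UNIV :: 'e list set)"
    unfolding card_of_ordIso .
  then obtain f where "bij_betw f (S \<times> (UNIV :: 'e list set)) (UNIV :: 'e list set)" ..
  then show ?thesis by (intro exI[of _ "\<lambda>e l. f (e, l)"]) simp
qed

text \<open>
  All the sets \<open>D v\<close> are copies of one infinite set, so every vertex acts nontrivially.  The integer
  component counts the edges; without it, the loop of a graph with one vertex and one edge could act as
  the identity.
\<close>

lemma graded_branching_system_exists:
  fixes E :: "('v, 'e) pre_digraph"
  assumes "wf_digraph E" "XE \<subseteq> regular_verts E"
  obtains h :: "'e \<Rightarrow> 'e list \<Rightarrow> 'e list" where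
    "branching_system E XE (verts E \<times> UNIV) (fst :: 'v \<times> 'e list \<times> int \<Rightarrow> 'v)
      (\<lambda>e (v, l, d). (tail E e, h e l, d + 1))"
proof -
  interpret wf_digraph E by fact
  have "\<exists>h :: 'e \<Rightarrow> 'e list \<Rightarrow> 'e list. inj_on (\<lambda>(e, l). h e l) (out_arcs E v \<times> UNIV) \<and>
      (v \<in> XE \<longrightarrow> (\<lambda>(e, l). h e l) ` (out_arcs E v \<times> UNIV) = UNIV)" for v
  proof (cases "v \<in> XE")
    case True
    then have "out_arcs E v \<noteq> {}"
      using assms(2) by (auto simp: regular_verts_def)
    from infinite_list_absorbs_factor[OF this]
    obtain h :: "'e \<Rightarrow> 'e list \<Rightarrow> 'e list" where "bij_betw (\<lambda>(e, l). h e l) (out_arcs E v \<times> UNIV) UNIV" ..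
    then show ?thesis by (intro exI[of _ h]) (simp add: bij_betw_def)
  next
    case False
    then show ?thesis by (intro exI[of _ Cons]) (auto simp: inj_on_def)
  qed
  then have "\<forall>v. \<exists>h :: 'e \<Rightarrow> 'e list \<Rightarrow> 'e list. inj_on (\<lambda>(e, l). h e l) (out_arcs E v \<times> UNIV) \<and>
      (v \<in> XE \<longrightarrow> (\<lambda>(e, l). h e l) ` (out_arcs E v \<times> UNIV) = UNIV)" ..
  from choice[OF this] obtain H :: "'v \<Rightarrow> 'e \<Rightarrow> 'e list \<Rightarrow> 'e list" where
    H_all: "\<forall>v. inj_on (\<lambda>(e, l). H v e l) (out_arcs E v \<times> UNIV) \<and>
      (v \<in> XE \<longrightarrow> (\<lambda>(e, l). H v e l) ` (out_arcs E v \<times> UNIV) = UNIV)" ..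
  have H: "inj_on (\<lambda>(e, l). H v e l) (out_arcs E v \<times> UNIV)"
      "v \<in> XE \<Longrightarrow> (\<lambda>(e, l). H v e l) ` (out_arcs E v \<times> UNIV) = UNIV" for v
    using H_all[rule_format, of v] by blast+
  have "branching_system E XE (verts E \<times> UNIV) (fst :: 'v \<times> 'e list \<times> int \<Rightarrow> 'v)
      (\<lambda>e (v, l, d). (tail E e, H (tail E e) e l, d + 1))"
  proof unfold_locales
    show "XE \<subseteq> regular_verts E" by fact
  next
    fix e e' and y y' :: "'v \<times> 'e list \<times> int"
    assume e: "e \<in> arcs E" "e' \<in> arcs E" and y: "fst y = head E e" "fst y' = head E e'"
      and eq: "(\<lambda>(v, l, d). (tail E e, H (tail E e) e l, d + 1)) y
        = (\<lambda>(v, l, d). (tail E e', H (tail E e') e' l, d + 1)) y'"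
    obtain v l d v' l' d' where y_eq: "y = (v, l, d)" "y' = (v', l', d')" by (cases y, cases y') auto
    have tail: "tail E e = tail E e'" and "H (tail E e) e l = H (tail E e') e' l'"
      using eq unfolding y_eq prod.case prod.inject by blast+
    then have "H (tail E e) e l = H (tail E e) e' l'" by metis
    moreover have "(e, l) \<in> out_arcs E (tail E e) \<times> UNIV" "(e', l') \<in> out_arcs E (tail E e) \<times> UNIV"
      using e tail by simp_all
    ultimately have "(e, l) = (e', l')"
      using inj_onD[OF H(1)[of "tail E e"], of "(e, l)" "(e', l')", unfolded prod.case] by metis
    then show "e = e' \<and> y = y'" using y eq by (auto simp: y_eq)
  next
    fix x :: "'v \<times> 'e list \<times> int"
    assume x: "fst x \<in> XE"
    obtain v l d where x_eq: "x = (v, l, d)" by (cases x) auto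
    have "v \<in> XE" using x unfolding x_eq by simp
    from H(2)[OF this] have "l \<in> (\<lambda>(e, l). H v e l) ` (out_arcs E v \<times> UNIV)" by (simp only: UNIV_I)
    then obtain a where a: "l = (\<lambda>(e, l). H v e l) a" "a \<in> out_arcs E v \<times> UNIV" by (rule imageE)
    obtain e l' where "a = (e, l')" by (cases a)
    with a have e: "e \<in> out_arcs E v" "H v e l' = l" by simp_all
    then show "\<exists>e\<in>out_arcs E (fst x). \<exists>y\<in>verts E \<times> UNIV. fst y = head E e \<and>
        x = (\<lambda>(v, l, d). (tail E e, H (tail E e) e l, d + 1)) y"
      unfolding x_eq by (intro bexI[of _ e] bexI[of _ "(head E e, l', d - 1)"]) simp_all
  qed (simp_all add: case_prod_unfold mem_Times_iff)
  then show ?thesis by (rule that[of "\<lambda>e. H (tail E e) e"])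
qed

text \<open>
  The kernel factors through the quotient, so the kernels of all elements lie in the span of finitely
  many of them.  The kernels of walks are independent.
\<close>

lemma fin_dim_cohn_path_algebra_imp_finite_walks:
  fixes E :: "('v, 'e) pre_digraph"
  assumes wf: "wf_digraph E" and XE: "XE \<subseteq> regular_verts E"
    and fin: "vectorspace.fin_dim class_ring (cohn_path_algebra TYPE('k::field) E XE)"
  shows "finite (walks E)"
proof -
  obtain h :: "'e \<Rightarrow> 'e list \<Rightarrow> 'e list" where
    "branching_system E XE (verts E \<times> UNIV) (fst :: 'v \<times> 'e list \<times> int \<Rightarrow> 'v) (\<lambda>e (v, l, d). (tail E e, h e l, d + 1))"
    using graded_branching_system_exists[OF wf XE] .
  then interpret branching_system E XE "verts E \<times> UNIV" "fst :: 'v \<times> 'e list \<times> int \<Rightarrow> 'v" "\<lambda>e (v, l, d). (tail E e, h e l, d + 1)" .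
  define F where "F = (free_algebra (cohn_gens E) :: ('k, _) module)"
  define I where "I = generated_ideal class_ring F (cohn_relators E XE)"
  define V where "V = cohn_path_algebra TYPE('k) E XE"
  have V_eq: "V = quotient_algebra F I" by (simp add: V_def I_def F_def cohn_path_algebra_def)
  interpret V: vectorspace "class_ring :: 'k ring" V
    unfolding V_def by (rule vectorspace_cohn_path_algebra[OF wf XE])
  note F_facts = module_free_algebra[of "cohn_gens E", where ?'r='k, folded F_def]
    cohn_relators_closed[OF wf XE, where ?'r='k, folded F_def]
  have mult: "x \<otimes>\<^bsub>F\<^esub> y \<in> carrier F" if "x \<in> carrier F" "y \<in> carrier F" for x y
    using that unfolding F_def free_algebra_mult by (rule free_mult_closed)
  interpret F: module "class_ring :: 'k ring" F by (rule F_facts)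
  interpret I: abelian_subgroup I F
    unfolding I_def by (rule generated_ideal_abelian_subgroup[OF F_facts mult])
  let ?c = "a_r_coset F I"
  have plus: "set_add F (?c f) (?c g) = ?c (f \<oplus>\<^bsub>F\<^esub> g)" if "f \<in> carrier F" "g \<in> carrier F" for f g
    using that by (rule I.a_rcos_sum)
  have scale: "c \<odot>\<^bsub>V\<^esub> ?c f = ?c (c \<odot>\<^bsub>F\<^esub> f)" if "f \<in> carrier F" for c f
    unfolding V_eq I_def by (rule quotient_algebra_coset_ops(2)[OF F_facts]) (simp_all add: mult that)
  have carr: "carrier V = ?c ` carrier F"
    by (auto simp: V_eq quotient_algebra_def A_RCOSETS_def RCOSETS_def a_r_coset_def)
  \<comment> \<open>the kernel of a coset, which does not depend on the chosen representative\<close>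
  define \<kappa> where "\<kappa> C = (\<lambda>(x, y). K (SOME f. f \<in> C) x y)" for C :: "(('v, 'e) cohn_gen list \<Rightarrow>\<^sub>0 'k) set"
  have \<kappa>: "\<kappa> (?c f) = (\<lambda>(x, y). K f x y)" if "f \<in> carrier F" for f
  proof -
    have "(SOME g. g \<in> ?c f) \<in> ?c f" by (rule someI) (rule I.a_rcos_self[OF that])
    then obtain i where "i \<in> I" "(SOME g. g \<in> ?c f) = i + f"
      by (auto simp: a_r_coset_def r_coset_def F_def free_algebra_def)
    then show ?thesis
      using K_ideal[of i] by (simp add: \<kappa>_def rel_kernel_add I_def F_def)
  qed
  obtain A where A: "finite A" "A \<subseteq> carrier V" "V.span A = carrier V"
    using fin[folded V_def] V.fin_dim_def by auto
  \<comment> \<open>a subspace of the quotient that contains the generating set, hence everything\<close>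
  define N where "N = {C \<in> carrier V. \<kappa> C \<in> fun_space.span (\<kappa> ` A)}"
  have "submodule class_ring N V"
  proof (rule submodule.intro)
    show "module class_ring V" by unfold_locales
    show "v \<oplus>\<^bsub>V\<^esub> w \<in> N" if "v \<in> N" "w \<in> N" for v w
    proof -
      from that obtain f g where f: "f \<in> carrier F" "v = ?c f" and g: "g \<in> carrier F" "w = ?c g"
        by (auto simp: N_def carr)
      have vw: "v \<oplus>\<^bsub>V\<^esub> w = ?c (f \<oplus>\<^bsub>F\<^esub> g)"
        using plus[OF f(1) g(1)] by (simp add: V_eq quotient_algebra_def f g)
      have "\<kappa> (v \<oplus>\<^bsub>V\<^esub> w) = \<kappa> v + \<kappa> w"
        unfolding vw using f g by (simp add: \<kappa> fun_eq_iff) (simp add: F_def free_algebra_def rel_kernel_add)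
      then show ?thesis using that by (auto simp: N_def intro: fun_space.span_add)
    qed
    show "\<zero>\<^bsub>V\<^esub> \<in> N"
    proof -
      have "\<zero>\<^bsub>V\<^esub> = ?c \<zero>\<^bsub>F\<^esub>"
        using I.a_rcos_const[OF I.zero_closed] by (simp add: V_eq quotient_algebra_def)
      then have "\<kappa> \<zero>\<^bsub>V\<^esub> = 0" by (simp add: \<kappa> fun_eq_iff) (simp add: F_def free_algebra_def)
      then show ?thesis by (auto simp: N_def intro: fun_space.span_zero)
    qed
    show "c \<odot>\<^bsub>V\<^esub> v \<in> N" if "c \<in> carrier class_ring" "v \<in> N" for c v
    proof -
      from that obtain f where f: "f \<in> carrier F" "v = ?c f" by (auto simp: N_def carr)
      have "c \<odot>\<^bsub>V\<^esub> v = ?c (c \<odot>\<^bsub>F\<^esub> f)"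
        using scale[OF f(1)] by (simp add: f)
      moreover have "\<kappa> (?c (c \<odot>\<^bsub>F\<^esub> f)) = (\<lambda>a. c * \<kappa> (?c f) a)"
        using f that(1) by (simp add: \<kappa> fun_eq_iff) (simp add: F_def free_algebra_def K_smult)
      ultimately have "\<kappa> (c \<odot>\<^bsub>V\<^esub> v) = (\<lambda>a. c * \<kappa> v a)" using f by simp
      then show ?thesis using that by (auto simp: N_def intro: fun_space.span_scale)
    qed
  qed (auto simp: N_def)
  then have "V.span A \<subseteq> N"
    by (intro V.span_is_subset) (use A(2) in \<open>auto simp: N_def intro: fun_space.span_base\<close>)
  then have span: "(\<lambda>(x, y). K f x y) \<in> fun_space.span (\<kappa> ` A)" if "f \<in> carrier F" for f
    using A(3) \<kappa>[OF that] that by (auto simp: N_def carr)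
  define k where "k = (\<lambda>(u, es) (x, y). K (word (Vert u # map Edge es) :: _ \<Rightarrow>\<^sub>0 'k) x y)"
  have k_apply: "k (u, es) (x, y) = K (word (Vert u # map Edge es)) x y" for u es x y
    by (simp add: k_def)
  have k_span: "k p \<in> fun_space.span (\<kappa> ` A)" if "p \<in> walks E" for p
  proof -
    obtain u es where p: "p = (u, es)" by (cases p)
    have "insert (Vert u) (Edge ` set es) \<subseteq> cohn_gens E"
      using walks_verts[of u es] that unfolding p cohn_gens_def by blast
    then have "word (Vert u # map Edge es) \<in> carrier F"
      by (simp add: F_def free_algebra_def lists_eq_set)
    from span[OF this] show ?thesis by (simp add: p k_def)
  qed
  have k_indep: "c p = 0" if J: "finite J" "J \<subseteq> walks E" and sum: "\<And>a. (\<Sum>p\<in>J. c p * k p a) = 0" and p: "p \<in> J"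
    for J c p
  proof (rule walk_kernels_independent[of "\<lambda>(v, l, d). d", OF _ _ J _ p])
    show "verts E \<subseteq> fst ` (verts E \<times> (UNIV :: ('e list \<times> int) set))" by force
    show "(\<Sum>(u, es)\<in>J. c (u, es) * K (word (Vert u # map Edge es)) x y) = 0" for x y
      using sum[of "(x, y)"] unfolding k_def case_prod_unfold by simp
  qed (simp add: case_prod_unfold)
  have "finite (walks E) \<and> card (walks E) \<le> card (\<kappa> ` A)"
  proof (rule card_le_of_independent_family[of "\<kappa> ` A" "walks E" k])
    show "finite (\<kappa> ` A)" using A(1) by simp
  qed (erule k_span, rule k_indep)
  then show ?thesis ..
qed

section \<open>Relative Cohn path algebras as algebras of block matrices\<close>

text \<open>
  The direct sum of the full matrix algebras over the fibres of \<open>b\<close>: matrices with rows and columns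
  indexed by \<open>\<Omega>\<close> whose entries vanish outside the diagonal blocks.
\<close>

definition block_matrix_algebra ::
    "'p set \<Rightarrow> ('p \<Rightarrow> 'i) \<Rightarrow> ('r::comm_ring_1, 'p \<Rightarrow> 'p \<Rightarrow> 'r) module" where
  "block_matrix_algebra \<Omega> b =
    \<lparr>carrier = {k. \<forall>x y. k x y \<noteq> 0 \<longrightarrow> x \<in> \<Omega> \<and> y \<in> \<Omega> \<and> b x = b y},
     monoid.mult = (\<lambda>k l x y. \<Sum>z\<in>\<Omega>. k x z * l z y), one = undefined,
     zero = (\<lambda>_ _. 0), add = (\<lambda>k l x y. k x y + l x y), smult = (\<lambda>c k x y. c * k x y)\<rparr>"

lemma block_matrix_algebra_carrier:
  "k \<in> carrier (block_matrix_algebra \<Omega> b) \<longleftrightarrow> (\<forall>x y. k x y \<noteq> 0 \<longrightarrow> x \<in> \<Omega> \<and> y \<in> \<Omega> \<and> b x = b y)"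
  by (simp add: block_matrix_algebra_def)

text \<open>
  The index set of the matrix units.  The relation at a vertex of \<open>XE\<close> splits a walk that ends there
  into its continuations by one edge, so only walks with other ends survive as indices.
\<close>

definition terminal_walks :: "('v, 'e) pre_digraph \<Rightarrow> 'v set \<Rightarrow> ('v \<times> 'e list) set" where
  "terminal_walks E XE = {p \<in> walks E. walk_end E p \<notin> XE}"

locale finitely_many_walks = wf_digraph E for E :: "('v, 'e) pre_digraph" +
  fixes XE :: "'v set"
  assumes XE_regular: "XE \<subseteq> regular_verts E"
    and finite_walks: "finite (walks E)"
begin

abbreviation \<Omega> where "\<Omega> \<equiv> terminal_walks E XE"

lemma mem_\<Omega>: "p \<in> \<Omega> \<longleftrightarrow> p \<in> walks E \<and> walk_end E p \<notin> XE"
  by (simp add: terminal_walks_def)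

lemma finite_\<Omega>: "finite \<Omega>"
  using finite_walks by (simp add: terminal_walks_def)

lemma finite_out_arcs: "finite (out_arcs E v)"
proof (rule finite_surj[OF finite_walks])
  show "out_arcs E v \<subseteq> (\<lambda>p. hd (snd p)) ` walks E"
  proof
    fix e assume "e \<in> out_arcs E v"
    then have "(tail E e, [e]) \<in> walks E" by simp
    then show "e \<in> (\<lambda>p. hd (snd p)) ` walks E" by (force intro: image_eqI[of _ _ "(tail E e, [e])"])
  qed
qed

text \<open>
  The points are the terminal walks, and an edge acts by prepending it.  A terminal walk that starts in
  \<open>XE\<close> is nontrivial, so it is an extension of its tail along its first edge.
\<close>

sublocale branching_system E XE \<Omega> fst "\<lambda>e p. (tail E e, e # snd p)"
proof unfold_locales
  fix x assume "x \<in> \<Omega>" "fst x \<in> XE"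
  then obtain u e es where x: "x = (u, e # es)"
    by (cases x; cases "snd x") (auto simp: terminal_walks_def)
  with \<open>x \<in> \<Omega>\<close> show "\<exists>e\<in>out_arcs E (fst x). \<exists>y\<in>\<Omega>. fst y = head E e \<and> x = (tail E e, e # snd y)"
    by (intro bexI[of _ e] bexI[of _ "(head E e, es)"]) (auto simp: terminal_walks_def)
qed (use XE_regular in \<open>auto simp: terminal_walks_def\<close>)

lemma walk_end_word_rel: "(x, y) \<in> word_rel u \<Longrightarrow> walk_end E x = walk_end E y"
proof (induction u arbitrary: x)
  case (Cons g u)
  then obtain z where z: "(x, z) \<in> gen_rel g" "walk_end E z = walk_end E y" by auto
  have "walk_end E x = walk_end E z" using z(1) by (cases g) (auto simp: walk_end_def)
  with z(2) show ?case by simp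
qed auto

lemma K_in_block_matrix_algebra: "K f \<in> carrier (block_matrix_algebra \<Omega> (walk_end E))"
proof -
  have "x \<in> \<Omega> \<and> y \<in> \<Omega> \<and> walk_end E x = walk_end E y" if "K f x y \<noteq> 0" for x y
  proof -
    have "\<exists>u. (x, y) \<in> word_rel u"
    proof (rule ccontr)
      assume "\<nexists>u. (x, y) \<in> word_rel u"
      then have "K f x y = 0" unfolding rel_kernel_def by (intro sum.neutral) auto
      with that show False by simp
    qed
    then show ?thesis using walk_end_word_rel word_rel_subset by blast
  qed
  then show ?thesis unfolding block_matrix_algebra_carrier by blast
qed

text \<open>
  With finitely many points, the kernel turns products into matrix products.
\<close>

lemma K_mult: "K (free_mult f g) x y = (\<Sum>z\<in>\<Omega>. K f x z * K g z y)"
proof -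
  have single: "K (free_mult (Poly_Mapping.single u c) g) x y = (\<Sum>z\<in>\<Omega>. K (Poly_Mapping.single u c) x z * K g z y)" for u c
  proof (cases "x \<in> Domain (word_rel u)")
    case True
    then obtain z where z: "(x, z) \<in> word_rel u" by blast
    then have z_in: "z \<in> \<Omega>" using word_rel_subset by blast
    have "(\<Sum>z'\<in>\<Omega>. K (Poly_Mapping.single u c) x z' * K g z' y) = (\<Sum>z'\<in>\<Omega>. if z' = z then c * K g z y else 0)"
    proof (rule sum.cong[OF refl])
      fix z'
      have "(x, z') \<in> word_rel u \<longleftrightarrow> z' = z" using z word_rel_unique_right by blast
      then show "K (Poly_Mapping.single u c) x z' * K g z' y = (if z' = z then c * K g z y else 0)" by simp
    qed
    then show ?thesis using K_mult_single_left(1)[OF z] z_in finite_\<Omega> by simp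
  next
    case False
    then have "(x, z) \<notin> word_rel u" for z by blast
    then show ?thesis using K_mult_single_left(2)[OF False] by simp
  qed
  have sum_f: "(\<Sum>u\<in>Poly_Mapping.keys f. K (Poly_Mapping.single u (Poly_Mapping.lookup f u)) x z) = K f x z" for z
    unfolding rel_kernel_sum[symmetric] by (simp add: sum_single_keys)
  have "K (free_mult f g) x y = (\<Sum>u\<in>Poly_Mapping.keys f. K (free_mult (Poly_Mapping.single u (Poly_Mapping.lookup f u)) g) x y)"
    by (subst sum_single_keys[of f, symmetric]) (simp only: free_mult_sum_left rel_kernel_sum)
  also have "\<dots> = (\<Sum>z\<in>\<Omega>. \<Sum>u\<in>Poly_Mapping.keys f. K (Poly_Mapping.single u (Poly_Mapping.lookup f u)) x z * K g z y)"
    unfolding single by (rule sum.swap)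
  finally show ?thesis unfolding sum_distrib_right[symmetric] sum_f .
qed

subsection \<open>Congruence modulo the relations\<close>

abbreviation cohn_ideal :: "(('v, 'e) cohn_gen list \<Rightarrow>\<^sub>0 'r::comm_ring_1) set" where
  "cohn_ideal \<equiv> generated_ideal class_ring (free_algebra (cohn_gens E)) (cohn_relators E XE)"

definition cong_rel :: "(('v, 'e) cohn_gen list \<Rightarrow>\<^sub>0 'r::comm_ring_1) \<Rightarrow> _ \<Rightarrow> bool" (infix "\<approx>" 50) where
  "f \<approx> g \<longleftrightarrow> f - g \<in> cohn_ideal"

text \<open>
  Unlike the carrier of the free algebra, this admits the empty word, which is convenient as a factor of
  matrix units that belong to trivial walks.
\<close>

definition supported :: "(('v, 'e) cohn_gen list \<Rightarrow>\<^sub>0 'r::comm_ring_1) \<Rightarrow> bool" where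
  "supported f \<longleftrightarrow> Poly_Mapping.keys f \<subseteq> lists (cohn_gens E)"

lemma ideal_scale: "f \<in> cohn_ideal \<Longrightarrow> free_mult (Poly_Mapping.single [] c) f \<in> cohn_ideal"
  using generated_ideal.smult[of c class_ring f "free_algebra (cohn_gens E)" "cohn_relators E XE"]
  by (simp add: free_algebra_def smult_conv)

lemma ideal_add: "f \<in> cohn_ideal \<Longrightarrow> g \<in> cohn_ideal \<Longrightarrow> f + g \<in> cohn_ideal"
  using generated_ideal.add[of f class_ring "free_algebra (cohn_gens E)" "cohn_relators E XE" g]
  by (simp add: free_algebra_def)

lemma ideal_zero: "0 \<in> cohn_ideal"
  using generated_ideal.zero[of "free_algebra (cohn_gens E)" class_ring "cohn_relators E XE"]
  by (simp add: free_algebra_def)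

lemma ideal_uminus: "f \<in> cohn_ideal \<Longrightarrow> - f \<in> cohn_ideal"
proof -
  have "free_mult (Poly_Mapping.single [] (-1)) f = - f"
    using free_mult_minus_left[of "word []" f] by (simp add: single_uminus)
  then show "f \<in> cohn_ideal \<Longrightarrow> - f \<in> cohn_ideal" using ideal_scale[of f "-1"] by simp
qed

lemma ideal_sum: "(\<And>i. i \<in> A \<Longrightarrow> f i \<in> cohn_ideal) \<Longrightarrow> sum f A \<in> cohn_ideal"
  by (induction A rule: infinite_finite_induct) (auto intro: ideal_add ideal_zero)

lemma ideal_mult:
  assumes "f \<in> cohn_ideal" "supported a"
  shows "free_mult a f \<in> cohn_ideal" "free_mult f a \<in> cohn_ideal"
proof -
  have *: "free_mult (Poly_Mapping.single u c) f \<in> cohn_ideal \<and> free_mult f (Poly_Mapping.single u c) \<in> cohn_ideal"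
    if "u \<in> lists (cohn_gens E)" for u c
  proof (cases "u = []")
    case True
    then show "free_mult (Poly_Mapping.single u c) f \<in> cohn_ideal \<and> free_mult f (Poly_Mapping.single u c) \<in> cohn_ideal"
      using ideal_scale[OF assms(1)] by (simp_all add: free_mult_single_Nil_commute)
  next
    case False
    then have "Poly_Mapping.single u c \<in> carrier (free_algebra (cohn_gens E))"
      using that by (simp add: free_algebra_def)
    from generated_ideal.mult_left[OF this assms(1)] generated_ideal.mult_right[OF this assms(1)]
    show "free_mult (Poly_Mapping.single u c) f \<in> cohn_ideal \<and> free_mult f (Poly_Mapping.single u c) \<in> cohn_ideal"
      by (simp_all add: free_algebra_mult)
  qed
  have "free_mult (\<Sum>u\<in>Poly_Mapping.keys a. Poly_Mapping.single u (Poly_Mapping.lookup a u)) f \<in> cohn_ideal"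
    "free_mult f (\<Sum>u\<in>Poly_Mapping.keys a. Poly_Mapping.single u (Poly_Mapping.lookup a u)) \<in> cohn_ideal"
    unfolding free_mult_sum_left free_mult_sum_right using assms(2)
    by (auto intro!: ideal_sum *[THEN conjunct1] *[THEN conjunct2] simp: supported_def)
  then show "free_mult a f \<in> cohn_ideal" "free_mult f a \<in> cohn_ideal"
    by (simp_all only: sum_single_keys)
qed

lemma cong_refl [simp, intro]: "f \<approx> f"
  by (simp add: cong_rel_def ideal_zero)

lemma cong_sym: "f \<approx> g \<Longrightarrow> g \<approx> f"
  unfolding cong_rel_def using ideal_uminus[of "f - g"] by simp

lemma cong_trans [trans]: "f \<approx> g \<Longrightarrow> g \<approx> h \<Longrightarrow> f \<approx> h"
  unfolding cong_rel_def using ideal_add[of "f - g" "g - h"] by simp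

lemma cong_add: "f \<approx> f' \<Longrightarrow> g \<approx> g' \<Longrightarrow> f + g \<approx> f' + g'"
  unfolding cong_rel_def using ideal_add[of "f - f'" "g - g'"] by (simp add: algebra_simps)

lemma cong_diff: "f \<approx> f' \<Longrightarrow> g \<approx> g' \<Longrightarrow> f - g \<approx> f' - g'"
  unfolding cong_rel_def using ideal_add[of "f - f'" "- (g - g')"] ideal_uminus[of "g - g'"] by (simp add: algebra_simps)

lemma cong_sum: "(\<And>i. i \<in> A \<Longrightarrow> f i \<approx> g i) \<Longrightarrow> sum f A \<approx> sum g A"
  unfolding cong_rel_def sum_subtractf[symmetric] by (rule ideal_sum)

lemma cong_mult_left: "f \<approx> g \<Longrightarrow> supported a \<Longrightarrow> free_mult a f \<approx> free_mult a g"
  unfolding cong_rel_def free_mult_diff_right[symmetric] by (rule ideal_mult)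

lemma cong_mult_right: "f \<approx> g \<Longrightarrow> supported a \<Longrightarrow> free_mult f a \<approx> free_mult g a"
  unfolding cong_rel_def free_mult_diff_left[symmetric] by (rule ideal_mult)

lemma cong_K: "f \<approx> g \<Longrightarrow> K f = K g"
  unfolding cong_rel_def using K_ideal[of "f - g"] by (simp add: fun_eq_iff rel_kernel_diff)

lemma supported_single [simp]: "set u \<subseteq> cohn_gens E \<Longrightarrow> supported (Poly_Mapping.single u c)"
  by (auto simp: supported_def)

lemma supported_mult: "supported f \<Longrightarrow> supported g \<Longrightarrow> supported (free_mult f g)"
  unfolding supported_def by (intro keys_free_mult) auto

lemma supported_diff: "supported f \<Longrightarrow> supported g \<Longrightarrow> supported (f - g)"
  unfolding supported_def using keys_diff[of f g] by blast

lemma supported_sum: "(\<And>i. i \<in> A \<Longrightarrow> supported (f i)) \<Longrightarrow> supported (sum f A)"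
  unfolding supported_def by (rule keys_sum_closed)

lemma gens_simps [simp]:
  "Vert v \<in> cohn_gens E \<longleftrightarrow> v \<in> verts E" "Edge e \<in> cohn_gens E \<longleftrightarrow> e \<in> arcs E"
  "Ghost e \<in> cohn_gens E \<longleftrightarrow> e \<in> arcs E"
  by (auto simp: cohn_gens_def)

lemma cong_words:
  assumes "word u \<approx> f" "set a \<subseteq> cohn_gens E" "set b \<subseteq> cohn_gens E"
  shows "word (a @ u @ b) \<approx> free_mult (word a) (free_mult f (word b))"
proof -
  have "free_mult (word a) (free_mult (word u) (word b)) \<approx> free_mult (word a) (free_mult f (word b))"
    using assms by (intro cong_mult_left cong_mult_right) auto
  then show ?thesis by simp
qed

lemma relator_cong: "f - g \<in> cohn_relators E XE \<Longrightarrow> f \<approx> g"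
  unfolding cong_rel_def by (rule generated_ideal.incl)

lemma cong_Vert_Vert:
  assumes "v \<in> verts E" "w \<in> verts E" "set a \<subseteq> cohn_gens E" "set b \<subseteq> cohn_gens E"
  shows "word (a @ Vert v # Vert w # b) \<approx> (if v = w then word (a @ Vert v # b) else 0)"
  using cong_words[OF relator_cong[OF cohn_relators.V[OF assms(1,2)]] assms(3,4)] by (simp split: if_splits)

lemma cong_tail_Edge:
  assumes "e \<in> arcs E" "set a \<subseteq> cohn_gens E" "set b \<subseteq> cohn_gens E"
  shows "word (a @ Vert (tail E e) # Edge e # b) \<approx> word (a @ Edge e # b)"
  using cong_words[OF relator_cong[OF cohn_relators.E1_source[OF assms(1)]] assms(2,3)] by simp

lemma cong_Edge_head:
  assumes "e \<in> arcs E" "set a \<subseteq> cohn_gens E" "set b \<subseteq> cohn_gens E"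
  shows "word (a @ Edge e # Vert (head E e) # b) \<approx> word (a @ Edge e # b)"
  using cong_words[OF relator_cong[OF cohn_relators.E1_range[OF assms(1)]] assms(2,3)] by simp

lemma cong_head_Ghost:
  assumes "e \<in> arcs E" "set a \<subseteq> cohn_gens E" "set b \<subseteq> cohn_gens E"
  shows "word (a @ Vert (head E e) # Ghost e # b) \<approx> word (a @ Ghost e # b)"
  using cong_words[OF relator_cong[OF cohn_relators.E2_range[OF assms(1)]] assms(2,3)] by simp

lemma cong_Ghost_tail:
  assumes "e \<in> arcs E" "set a \<subseteq> cohn_gens E" "set b \<subseteq> cohn_gens E"
  shows "word (a @ Ghost e # Vert (tail E e) # b) \<approx> word (a @ Ghost e # b)"
  using cong_words[OF relator_cong[OF cohn_relators.E2_source[OF assms(1)]] assms(2,3)] by simp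

lemma cong_Ghost_Edge:
  assumes "e \<in> arcs E" "f \<in> arcs E" "set a \<subseteq> cohn_gens E" "set b \<subseteq> cohn_gens E"
  shows "word (a @ Ghost e # Edge f # b) \<approx> (if e = f then word (a @ Vert (head E e) # b) else 0)"
  using cong_words[OF relator_cong[OF cohn_relators.CK1[OF assms(1,2)]] assms(3,4)] by (simp split: if_splits)

lemma cong_Vert_Edge:
  assumes "w \<in> verts E" "e \<in> arcs E" "set b \<subseteq> cohn_gens E"
  shows "word (Vert w # Edge e # b) \<approx> (if w = tail E e then word (Edge e # b) else 0)"
proof (cases "w = tail E e")
  case True
  then show ?thesis using cong_tail_Edge[of e "[]" b] assms by simp
next
  case False
  have "word (Vert w # Edge e # b) \<approx> word (Vert w # Vert (tail E e) # Edge e # b)"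
    using cong_sym[OF cong_tail_Edge[of e "[Vert w]" b]] assms by simp
  also have "\<dots> \<approx> 0"
    using cong_Vert_Vert[of w "tail E e" "[]" "Edge e # b"] assms False by simp
  finally show ?thesis using False by simp
qed

lemma cong_Ghost_Vert:
  assumes "w \<in> verts E" "e \<in> arcs E"
  shows "word [Ghost e, Vert w] \<approx> (if w = tail E e then word [Ghost e] else 0)"
proof (cases "w = tail E e")
  case True
  then show ?thesis using cong_Ghost_tail[of e "[]" "[]"] assms by simp
next
  case False
  have "word [Ghost e, Vert w] \<approx> word [Ghost e, Vert (tail E e), Vert w]"
    using cong_sym[OF cong_Ghost_tail[of e "[]" "[Vert w]"]] assms by simp
  also have "\<dots> \<approx> 0"
    using cong_Vert_Vert[of "tail E e" w "[Ghost e]" "[]"] assms False by simp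
  finally show ?thesis using False by simp
qed

subsection \<open>Matrix units\<close>

text \<open>
  The relation imposed at the vertices of \<open>XE\<close> says that this element vanishes.  At the other
  vertices it becomes the diagonal matrix unit of the trivial walk.
\<close>

definition vertex_defect :: "'v \<Rightarrow> ('v, 'e) cohn_gen list \<Rightarrow>\<^sub>0 'r::comm_ring_1" where
  "vertex_defect v = word [Vert v] - (\<Sum>e\<in>out_arcs E v. word [Edge e, Ghost e])"

lemma supported_vertex_defect: "v \<in> verts E \<Longrightarrow> supported (vertex_defect v)"
  unfolding vertex_defect_def by (intro supported_diff supported_sum) auto

lemma Vert_vertex_defect:
  assumes "w \<in> verts E" "v \<in> verts E"
  shows "free_mult (word [Vert w]) (vertex_defect v) \<approx> (if w = v then vertex_defect v else 0)"
proof -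
  have "free_mult (word [Vert w]) (vertex_defect v)
      = word [Vert w, Vert v] - (\<Sum>e\<in>out_arcs E v. word [Vert w, Edge e, Ghost e])"
    by (simp add: vertex_defect_def free_mult_diff_right free_mult_sum_right)
  also have "\<dots> \<approx> (if w = v then word [Vert w] else 0)
      - (\<Sum>e\<in>out_arcs E v. if w = tail E e then word [Edge e, Ghost e] else 0)"
  proof (intro cong_diff cong_sum)
    show "word [Vert w, Vert v] \<approx> (if w = v then word [Vert w] else 0)"
      using cong_Vert_Vert[of w v "[]" "[]"] assms by (simp split: if_splits)
    show "word [Vert w, Edge e, Ghost e] \<approx> (if w = tail E e then word [Edge e, Ghost e] else 0)"
      if "e \<in> out_arcs E v" for e
      using cong_Vert_Edge[of w e "[Ghost e]"] assms that by (simp split: if_splits)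
  qed
  also have "\<dots> = (if w = v then vertex_defect v else 0)"
    by (auto simp: vertex_defect_def intro!: sum.neutral)
  finally show ?thesis .
qed

lemma Ghost_vertex_defect:
  assumes "e \<in> arcs E" "v \<in> verts E"
  shows "free_mult (word [Ghost e]) (vertex_defect v) \<approx> 0"
proof -
  have summand: "word [Ghost e, Edge f, Ghost f] \<approx> (if f = e then word [Ghost e] else 0)" if "f \<in> out_arcs E v" for f
  proof (cases "f = e")
    case True
    have "word [Ghost e, Edge e, Ghost e] \<approx> word [Vert (head E e), Ghost e]"
      using cong_Ghost_Edge[of e e "[]" "[Ghost e]"] assms by simp
    also have "\<dots> \<approx> word [Ghost e]"
      using cong_head_Ghost[of e "[]" "[]"] assms by simp
    finally show ?thesis using True by simp
  next
    case False
    then show ?thesis using cong_Ghost_Edge[of e f "[]" "[Ghost f]"] assms that by auto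
  qed
  have "free_mult (word [Ghost e]) (vertex_defect v)
      = word [Ghost e, Vert v] - (\<Sum>f\<in>out_arcs E v. word [Ghost e, Edge f, Ghost f])"
    by (simp add: vertex_defect_def free_mult_diff_right free_mult_sum_right)
  also have "\<dots> \<approx> (if v = tail E e then word [Ghost e] else 0)
      - (\<Sum>f\<in>out_arcs E v. if f = e then word [Ghost e] else 0)"
    by (intro cong_diff cong_sum cong_Ghost_Vert assms summand)
  also have "\<dots> = 0"
    using assms finite_out_arcs by auto
  finally show ?thesis .
qed

definition matrix_unit :: "'v \<times> 'e list \<Rightarrow> 'v \<times> 'e list \<Rightarrow> ('v, 'e) cohn_gen list \<Rightarrow>\<^sub>0 'r::comm_ring_1" where
  "matrix_unit p q = free_mult (word (map Edge (snd p)))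
     (free_mult (vertex_defect (walk_end E p)) (word (rev (map Ghost (snd q)))))"

lemma supported_half_unit:
  assumes "p \<in> walks E" "q \<in> walks E"
  shows "supported (free_mult (vertex_defect (walk_end E p)) (word (rev (map Ghost (snd q)))))"
  using assms walks_verts(2)[of "fst p" "snd p"] walks_verts(3)[of "fst q" "snd q"]
  by (intro supported_mult supported_vertex_defect supported_single) auto

text \<open>
  This lemma and the next two compute the left action of the generators on matrix units.  It is the
  action of generators on the walk that indexes the row: prepend an edge, remove it, or test the start
  vertex.
\<close>

lemma Vert_matrix_unit:
  assumes "w \<in> verts E" "(u, es) \<in> walks E" "q \<in> walks E"
  shows "free_mult (word [Vert w]) (matrix_unit (u, es) q) \<approx> (if w = u then matrix_unit (u, es) q else 0)"
proof (cases es)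
  case Nil
  have "supported (word (rev (map Ghost (snd q))))"
    using walks_verts(3)[of "fst q" "snd q"] assms(3) by (intro supported_single) auto
  from cong_mult_right[OF Vert_vertex_defect[of w u] this]
  show ?thesis using assms Nil by (simp add: matrix_unit_def free_mult_assoc split: if_splits)
next
  case (Cons e es')
  have "set (map Edge es') \<subseteq> cohn_gens E"
    using walks_verts(3)[OF assms(2)] Cons by auto
  from cong_mult_right[OF cong_Vert_Edge[OF assms(1) _ this] supported_half_unit[OF assms(2,3)], of e]
  show ?thesis
    using assms(2) Cons by (simp add: matrix_unit_def free_mult_assoc[symmetric] split: if_splits)
qed

lemma Edge_matrix_unit:
  assumes "e \<in> arcs E" "(u, es) \<in> walks E" "q \<in> walks E"
  shows "free_mult (word [Edge e]) (matrix_unit (u, es) q)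
    \<approx> (if u = head E e then matrix_unit (tail E e, e # es) q else 0)"
proof (cases "u = head E e")
  case True
  then show ?thesis by (simp add: matrix_unit_def free_mult_assoc[symmetric])
next
  case False
  have u: "u \<in> verts E" using assms(2) by (rule walks_verts)
  have "word [Edge e, Vert u] \<approx> word [Edge e, Vert (head E e), Vert u]"
    using cong_sym[OF cong_Edge_head[of e "[]" "[Vert u]"]] assms u by simp
  also have "\<dots> \<approx> 0"
    using cong_Vert_Vert[of "head E e" u "[Edge e]" "[]"] assms u False by simp
  finally have zero: "word [Edge e, Vert u] \<approx> 0" .
  have "set (map Edge es) \<subseteq> cohn_gens E" using walks_verts(3)[OF assms(2)] by auto
  then have supp: "supported (matrix_unit (u, es) q)"
    unfolding matrix_unit_def using assms by (intro supported_mult supported_half_unit supported_single) auto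
  have "free_mult (word [Edge e]) (matrix_unit (u, es) q)
      \<approx> free_mult (word [Edge e]) (free_mult (word [Vert u]) (matrix_unit (u, es) q))"
    using cong_mult_left[OF cong_sym[OF Vert_matrix_unit[OF u assms(2,3)]], of "word [Edge e]"] assms(1) by simp
  also have "\<dots> = free_mult (word [Edge e, Vert u]) (matrix_unit (u, es) q)"
    by (simp add: free_mult_assoc[symmetric])
  also have "\<dots> \<approx> 0"
    using cong_mult_right[OF zero supp] by simp
  finally show ?thesis using False by simp
qed

lemma Ghost_matrix_unit:
  assumes "e \<in> arcs E" "(u, es) \<in> walks E" "q \<in> walks E"
  shows "free_mult (word [Ghost e]) (matrix_unit (u, es) q)
    \<approx> (if es \<noteq> [] \<and> hd es = e then matrix_unit (head E e, tl es) q else 0)"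
proof (cases es)
  case Nil
  have "supported (word (rev (map Ghost (snd q))))"
    using walks_verts(3)[of "fst q" "snd q"] assms(3) by (intro supported_single) auto
  from cong_mult_right[OF Ghost_vertex_defect[of e u] this]
  show ?thesis using assms Nil by (simp add: matrix_unit_def free_mult_assoc)
next
  case (Cons f es')
  have f: "f \<in> arcs E" "(head E f, es') \<in> walks E" "walk_end E (u, es) = walk_end E (head E f, es')"
    using assms(2) Cons by auto
  have gens: "set (map Edge es') \<subseteq> cohn_gens E" using walks_verts(3)[OF f(2)] by auto
  have ck1: "word (Ghost e # Edge f # map Edge es') \<approx> (if e = f then word (Vert (head E e) # map Edge es') else 0)"
    using cong_Ghost_Edge[OF assms(1) f(1) _ gens, of "[]"] by (simp split: if_splits)
  have "free_mult (word [Ghost e]) (matrix_unit (u, es) q)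
      = free_mult (word (Ghost e # Edge f # map Edge es')) (free_mult (vertex_defect (walk_end E (u, es))) (word (rev (map Ghost (snd q)))))"
    using Cons by (simp add: matrix_unit_def free_mult_assoc[symmetric])
  also have "\<dots> \<approx> free_mult (if e = f then word (Vert (head E e) # map Edge es') else 0)
      (free_mult (vertex_defect (walk_end E (u, es))) (word (rev (map Ghost (snd q)))))"
    by (rule cong_mult_right[OF ck1 supported_half_unit[OF assms(2,3)]])
  also have "\<dots> = (if e = f then free_mult (word [Vert (head E e)]) (matrix_unit (head E e, es') q) else 0)"
    using f(3) by (simp add: matrix_unit_def free_mult_assoc[symmetric])
  also have "\<dots> \<approx> (if e = f then matrix_unit (head E e, es') q else 0)"
    using Vert_matrix_unit[OF _ f(2) assms(3), of "head E f"] f(1) by auto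
  finally show ?thesis using Cons by (simp split: if_splits)
qed

text \<open>
  The edges of a walk take the trivial walk at its end to the walk itself.
\<close>

lemma word_rel_edges:
  assumes "(u, es) \<in> walks E" "walk_end E (u, es) = v" "v \<notin> XE"
  shows "((u, es), (v, [])) \<in> word_rel (map Edge es)"
  using assms
proof (induction es arbitrary: u)
  case Nil
  then show ?case by (auto simp: mem_\<Omega>)
next
  case (Cons e es)
  then have e: "e \<in> arcs E" "u = tail E e" "(head E e, es) \<in> walks E" "walk_end E (head E e, es) = v" by auto
  then have "((head E e, es), (v, [])) \<in> word_rel (map Edge es)" using Cons by blast
  moreover have "((u, e # es), (head E e, es)) \<in> gen_rel (Edge e)"
    using e Cons.prems(3) by (auto simp: mem_\<Omega>)
  ultimately show ?case by auto
qed

lemma word_rel_ghosts: "word_rel (rev (map Ghost es)) = (word_rel (map Edge es))\<inverse>"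
proof (induction es)
  case (Cons e es)
  have "word_rel (rev (map Ghost (e # es))) = (word_rel (map Edge es))\<inverse> O gen_rel (Ghost e)"
    by (simp add: word_rel_append Cons del: word_rel.simps(2))
  also have "gen_rel (Ghost e) = (gen_rel (Edge e))\<inverse>" by auto
  finally show ?case by (simp add: converse_relcomp)
qed auto

text \<open>
  The defect of \<open>v\<close> acts as the projection to the trivial walk at \<open>v\<close>; the ghost edges of \<open>q\<close> lead only
  from \<open>q\<close> to it, and the edges of \<open>p\<close> lead only from it to \<open>p\<close>.
\<close>

lemma K_matrix_unit:
  assumes "p \<in> \<Omega>" "q \<in> \<Omega>" "walk_end E p = walk_end E q"
  shows "K (matrix_unit p q) x y = (if x = p \<and> y = q then 1 else 0 :: 'r::comm_ring_1)"
proof -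
  define v where "v = walk_end E p"
  let ?z = "(v, [])"
  have v: "v \<in> verts E" "v \<notin> XE"
    using assms(1) walks_verts(2)[of "fst p" "snd p"] by (auto simp: mem_\<Omega> v_def)
  have p: "(p, ?z) \<in> word_rel (map Edge (snd p))"
    using word_rel_edges[of "fst p" "snd p" v] assms v by (simp add: mem_\<Omega> v_def)
  have q: "(?z, q) \<in> word_rel (rev (map Ghost (snd q)))"
    using word_rel_edges[of "fst q" "snd q" v] assms v by (simp add: mem_\<Omega> v_def word_rel_ghosts)
  have defect: "K (vertex_defect v) z t = (if z = ?z \<and> t = ?z then 1 else 0 :: 'r)" for z t
  proof -
    have "z \<in> \<Omega> \<and> fst z = v \<and> \<not> (\<exists>e\<in>out_arcs E v. \<exists>y\<in>\<Omega>. fst y = head E e \<and> z = (tail E e, e # snd y)) \<longleftrightarrow> z = ?z"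
    proof
      assume z: "z \<in> \<Omega> \<and> fst z = v \<and> \<not> (\<exists>e\<in>out_arcs E v. \<exists>y\<in>\<Omega>. fst y = head E e \<and> z = (tail E e, e # snd y))"
      show "z = ?z"
      proof (cases "snd z")
        case Nil
        then show ?thesis using z by (cases z) auto
      next
        case (Cons e es)
        then have z_eq: "z = (v, e # es)" using z by (cases z) auto
        then have "e \<in> out_arcs E v" "(head E e, es) \<in> \<Omega>" "z = (tail E e, e # es)"
          using z by (auto simp: mem_\<Omega>)
        then show ?thesis using z by force
      qed
    next
      assume "z = ?z"
      then show "z \<in> \<Omega> \<and> fst z = v \<and> \<not> (\<exists>e\<in>out_arcs E v. \<exists>y\<in>\<Omega>. fst y = head E e \<and> z = (tail E e, e # snd y))"
        using v by (auto simp: mem_\<Omega>)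
    qed
    then show ?thesis unfolding vertex_defect_def K_vertex_defect[OF finite_out_arcs] by auto
  qed
  show ?thesis
  proof (cases "x \<in> Domain (word_rel (map Edge (snd p)))")
    case False
    then have "x \<noteq> p" using p by blast
    then show ?thesis unfolding matrix_unit_def by (simp add: K_mult_single_left(2)[OF False])
  next
    case True
    then obtain z where z: "(x, z) \<in> word_rel (map Edge (snd p))" by blast
    have left: "K (matrix_unit p q :: _ \<Rightarrow>\<^sub>0 'r) x y = K (free_mult (vertex_defect v) (word (rev (map Ghost (snd q))))) z y"
      unfolding matrix_unit_def by (simp add: v_def K_mult_single_left(1)[OF z])
    have xz: "x = p \<longleftrightarrow> z = ?z" using z p word_rel_unique_left word_rel_unique_right by blast
    show ?thesis
    proof (cases "y \<in> Range (word_rel (rev (map Ghost (snd q))))")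
      case False
      then have "y \<noteq> q" using q by blast
      then show ?thesis unfolding left by (simp add: K_mult_single_right(2)[OF False])
    next
      case True
      then obtain t where t: "(t, y) \<in> word_rel (rev (map Ghost (snd q)))" by blast
      have "y = q \<longleftrightarrow> t = ?z" using t q word_rel_unique_left word_rel_unique_right by blast
      then show ?thesis unfolding left using xz by (simp add: defect K_mult_single_right(1)[OF t])
    qed
  qed
qed

lemma vertex_defect_XE:
  assumes "v \<in> XE"
  shows "vertex_defect v \<approx> 0"
  unfolding vertex_defect_def using relator_cong[of "word [Vert v] - (\<Sum>e\<in>out_arcs E v. word [Edge e, Ghost e])" 0] assms
  by (simp add: cohn_relators.XCK2)

text \<open>
  A vertex is its defect plus the sum of \<open>e e\<^sup>*\<close> over the outgoing edges, and \<open>e e\<^sup>* = e u e\<^sup>*\<close> for the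
  head \<open>u\<close> of \<open>e\<close>, to which the same decomposition applies.  This recursion ends because the lengths of
  the walks from a vertex are bounded, by a smaller bound for the heads of its outgoing edges.
\<close>

lemma Vert_eq_sum_matrix_units:
  assumes "w \<in> verts E"
  shows "(word [Vert w] :: _ \<Rightarrow>\<^sub>0 'r::comm_ring_1) \<approx> (\<Sum>p\<in>{p \<in> \<Omega>. fst p = w}. matrix_unit p p)"
proof -
  have "\<forall>es. (w, es) \<in> walks E \<longrightarrow> length es < n \<Longrightarrow> w \<in> verts E \<Longrightarrow>
      (word [Vert w] :: _ \<Rightarrow>\<^sub>0 'r) \<approx> (\<Sum>p\<in>{p \<in> \<Omega>. fst p = w}. matrix_unit p p)" for n w
  proof (induction n arbitrary: w)
    case 0
    then have "(w, []) \<in> walks E" by simp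
    with 0 show ?case by blast
  next
    case (Suc n)
    define W where "W u = {p \<in> \<Omega>. fst p = u}" for u
    have fin: "finite (W u)" for u using finite_\<Omega> by (simp add: W_def)
    have summand: "(word [Edge e, Ghost e] :: _ \<Rightarrow>\<^sub>0 'r) \<approx> (\<Sum>p\<in>W (head E e). matrix_unit (tail E e, e # snd p) (tail E e, e # snd p))"
      if e: "e \<in> out_arcs E w" for e
    proof -
      have arc: "e \<in> arcs E" "tail E e = w" using e by auto
      have "\<forall>es. (head E e, es) \<in> walks E \<longrightarrow> length es < n"
      proof (intro allI impI)
        fix es assume "(head E e, es) \<in> walks E"
        then have "(w, e # es) \<in> walks E" using arc by simp
        then show "length es < n" using Suc.prems(1) by fastforce
      qed
      then have IH: "(word [Vert (head E e)] :: _ \<Rightarrow>\<^sub>0 'r) \<approx> (\<Sum>p\<in>W (head E e). matrix_unit p p)"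
        unfolding W_def using Suc.IH[of "head E e"] arc by simp
      have "(word [Edge e, Ghost e] :: _ \<Rightarrow>\<^sub>0 'r) \<approx> word [Edge e, Vert (head E e), Ghost e]"
        using cong_sym[OF cong_Edge_head[of e "[]" "[Ghost e]"]] arc by simp
      also have "\<dots> \<approx> free_mult (word [Edge e]) (free_mult (\<Sum>p\<in>W (head E e). matrix_unit p p) (word [Ghost e]))"
        using cong_words[OF IH, of "[Edge e]" "[Ghost e]"] arc by simp
      also have "\<dots> = (\<Sum>p\<in>W (head E e). matrix_unit (tail E e, e # snd p) (tail E e, e # snd p))"
        unfolding free_mult_sum_left free_mult_sum_right
      proof (rule sum.cong[OF refl])
        fix p assume "p \<in> W (head E e)"
        then have "walk_end E (tail E e, e # snd p) = walk_end E p" by (cases p) (simp add: W_def)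
        then show "free_mult (word [Edge e]) (free_mult (matrix_unit p p) (word [Ghost e]))
            = matrix_unit (tail E e, e # snd p) (tail E e, e # snd p)"
          by (simp add: matrix_unit_def free_mult_assoc) (simp add: free_mult_assoc[symmetric])
      qed
      finally show ?thesis .
    qed
    define P where "P = Sigma (out_arcs E w) (\<lambda>e. W (head E e))"
    define h where "h = (\<lambda>(e :: 'e, p :: 'v \<times> 'e list). (w, e # snd p))"
    have inj: "inj_on h P"
      by (rule inj_onI) (auto simp: h_def P_def W_def prod_eq_iff)
    have image: "h ` P = W w - {(w, [])}"
    proof
      show "h ` P \<subseteq> W w - {(w, [])}"
        by (auto simp: h_def P_def W_def mem_\<Omega>)
      show "W w - {(w, [])} \<subseteq> h ` P"
      proof
        fix p assume p: "p \<in> W w - {(w, [])}"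
        then obtain e es where p_eq: "p = (w, e # es)" by (cases p; cases "snd p") (auto simp: W_def)
        then have "(e, (head E e, es)) \<in> P" using p by (auto simp: P_def W_def mem_\<Omega>)
        then show "p \<in> h ` P" by (intro image_eqI[of _ _ "(e, (head E e, es))"]) (simp_all add: h_def p_eq)
      qed
    qed
    have "(word [Vert w] :: _ \<Rightarrow>\<^sub>0 'r) = vertex_defect w + (\<Sum>e\<in>out_arcs E w. word [Edge e, Ghost e])"
      by (simp add: vertex_defect_def)
    also have "\<dots> \<approx> vertex_defect w + (\<Sum>e\<in>out_arcs E w. \<Sum>p\<in>W (head E e). matrix_unit (tail E e, e # snd p) (tail E e, e # snd p))"
      by (intro cong_add cong_sum summand cong_refl)
    also have "(\<Sum>e\<in>out_arcs E w. \<Sum>p\<in>W (head E e). matrix_unit (tail E e, e # snd p) (tail E e, e # snd p) :: _ \<Rightarrow>\<^sub>0 'r)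
        = (\<Sum>e\<in>out_arcs E w. \<Sum>p\<in>W (head E e). matrix_unit (h (e, p)) (h (e, p)))"
      by (intro sum.cong) (auto simp: h_def)
    also have "\<dots> = (\<Sum>p\<in>W w - {(w, [])}. matrix_unit p p)"
      using finite_out_arcs fin sum.reindex[OF inj, of "\<lambda>p. matrix_unit p p :: _ \<Rightarrow>\<^sub>0 'r", unfolded image]
      by (simp add: sum.Sigma P_def case_prod_unfold)
    also have "vertex_defect w + (\<Sum>p\<in>W w - {(w, [])}. matrix_unit p p :: _ \<Rightarrow>\<^sub>0 'r) \<approx> (\<Sum>p\<in>W w. matrix_unit p p)"
    proof (cases "w \<in> XE")
      case True
      then have "W w - {(w, [])} = W w" by (auto simp: W_def mem_\<Omega>)
      then show ?thesis using cong_add[OF vertex_defect_XE[OF True] cong_refl] by simp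
    next
      case False
      then have "(w, []) \<in> W w" using Suc.prems(2) by (simp add: W_def mem_\<Omega>)
      then have "(\<Sum>p\<in>W w. matrix_unit p p :: _ \<Rightarrow>\<^sub>0 'r) = matrix_unit (w, []) (w, []) + (\<Sum>p\<in>W w - {(w, [])}. matrix_unit p p)"
        using fin by (intro sum.remove)
      moreover have "(matrix_unit (w, []) (w, []) :: _ \<Rightarrow>\<^sub>0 'r) = vertex_defect w"
        by (simp add: matrix_unit_def)
      ultimately show ?thesis by simp
    qed
    finally show ?case unfolding W_def .
  qed
  moreover have "\<forall>es. (w, es) \<in> walks E \<longrightarrow> length es < Suc (Max ((length \<circ> snd) ` walks E))"
  proof (intro allI impI)
    fix es assume "(w, es) \<in> walks E"
    then have "length es \<in> (length \<circ> snd) ` walks E" by force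
    then show "length es < Suc (Max ((length \<circ> snd) ` walks E))"
      using finite_walks by (simp add: less_Suc_eq_le)
  qed
  ultimately show ?thesis using assms by blast
qed

text \<open>
  A section of the kernel map: it reads a matrix as a linear combination of matrix units.
\<close>

definition from_matrix :: "('v \<times> 'e list \<Rightarrow> 'v \<times> 'e list \<Rightarrow> 'r::comm_ring_1) \<Rightarrow> ('v, 'e) cohn_gen list \<Rightarrow>\<^sub>0 'r" where
  "from_matrix k = (\<Sum>p\<in>\<Omega>. \<Sum>q\<in>\<Omega>. free_mult (Poly_Mapping.single [] (k p q)) (matrix_unit p q))"

lemma K_from_matrix:
  fixes k :: "_ \<Rightarrow> _ \<Rightarrow> 'r::comm_ring_1"
  assumes "k \<in> carrier (block_matrix_algebra \<Omega> (walk_end E))"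
  shows "K (from_matrix k) = k"
proof (intro ext)
  fix x y
  have k: "k p q \<noteq> 0 \<Longrightarrow> p \<in> \<Omega> \<and> q \<in> \<Omega> \<and> walk_end E p = walk_end E q" for p q
    using assms unfolding block_matrix_algebra_carrier by blast
  have summand: "K (free_mult (Poly_Mapping.single [] (k p q)) (matrix_unit p q)) x y
      = (if p = x then if q = y then k x y else 0 else 0)" if "p \<in> \<Omega>" "q \<in> \<Omega>" for p q
  proof (cases "k p q = 0")
    case True
    then show ?thesis by auto
  next
    case False
    then have "K (matrix_unit p q) x y = (if x = p \<and> y = q then 1 else 0 :: 'r)"
      using k that by (intro K_matrix_unit) auto
    then show ?thesis by (auto simp: smult_conv[symmetric] K_smult)
  qed
  have "K (from_matrix k) x y = (\<Sum>p\<in>\<Omega>. \<Sum>q\<in>\<Omega>. if p = x then if q = y then k x y else 0 else 0)"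
    unfolding from_matrix_def rel_kernel_sum by (intro sum.cong refl summand)
  also have "\<dots> = (\<Sum>p\<in>\<Omega>. if p = x then (\<Sum>q\<in>\<Omega>. if q = y then k x y else 0) else 0)"
    by (intro sum.cong) auto
  also have "\<dots> = k x y"
    using k[of x y] finite_\<Omega> by auto
  finally show "K (from_matrix k) x y = k x y" .
qed

text \<open>
  An element with this property is determined, modulo the relations, by its kernel.  That all
  elements of the free algebra have it makes the kernel map injective on the quotient.
\<close>

definition reducible :: "(('v, 'e) cohn_gen list \<Rightarrow>\<^sub>0 'r::comm_ring_1) \<Rightarrow> bool" where
  "reducible f \<longleftrightarrow> f \<approx> from_matrix (K f)"

lemma reducible_cong:
  assumes "f \<approx> g" "reducible g"
  shows "reducible f"
  using assms(2) unfolding reducible_def cong_K[OF assms(1)] by (rule cong_trans[OF assms(1)])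

lemma from_matrix_add: "from_matrix (\<lambda>p q. k p q + l p q) = from_matrix k + from_matrix l"
  by (simp add: from_matrix_def single_add free_mult_add_left sum.distrib)

lemma from_matrix_scale: "from_matrix (\<lambda>p q. c * k p q) = free_mult (Poly_Mapping.single [] c) (from_matrix k)"
  unfolding from_matrix_def free_mult_sum_right
  by (intro sum.cong refl) (simp add: free_mult_assoc[symmetric])

lemma reducible_0: "reducible 0"
  by (simp add: reducible_def from_matrix_def)

lemma reducible_add:
  assumes "reducible f" "reducible g"
  shows "reducible (f + g)"
proof -
  have "K (f + g) = (\<lambda>p q. K f p q + K g p q)" by (simp add: fun_eq_iff rel_kernel_add)
  then show ?thesis
    using cong_add[OF assms[unfolded reducible_def]] unfolding reducible_def by (simp add: from_matrix_add)
qed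

lemma reducible_scale:
  assumes "reducible f"
  shows "reducible (free_mult (Poly_Mapping.single [] c) f)"
proof -
  have "K (free_mult (Poly_Mapping.single [] c) f) = (\<lambda>p q. c * K f p q)"
    by (simp add: fun_eq_iff smult_conv[symmetric] K_smult)
  then show ?thesis
    using cong_mult_left[OF assms[unfolded reducible_def], of "Poly_Mapping.single [] c"]
    unfolding reducible_def by (simp add: from_matrix_scale)
qed

lemma reducible_sum: "(\<And>i. i \<in> A \<Longrightarrow> reducible (f i)) \<Longrightarrow> reducible (sum f A)"
  by (induction A rule: infinite_finite_induct) (auto intro: reducible_add reducible_0)

lemma reducible_matrix_unit:
  assumes "p \<in> \<Omega>" "q \<in> \<Omega>" "walk_end E p = walk_end E q"
  shows "reducible (matrix_unit p q :: _ \<Rightarrow>\<^sub>0 'r::comm_ring_1)"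
proof -
  have "from_matrix (K (matrix_unit p q :: _ \<Rightarrow>\<^sub>0 'r)) = (\<Sum>p'\<in>\<Omega>. \<Sum>q'\<in>\<Omega>. if p' = p then if q' = q then matrix_unit p q else 0 else 0)"
    unfolding from_matrix_def by (intro sum.cong refl) (simp add: K_matrix_unit[OF assms])
  also have "\<dots> = (\<Sum>p'\<in>\<Omega>. if p' = p then (\<Sum>q'\<in>\<Omega>. if q' = q then matrix_unit p q else 0) else 0)"
    by (intro sum.cong) auto
  also have "\<dots> = matrix_unit p q" using assms finite_\<Omega> by simp
  finally show ?thesis by (simp add: reducible_def)
qed

lemma reducible_generator_matrix_unit:
  assumes "g \<in> cohn_gens E" "p \<in> \<Omega>" "q \<in> \<Omega>" "walk_end E p = walk_end E q"
  shows "reducible (free_mult (word [g]) (matrix_unit p q :: _ \<Rightarrow>\<^sub>0 'r::comm_ring_1))"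
proof -
  obtain u es where p: "p = (u, es)" by (cases p)
  have walks: "(u, es) \<in> walks E" "q \<in> walks E" using assms by (auto simp: mem_\<Omega> p)
  show ?thesis
  proof (cases g)
    case (Vert w)
    have "reducible (if w = u then matrix_unit (u, es) q else 0 :: _ \<Rightarrow>\<^sub>0 'r)"
      using reducible_matrix_unit[of p q, where ?'r = 'r] assms by (simp add: p reducible_0)
    moreover have "w \<in> verts E" using assms(1) Vert by simp
    ultimately show ?thesis
      unfolding Vert p using reducible_cong[OF Vert_matrix_unit[OF _ walks]] by blast
  next
    case (Edge e)
    have "reducible (if u = head E e then matrix_unit (tail E e, e # es) q else 0 :: _ \<Rightarrow>\<^sub>0 'r)"
      using reducible_matrix_unit[of "(tail E e, e # es)" q, where ?'r = 'r] assms Edge walks by (auto simp: p reducible_0 mem_\<Omega>)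
    moreover have "e \<in> arcs E" using assms(1) Edge by simp
    ultimately show ?thesis
      unfolding Edge p using reducible_cong[OF Edge_matrix_unit[OF _ walks]] by blast
  next
    case (Ghost e)
    have "reducible (if es \<noteq> [] \<and> hd es = e then matrix_unit (head E e, tl es) q else 0 :: _ \<Rightarrow>\<^sub>0 'r)"
    proof (cases "es \<noteq> [] \<and> hd es = e")
      case True
      then have "es = e # tl es" by auto
      then obtain es' where "es = e # es'" by blast
      then show ?thesis
        using reducible_matrix_unit[of "(head E e, es')" q, where ?'r = 'r] assms walks by (auto simp: p mem_\<Omega>)
    qed (auto simp: reducible_0)
    moreover have "e \<in> arcs E" using assms(1) Ghost by simp
    ultimately show ?thesis
      unfolding Ghost p using reducible_cong[OF Ghost_matrix_unit[OF _ walks]] by blast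
  qed
qed

lemma reducible_generator_mult:
  assumes g: "g \<in> cohn_gens E" and f: "reducible f"
  shows "reducible (free_mult (word [g]) f)"
proof -
  have "free_mult (word [g]) f \<approx> free_mult (word [g]) (from_matrix (K f))"
    using cong_mult_left[OF f[unfolded reducible_def], of "word [g]"] g by simp
  moreover have "reducible (free_mult (word [g]) (from_matrix (K f)))"
    unfolding from_matrix_def free_mult_sum_right
  proof (intro reducible_sum)
    fix p q assume pq: "p \<in> \<Omega>" "q \<in> \<Omega>"
    have "free_mult (word [g]) (free_mult (Poly_Mapping.single [] (K f p q)) (matrix_unit p q))
        = free_mult (Poly_Mapping.single [] (K f p q)) (free_mult (word [g]) (matrix_unit p q))"
      by (simp add: free_mult_assoc[symmetric])
    moreover have "reducible \<dots>"
    proof (cases "K f p q = 0")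
      case False
      then have "walk_end E p = walk_end E q"
        using K_in_block_matrix_algebra[of f] unfolding block_matrix_algebra_carrier by blast
      then show ?thesis
        by (intro reducible_scale reducible_generator_matrix_unit g pq)
    qed (simp add: reducible_0)
    ultimately show "reducible (free_mult (word [g]) (free_mult (Poly_Mapping.single [] (K f p q)) (matrix_unit p q)))"
      by simp
  qed
  ultimately show ?thesis by (rule reducible_cong)
qed

lemma reducible_Vert: "w \<in> verts E \<Longrightarrow> reducible (word [Vert w])"
  by (rule reducible_cong[OF Vert_eq_sum_matrix_units]) (auto intro!: reducible_sum reducible_matrix_unit)

lemma reducible_generator:
  assumes "g \<in> cohn_gens E"
  shows "reducible (word [g] :: _ \<Rightarrow>\<^sub>0 'r::comm_ring_1)"
proof (cases g)
  case (Vert w)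
  then show ?thesis using reducible_Vert assms by simp
next
  case (Edge e)
  then have e: "e \<in> arcs E" using assms by simp
  then have "reducible (free_mult (word [Edge e]) (word [Vert (head E e)]) :: _ \<Rightarrow>\<^sub>0 'r)"
    by (intro reducible_generator_mult reducible_Vert) auto
  moreover have "(word [Edge e] :: _ \<Rightarrow>\<^sub>0 'r) \<approx> free_mult (word [Edge e]) (word [Vert (head E e)])"
    using cong_sym[OF cong_Edge_head[of e "[]" "[]"]] e by simp
  ultimately show ?thesis unfolding Edge using reducible_cong by blast
next
  case (Ghost e)
  then have e: "e \<in> arcs E" using assms by simp
  then have "reducible (free_mult (word [Ghost e]) (word [Vert (tail E e)]) :: _ \<Rightarrow>\<^sub>0 'r)"
    by (intro reducible_generator_mult reducible_Vert) auto
  moreover have "(word [Ghost e] :: _ \<Rightarrow>\<^sub>0 'r) \<approx> free_mult (word [Ghost e]) (word [Vert (tail E e)])"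
    using cong_sym[OF cong_Ghost_tail[of e "[]" "[]"]] e by simp
  ultimately show ?thesis unfolding Ghost using reducible_cong by blast
qed

lemma reducible_word:
  "u \<noteq> [] \<Longrightarrow> set u \<subseteq> cohn_gens E \<Longrightarrow> reducible (word u :: _ \<Rightarrow>\<^sub>0 'r::comm_ring_1)"
proof (induction u)
  case (Cons g u)
  show ?case
  proof (cases "u = []")
    case True
    then show ?thesis using Cons.prems reducible_generator by simp
  next
    case False
    then have "reducible (free_mult (word [g]) (word u) :: _ \<Rightarrow>\<^sub>0 'r)"
      using Cons by (intro reducible_generator_mult) auto
    then show ?thesis by simp
  qed
qed simp

text \<open>
  The reducible elements form a linear subspace that is closed under left multiplication by generators
  and contains the vertices, of which every generator is a left multiple.
\<close>

lemma reducible_free_algebra: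
  fixes f :: "('v, 'e) cohn_gen list \<Rightarrow>\<^sub>0 'r::comm_ring_1"
  assumes "f \<in> carrier (free_algebra (cohn_gens E))"
  shows "reducible f"
proof -
  have single: "Poly_Mapping.single u c = free_mult (Poly_Mapping.single [] c) (word u)" for u :: "('v, 'e) cohn_gen list" and c :: 'r
    by simp
  have "reducible (\<Sum>u\<in>Poly_Mapping.keys f. Poly_Mapping.single u (Poly_Mapping.lookup f u))"
  proof (rule reducible_sum)
    fix u assume "u \<in> Poly_Mapping.keys f"
    then have "u \<noteq> []" "set u \<subseteq> cohn_gens E" using assms by (auto simp: free_algebra_def)
    then show "reducible (Poly_Mapping.single u (Poly_Mapping.lookup f u))"
      by (subst single) (intro reducible_scale reducible_word)
  qed
  then show ?thesis by (simp only: sum_single_keys)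
qed

lemma supported_matrix_unit:
  assumes "p \<in> walks E" "q \<in> walks E"
  shows "supported (matrix_unit p q)"
  unfolding matrix_unit_def using walks_verts(3)[of "fst p" "snd p"] assms
  by (intro supported_mult supported_half_unit supported_single) auto

text \<open>
  The kernel map is a surjective homomorphism because \<open>from_matrix\<close> is a section of it, and
  two elements with the same kernel are congruent to the same combination of matrix units.
\<close>

theorem cohn_path_algebra_isomorphic_block_matrix_algebra:
  "algebra_isomorphic class_ring (cohn_path_algebra TYPE('r::comm_ring_1) E XE)
     (block_matrix_algebra \<Omega> (walk_end E))"
proof -
  let ?F = "free_algebra (cohn_gens E) :: ('r, _) module"
  have wf: "wf_digraph E" by unfold_locales
  interpret F: module "class_ring :: 'r ring" ?F by (rule module_free_algebra)
  have ops: "f \<oplus>\<^bsub>?F\<^esub> g = f + g" "f \<otimes>\<^bsub>?F\<^esub> g = free_mult f g" "c \<odot>\<^bsub>?F\<^esub> f = Poly_Mapping.map (\<lambda>x. c * x) f" "\<zero>\<^bsub>?F\<^esub> = 0"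
    for f g c by (simp_all add: free_algebra_def)
  have closed: "free_mult f g \<in> carrier ?F" if "f \<in> carrier ?F" "g \<in> carrier ?F" for f g
    using that by (rule free_mult_closed)
  have minus: "f \<ominus>\<^bsub>?F\<^esub> g = f - g" if "f \<in> carrier ?F" "g \<in> carrier ?F" for f g
  proof -
    have "- g \<in> carrier ?F" using that(2) by (simp add: free_algebra_def)
    then have "\<ominus>\<^bsub>?F\<^esub> g = - g" using that(2) by (intro F.M.minus_equality) (simp_all add: ops)
    then show ?thesis by (simp add: a_minus_def ops)
  qed
  show ?thesis
    unfolding cohn_path_algebra_def
  proof (rule quotient_algebra_isomorphic[where \<psi> = K])
    show "module (class_ring :: 'r ring) ?F" by (rule module_free_algebra)
    show "cohn_relators E XE \<subseteq> carrier ?F" by (rule cohn_relators_closed[OF wf XE_regular])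
    show "K ` carrier ?F = carrier (block_matrix_algebra \<Omega> (walk_end E))"
    proof
      show "K ` carrier ?F \<subseteq> carrier (block_matrix_algebra \<Omega> (walk_end E))"
        using K_in_block_matrix_algebra by blast
      show "carrier (block_matrix_algebra \<Omega> (walk_end E)) \<subseteq> K ` carrier ?F"
      proof
        fix k :: "_ \<Rightarrow> _ \<Rightarrow> 'r" assume k: "k \<in> carrier (block_matrix_algebra \<Omega> (walk_end E))"
        \<comment> \<open>the empty word does not belong to the free algebra without unit\<close>
        have nonempty: "[] \<notin> Poly_Mapping.keys (matrix_unit p q :: _ \<Rightarrow>\<^sub>0 'r)" for p q
        proof -
          have "Poly_Mapping.keys (vertex_defect v :: _ \<Rightarrow>\<^sub>0 'r) \<subseteq> - {[]}" for v
          proof -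
            have "Poly_Mapping.keys (\<Sum>e\<in>out_arcs E v. word [Edge e, Ghost e] :: _ \<Rightarrow>\<^sub>0 'r) \<subseteq> - {[]}"
              by (rule keys_sum_closed) auto
            then show ?thesis unfolding vertex_defect_def
              using keys_diff[of "word [Vert v]" "\<Sum>e\<in>out_arcs E v. word [Edge e, Ghost e] :: _ \<Rightarrow>\<^sub>0 'r"] by auto
          qed
          then have "Poly_Mapping.keys (matrix_unit p q :: _ \<Rightarrow>\<^sub>0 'r) \<subseteq> - {[]}"
            unfolding matrix_unit_def
            by (intro keys_free_mult) (use keys_free_mult[of "vertex_defect _" _ "- {[]}"] in blast)
          then show ?thesis by blast
        qed
        have unit: "matrix_unit p q \<in> carrier ?F" if "p \<in> \<Omega>" "q \<in> \<Omega>" for p q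
        proof -
          have "supported (matrix_unit p q :: _ \<Rightarrow>\<^sub>0 'r)"
            using that by (intro supported_matrix_unit) (simp_all add: mem_\<Omega>)
          with nonempty[of p q] show ?thesis
            by (simp add: free_algebra_def supported_def subset_Diff_insert)
        qed
        have "from_matrix k \<in> carrier ?F"
        proof -
          have "free_mult (Poly_Mapping.single [] (k p q)) (matrix_unit p q) \<in> carrier ?F" if "p \<in> \<Omega>" "q \<in> \<Omega>" for p q
            using F.smult_closed[OF _ unit[OF that], of "k p q"] by (simp add: ops smult_conv)
          then have "Poly_Mapping.keys (from_matrix k) \<subseteq> lists (cohn_gens E) - {[]}"
            unfolding from_matrix_def
            by (intro keys_sum_closed) (simp only: free_algebra_def partial_object.simps mem_Collect_eq)
          then show ?thesis by (simp add: free_algebra_def)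
        qed
        then show "k \<in> K ` carrier ?F" by (rule image_eqI[where f = K, OF K_from_matrix[OF k, symmetric]])
      qed
    qed
    show "K f = K g \<longleftrightarrow> f \<ominus>\<^bsub>?F\<^esub> g \<in> cohn_ideal" if fg: "f \<in> carrier ?F" "g \<in> carrier ?F" for f g
    proof
      assume "K f = K g"
      then have "f \<approx> g"
        using cong_trans[OF fg(1)[THEN reducible_free_algebra, unfolded reducible_def]]
          cong_sym[OF fg(2)[THEN reducible_free_algebra, unfolded reducible_def]] by simp
      then show "f \<ominus>\<^bsub>?F\<^esub> g \<in> cohn_ideal" using fg by (simp add: minus cong_rel_def)
    next
      assume "f \<ominus>\<^bsub>?F\<^esub> g \<in> cohn_ideal"
      then show "K f = K g" using fg by (intro cong_K) (simp add: minus cong_rel_def)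
    qed
  qed (simp_all add: ops closed free_mult_add_left free_mult_add_right block_matrix_algebra_def
      fun_eq_iff rel_kernel_add K_smult K_mult)
qed

end

lemma cohn_path_algebra_closed:
  fixes E :: "('v, 'e) pre_digraph"
  assumes wf: "wf_digraph E" and XE: "XE \<subseteq> regular_verts E"
  defines "A \<equiv> cohn_path_algebra TYPE('r::comm_ring_1) E XE"
  shows "x \<in> carrier A \<Longrightarrow> y \<in> carrier A \<Longrightarrow> x \<oplus>\<^bsub>A\<^esub> y \<in> carrier A"
    and "x \<in> carrier A \<Longrightarrow> c \<odot>\<^bsub>A\<^esub> x \<in> carrier A"
    and "x \<in> carrier A \<Longrightarrow> y \<in> carrier A \<Longrightarrow> x \<otimes>\<^bsub>A\<^esub> y \<in> carrier A"
proof -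
  let ?F = "free_algebra (cohn_gens E) :: ('r, _) module"
  note F = module_free_algebra[of "cohn_gens E", where ?'r = 'r] cohn_relators_closed[OF wf XE, where ?'r = 'r]
  have mult: "f \<otimes>\<^bsub>?F\<^esub> g \<in> carrier ?F" if "f \<in> carrier ?F" "g \<in> carrier ?F" for f g
    using that unfolding free_algebra_mult by (rule free_mult_closed)
  interpret A: module "class_ring :: 'r ring" A
    unfolding A_def cohn_path_algebra_def by (rule module_quotient_algebra[OF F mult])
  show "x \<oplus>\<^bsub>A\<^esub> y \<in> carrier A" if "x \<in> carrier A" "y \<in> carrier A" using that by simp
  show "c \<odot>\<^bsub>A\<^esub> x \<in> carrier A" if "x \<in> carrier A" using that A.smult_closed by simp
  show "x \<otimes>\<^bsub>A\<^esub> y \<in> carrier A" if xy: "x \<in> carrier A" "y \<in> carrier A"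
  proof -
    define I where "I = generated_ideal (class_ring :: 'r ring) ?F (cohn_relators E XE)"
    have A_eq: "A = quotient_algebra ?F I" by (simp add: A_def I_def cohn_path_algebra_def)
    have carr: "carrier A = a_r_coset ?F I ` carrier ?F"
      by (auto simp: A_eq quotient_algebra_def A_RCOSETS_def RCOSETS_def a_r_coset_def)
    obtain f g where fg: "f \<in> carrier ?F" "x = a_r_coset ?F I f" "g \<in> carrier ?F" "y = a_r_coset ?F I g"
      using xy by (auto simp: carr)
    have "x \<otimes>\<^bsub>A\<^esub> y = rcoset_mult ?F I (a_r_coset ?F I f) (a_r_coset ?F I g)"
      by (simp add: A_eq quotient_algebra_def fg)
    also have "\<dots> = a_r_coset ?F I (f \<otimes>\<^bsub>?F\<^esub> g)"
      unfolding I_def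
      by (rule quotient_algebra_coset_ops(3)[OF F mult fg(1,3)])
        (simp_all add: free_algebra_def free_mult_add_left free_mult_add_right)
    finally show ?thesis using mult[OF fg(1,3)] by (simp add: carr)
  qed
qed

section \<open>Isomorphisms between algebras of block matrices\<close>

lemma block_matrix_algebra_ops [simp]:
  "k \<otimes>\<^bsub>block_matrix_algebra \<Omega> b\<^esub> l = (\<lambda>x y. \<Sum>z\<in>\<Omega>. k x z * l z y)"
  "k \<oplus>\<^bsub>block_matrix_algebra \<Omega> b\<^esub> l = (\<lambda>x y. k x y + l x y)"
  "c \<odot>\<^bsub>block_matrix_algebra \<Omega> b\<^esub> k = (\<lambda>x y. c * k x y)"
  by (simp_all add: block_matrix_algebra_def)

lemma block_matrix_algebra_carrierD:
  assumes "k \<in> carrier (block_matrix_algebra \<Omega> b)" "k x y \<noteq> 0"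
  shows "x \<in> \<Omega>" "y \<in> \<Omega>" "b x = b y"
  using assms unfolding block_matrix_algebra_carrier by blast+

lemma block_matrix_algebra_closed:
  assumes "k \<in> carrier (block_matrix_algebra \<Omega> b)"
  shows "c \<odot>\<^bsub>block_matrix_algebra \<Omega> b\<^esub> k \<in> carrier (block_matrix_algebra \<Omega> b)"
    and "l \<in> carrier (block_matrix_algebra \<Omega> b) \<Longrightarrow>
      k \<oplus>\<^bsub>block_matrix_algebra \<Omega> b\<^esub> l \<in> carrier (block_matrix_algebra \<Omega> b)"
    and "l \<in> carrier (block_matrix_algebra \<Omega> b) \<Longrightarrow>
      k \<otimes>\<^bsub>block_matrix_algebra \<Omega> b\<^esub> l \<in> carrier (block_matrix_algebra \<Omega> b)"
proof -
  note k = block_matrix_algebra_carrierD[OF assms]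
  show "c \<odot>\<^bsub>block_matrix_algebra \<Omega> b\<^esub> k \<in> carrier (block_matrix_algebra \<Omega> b)"
    unfolding block_matrix_algebra_carrier block_matrix_algebra_ops using k by (metis mult_zero_right)
  assume "l \<in> carrier (block_matrix_algebra \<Omega> b)"
  note l = block_matrix_algebra_carrierD[OF this]
  show "k \<oplus>\<^bsub>block_matrix_algebra \<Omega> b\<^esub> l \<in> carrier (block_matrix_algebra \<Omega> b)"
    unfolding block_matrix_algebra_carrier block_matrix_algebra_ops using k l by (metis add_0)
  show "k \<otimes>\<^bsub>block_matrix_algebra \<Omega> b\<^esub> l \<in> carrier (block_matrix_algebra \<Omega> b)"
    unfolding block_matrix_algebra_carrier block_matrix_algebra_ops
  proof (intro allI impI)
    fix x y assume "(\<Sum>z\<in>\<Omega>. k x z * l z y) \<noteq> 0"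
    then obtain z where "k x z * l z y \<noteq> 0" by (rule sum.not_neutral_contains_not_neutral)
    then have "k x z \<noteq> 0" "l z y \<noteq> 0" by auto
    then show "x \<in> \<Omega> \<and> y \<in> \<Omega> \<and> b x = b y" using k[of x z] l[of z y] by simp
  qed
qed

definition elementary :: "'p \<Rightarrow> 'p \<Rightarrow> 'p \<Rightarrow> 'p \<Rightarrow> 'r::comm_ring_1" where
  "elementary p q = (\<lambda>x y. if x = p \<and> y = q then 1 else 0)"

definition block_unit :: "'p set \<Rightarrow> ('p \<Rightarrow> 'i) \<Rightarrow> 'i \<Rightarrow> 'p \<Rightarrow> 'p \<Rightarrow> 'r::comm_ring_1" where
  "block_unit \<Omega> b v = (\<lambda>x y. if x = y \<and> x \<in> \<Omega> \<and> b x = v then 1 else 0)"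

lemma elementary_carrier:
  "p \<in> \<Omega> \<Longrightarrow> q \<in> \<Omega> \<Longrightarrow> b p = b q \<Longrightarrow> elementary p q \<in> carrier (block_matrix_algebra \<Omega> b)"
  by (simp add: block_matrix_algebra_carrier elementary_def)

lemma block_unit_carrier: "block_unit \<Omega> b v \<in> carrier (block_matrix_algebra \<Omega> b)"
  by (simp add: block_matrix_algebra_carrier block_unit_def)

lemma block_unit_mult:
  assumes "finite \<Omega>" "k \<in> carrier (block_matrix_algebra \<Omega> b)"
  shows "block_unit \<Omega> b v \<otimes>\<^bsub>block_matrix_algebra \<Omega> b\<^esub> k = (\<lambda>x y. if b x = v then k x y else 0)"
    and "k \<otimes>\<^bsub>block_matrix_algebra \<Omega> b\<^esub> block_unit \<Omega> b v = (\<lambda>x y. if b y = v then k x y else 0)"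
proof -
  have "(\<Sum>z\<in>\<Omega>. block_unit \<Omega> b v x z * k z y) = (\<Sum>z\<in>\<Omega>. if z = x then if b x = v then k x y else 0 else 0)" for x y
    by (rule sum.cong) (auto simp: block_unit_def)
  also have "(\<Sum>z\<in>\<Omega>. if z = x then if b x = v then k x y else 0 else 0) = (if b x = v then k x y else 0)" for x y
    using assms(1) block_matrix_algebra_carrierD(1)[OF assms(2), of x y] by auto
  finally show "block_unit \<Omega> b v \<otimes>\<^bsub>block_matrix_algebra \<Omega> b\<^esub> k = (\<lambda>x y. if b x = v then k x y else 0)"
    by (simp add: fun_eq_iff)
  have "(\<Sum>z\<in>\<Omega>. k x z * block_unit \<Omega> b v z y) = (\<Sum>z\<in>\<Omega>. if z = y then if b y = v then k x y else 0 else 0)" for x y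
    by (rule sum.cong) (auto simp: block_unit_def)
  also have "(\<Sum>z\<in>\<Omega>. if z = y then if b y = v then k x y else 0 else 0) = (if b y = v then k x y else 0)" for x y
    using assms(1) block_matrix_algebra_carrierD(2)[OF assms(2), of x y] by auto
  finally show "k \<otimes>\<^bsub>block_matrix_algebra \<Omega> b\<^esub> block_unit \<Omega> b v = (\<lambda>x y. if b y = v then k x y else 0)"
    by (simp add: fun_eq_iff)
qed

lemma block_unit_central:
  assumes "finite \<Omega>" "k \<in> carrier (block_matrix_algebra \<Omega> b)"
  shows "block_unit \<Omega> b v \<otimes>\<^bsub>block_matrix_algebra \<Omega> b\<^esub> k = k \<otimes>\<^bsub>block_matrix_algebra \<Omega> b\<^esub> block_unit \<Omega> b v"
  unfolding block_unit_mult[OF assms] using block_matrix_algebra_carrierD(3)[OF assms(2)]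
  by (auto simp: fun_eq_iff; metis)

text \<open>
  Commuting with the elementary matrix that has its entry in row \<open>p\<close> and column \<open>q\<close> kills the
  off-diagonal entries in column \<open>p\<close> and equates the diagonal entries at \<open>p\<close> and \<open>q\<close>.
\<close>

lemma central_block_matrix:
  fixes z :: "'p \<Rightarrow> 'p \<Rightarrow> 'r::comm_ring_1"
  assumes "finite \<Omega>" and z: "z \<in> carrier (block_matrix_algebra \<Omega> b)"
    and central: "\<And>k. k \<in> carrier (block_matrix_algebra \<Omega> b) \<Longrightarrow>
      z \<otimes>\<^bsub>block_matrix_algebra \<Omega> b\<^esub> k = k \<otimes>\<^bsub>block_matrix_algebra \<Omega> b\<^esub> z"
  shows "x \<noteq> y \<Longrightarrow> z x y = 0"
    and "x \<in> \<Omega> \<Longrightarrow> y \<in> \<Omega> \<Longrightarrow> b x = b y \<Longrightarrow> z x x = z y y"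
proof -
  have entry: "z a p = (if a = p then z q q else 0)" if "p \<in> \<Omega>" "q \<in> \<Omega>" "b p = b q" for a p q
  proof -
    have "(\<Sum>w\<in>\<Omega>. z a w * elementary p q w q) = (\<Sum>w\<in>\<Omega>. if w = p then z a p else 0)"
      by (rule sum.cong) (auto simp: elementary_def)
    moreover have "(\<Sum>w\<in>\<Omega>. elementary p q a w * z w q) = (\<Sum>w\<in>\<Omega>. if w = q then if a = p then z q q else 0 else 0)"
      by (rule sum.cong) (auto simp: elementary_def)
    moreover have "(\<Sum>w\<in>\<Omega>. z a w * elementary p q w q) = (\<Sum>w\<in>\<Omega>. elementary p q a w * z w q)"
      using fun_cong[OF fun_cong[OF central[OF elementary_carrier[OF that]], of a], of q] by simp
    ultimately show ?thesis using assms(1) that by simp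
  qed
  show "z x y = 0" if "x \<noteq> y"
  proof (cases "y \<in> \<Omega>")
    case True
    then show ?thesis using entry[of y y x] that by simp
  next
    case False
    then show ?thesis using block_matrix_algebra_carrierD(2)[OF z, of x y] by blast
  qed
  show "z x x = z y y" if "x \<in> \<Omega>" "y \<in> \<Omega>" "b x = b y"
    using entry[OF that, of x] by simp
qed

locale block_matrix_iso =
  fixes \<Omega>1 :: "'p set" and b1 :: "'p \<Rightarrow> 'i" and \<Omega>2 :: "'q set" and b2 :: "'q \<Rightarrow> 'j"
    and \<phi> :: "('p \<Rightarrow> 'p \<Rightarrow> 'k::field) \<Rightarrow> 'q \<Rightarrow> 'q \<Rightarrow> 'k"
  assumes finite1: "finite \<Omega>1" and finite2: "finite \<Omega>2"
    and iso: "algebra_iso class_ring (block_matrix_algebra \<Omega>1 b1) (block_matrix_algebra \<Omega>2 b2) \<phi>"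
begin

abbreviation "B1 \<equiv> block_matrix_algebra \<Omega>1 b1 :: ('k, _) module"
abbreviation "B2 \<equiv> block_matrix_algebra \<Omega>2 b2 :: ('k, _) module"

lemma \<phi>_carrier: "k \<in> carrier B1 \<Longrightarrow> \<phi> k \<in> carrier B2"
  using algebra_isoD(2)[OF iso] .

lemma \<phi>_mult: "k \<in> carrier B1 \<Longrightarrow> l \<in> carrier B1 \<Longrightarrow> \<phi> (k \<otimes>\<^bsub>B1\<^esub> l) = \<phi> k \<otimes>\<^bsub>B2\<^esub> \<phi> l"
  using algebra_isoD(5)[OF iso] .

lemma \<phi>_smult: "k \<in> carrier B1 \<Longrightarrow> \<phi> (\<lambda>x y. c * k x y) = (\<lambda>x y. c * \<phi> k x y)"
  using algebra_isoD(4)[OF iso, of c k] by simp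

lemma \<phi>_add: "k \<in> carrier B1 \<Longrightarrow> l \<in> carrier B1 \<Longrightarrow> \<phi> (\<lambda>x y. k x y + l x y) = (\<lambda>x y. \<phi> k x y + \<phi> l x y)"
  using algebra_isoD(3)[OF iso, of k l] by simp

lemma \<phi>_inj: "k \<in> carrier B1 \<Longrightarrow> l \<in> carrier B1 \<Longrightarrow> \<phi> k = \<phi> l \<Longrightarrow> k = l"
  using algebra_isoD(1)[OF iso] by (auto simp: bij_betw_def dest: inj_onD)

lemma \<phi>_surj: "l \<in> carrier B2 \<Longrightarrow> \<exists>k\<in>carrier B1. l = \<phi> k"
  using algebra_isoD(1)[OF iso] by (auto simp: bij_betw_def)

lemma zero_carrier: "(\<lambda>_ _. 0) \<in> carrier B1"
  by (simp add: block_matrix_algebra_carrier)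

lemma \<phi>_zero: "\<phi> (\<lambda>_ _. 0) = (\<lambda>_ _. 0)"
  using \<phi>_smult[OF zero_carrier, of 0] by simp

lemma \<phi>_sum:
  assumes "finite J" "\<And>i. i \<in> J \<Longrightarrow> k i \<in> carrier B1"
  shows "(\<lambda>x y. \<Sum>i\<in>J. c i * k i x y) \<in> carrier B1 \<and>
    \<phi> (\<lambda>x y. \<Sum>i\<in>J. c i * k i x y) = (\<lambda>x y. \<Sum>i\<in>J. c i * \<phi> (k i) x y)"
  using assms
proof (induction J)
  case empty
  show ?case using zero_carrier \<phi>_zero by simp
next
  case (insert j J)
  have scale: "(\<lambda>x y. c j * k j x y) \<in> carrier B1"
    using block_matrix_algebra_closed(1)[of "k j" \<Omega>1 b1 "c j"] insert.prems by simp
  have IH: "(\<lambda>x y. \<Sum>i\<in>J. c i * k i x y) \<in> carrier B1"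
    "\<phi> (\<lambda>x y. \<Sum>i\<in>J. c i * k i x y) = (\<lambda>x y. \<Sum>i\<in>J. c i * \<phi> (k i) x y)"
    using insert by auto
  show ?case
    using \<phi>_add[OF scale IH(1)] block_matrix_algebra_closed(2)[OF scale IH(1)] insert.hyps insert.prems \<phi>_smult[of "k j" "c j"] IH(2)
    by simp
qed

text \<open>
  The image of a block unit is a central idempotent, hence a diagonal matrix that is constant on blocks,
  with entries \<open>0\<close> and \<open>1\<close>.  Its support is therefore a union of blocks, and supports of images of
  different block units are disjoint.
\<close>

abbreviation "e v \<equiv> \<phi> (block_unit \<Omega>1 b1 v)"

lemma e_carrier: "e v \<in> carrier B2"
  by (rule \<phi>_carrier[OF block_unit_carrier])

lemma e_central: "l \<in> carrier B2 \<Longrightarrow> e v \<otimes>\<^bsub>B2\<^esub> l = l \<otimes>\<^bsub>B2\<^esub> e v"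
proof -
  assume "l \<in> carrier B2"
  then obtain k where k: "k \<in> carrier B1" "l = \<phi> k" using \<phi>_surj by blast
  show "e v \<otimes>\<^bsub>B2\<^esub> l = l \<otimes>\<^bsub>B2\<^esub> e v"
    unfolding k(2) \<phi>_mult[OF block_unit_carrier k(1), symmetric] \<phi>_mult[OF k(1) block_unit_carrier, symmetric]
    by (simp only: block_unit_central[OF finite1 k(1)])
qed

lemma e_diagonal: "x \<noteq> y \<Longrightarrow> e v x y = 0"
  using central_block_matrix(1)[OF finite2 e_carrier e_central] .

lemma e_constant: "x \<in> \<Omega>2 \<Longrightarrow> y \<in> \<Omega>2 \<Longrightarrow> b2 x = b2 y \<Longrightarrow> e v x x = e v y y"
  using central_block_matrix(2)[OF finite2 e_carrier e_central] .

lemma e_mult: "e v x x * e w x x = (if v = w then e v x x else 0)"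
proof -
  have "block_unit \<Omega>1 b1 v \<otimes>\<^bsub>B1\<^esub> block_unit \<Omega>1 b1 w = (if v = w then block_unit \<Omega>1 b1 v else (\<lambda>_ _. 0))"
    unfolding block_unit_mult(1)[OF finite1 block_unit_carrier] by (auto simp: block_unit_def fun_eq_iff)
  then have "e v \<otimes>\<^bsub>B2\<^esub> e w = (if v = w then e v else (\<lambda>_ _. 0))"
    using \<phi>_mult[OF block_unit_carrier block_unit_carrier, of v w] \<phi>_zero by (simp split: if_splits)
  then have "(\<Sum>z\<in>\<Omega>2. e v x z * e w z x) = (if v = w then e v x x else 0)"
    by (auto simp: fun_eq_iff)
  moreover have "(\<Sum>z\<in>\<Omega>2. e v x z * e w z x) = (\<Sum>z\<in>\<Omega>2. if z = x then e v x x * e w x x else 0)"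
    by (rule sum.cong) (auto simp: e_diagonal)
  moreover have "e v x x = 0" if "x \<notin> \<Omega>2"
    using block_matrix_algebra_carrierD(1)[OF e_carrier, of v x x] that by blast
  ultimately show ?thesis using finite2 by (auto split: if_splits)
qed

lemma e_nonzero:
  assumes "v \<in> b1 ` \<Omega>1"
  shows "\<exists>x\<in>\<Omega>2. e v x x \<noteq> 0"
proof (rule ccontr)
  assume contra: "\<not> (\<exists>x\<in>\<Omega>2. e v x x \<noteq> 0)"
  have "e v x y = 0" for x y
    using contra e_diagonal[of x y v] block_matrix_algebra_carrierD(1)[OF e_carrier, of v x y] by (cases "x = y") auto
  then have "e v = \<phi> (\<lambda>_ _. 0)" by (simp add: \<phi>_zero fun_eq_iff)
  then have "block_unit \<Omega>1 b1 v = ((\<lambda>_ _. 0) :: 'p \<Rightarrow> 'p \<Rightarrow> 'k)"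
    by (rule \<phi>_inj[OF block_unit_carrier zero_carrier])
  moreover obtain p where "p \<in> \<Omega>1" "b1 p = v" using assms by blast
  then have "block_unit \<Omega>1 b1 v p p = (1 :: 'k)" by (simp add: block_unit_def)
  ultimately show False by simp
qed

text \<open>
  Each block of the domain is assigned one of the blocks that support the image of its unit.
\<close>

lemma block_injection:
  obtains f where "inj_on f (b1 ` \<Omega>1)" "f ` (b1 ` \<Omega>1) \<subseteq> b2 ` \<Omega>2"
    "\<And>v x. v \<in> b1 ` \<Omega>1 \<Longrightarrow> x \<in> \<Omega>2 \<Longrightarrow> b2 x = f v \<Longrightarrow> e v x x \<noteq> 0"
proof -
  \<comment> \<open>a point in the support of the image of the unit of \<open>v\<close>\<close>
  define s where "s v = (SOME x. x \<in> \<Omega>2 \<and> e v x x \<noteq> 0)" for v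
  have s: "s v \<in> \<Omega>2" "e v (s v) (s v) \<noteq> 0" if "v \<in> b1 ` \<Omega>1" for v
    using someI_ex[of "\<lambda>x. x \<in> \<Omega>2 \<and> e v x x \<noteq> 0"] e_nonzero[OF that] unfolding s_def by blast+
  have nonzero: "e v x x \<noteq> 0" if "v \<in> b1 ` \<Omega>1" "x \<in> \<Omega>2" "b2 x = b2 (s v)" for v x
    using e_constant[OF that(2) s(1)[OF that(1)] that(3), of v] s(2)[OF that(1)] by simp
  show ?thesis
  proof (rule that[of "b2 \<circ> s"])
    show "inj_on (b2 \<circ> s) (b1 ` \<Omega>1)"
    proof (rule inj_onI)
      fix v w assume vw: "v \<in> b1 ` \<Omega>1" "w \<in> b1 ` \<Omega>1" "(b2 \<circ> s) v = (b2 \<circ> s) w"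
      have "e v (s v) (s v) * e w (s v) (s v) \<noteq> 0"
        using s[OF vw(1)] nonzero[OF vw(2), of "s v"] vw(3) by simp
      then show "v = w" unfolding e_mult by (simp split: if_splits)
    qed
  qed (use s nonzero in auto)
qed

text \<open>
  If the unit of one block is mapped to the unit of another, then the first block, as a vector space,
  embeds into the second.  The dimensions are the squares of the sizes.
\<close>

lemma block_size_le:
  assumes vw: "e v = block_unit \<Omega>2 b2 w"
  shows "card {x \<in> \<Omega>1. b1 x = v} \<le> card {x \<in> \<Omega>2. b2 x = w}"
proof -
  define P where "P = {x \<in> \<Omega>1. b1 x = v}"
  define Q where "Q = {x \<in> \<Omega>2. b2 x = w}"
  have finite: "finite P" "finite Q" using finite1 finite2 by (simp_all add: P_def Q_def)
  define \<delta> where "\<delta> a = (\<lambda>a'. if a' = a then 1 else 0 :: 'k)" for a :: "'q \<times> 'q"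
  define T where "T = \<delta> ` (Q \<times> Q)"
  have unit: "elementary p q \<in> carrier B1" if "(p, q) \<in> P \<times> P" for p q
    using that by (intro elementary_carrier) (auto simp: P_def)
  have "finite (P \<times> P) \<and> card (P \<times> P) \<le> card T"
  proof (rule card_le_of_independent_family[of T "P \<times> P" "\<lambda>(p, q) (x, y). \<phi> (elementary p q) x y"])
    show "finite T" using finite by (simp add: T_def)
  next
    fix i assume "i \<in> P \<times> P"
    then obtain p q where i: "i = (p, q)" "(p, q) \<in> P \<times> P" by (cases i) auto
    let ?k = "\<lambda>(x, y). \<phi> (elementary p q) x y"
    have "block_unit \<Omega>1 b1 v \<otimes>\<^bsub>B1\<^esub> elementary p q = elementary p q"
      unfolding block_unit_mult(1)[OF finite1 unit[OF i(2)]] using i(2) by (auto simp: elementary_def P_def fun_eq_iff)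
    then have "\<phi> (elementary p q) = block_unit \<Omega>2 b2 w \<otimes>\<^bsub>B2\<^esub> \<phi> (elementary p q)"
      using \<phi>_mult[OF block_unit_carrier unit[OF i(2)], of v] vw by simp
    then have eq: "\<phi> (elementary p q) = (\<lambda>x y. if b2 x = w then \<phi> (elementary p q) x y else 0)"
      unfolding block_unit_mult(1)[OF finite2 \<phi>_carrier[OF unit[OF i(2)]]] .
    have supp: "?k a = 0" if "a \<notin> Q \<times> Q" for a
    proof (rule ccontr)
      assume nz: "?k a \<noteq> 0"
      obtain x y where a: "a = (x, y)" by (cases a)
      have xy: "\<phi> (elementary p q) x y \<noteq> 0" using nz a by simp
      then have "b2 x = w" using fun_cong[OF fun_cong[OF eq, of x], of y] by (simp split: if_splits)
      then show False
        using block_matrix_algebra_carrierD[OF \<phi>_carrier[OF unit[OF i(2)]] xy] that a by (simp add: Q_def)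
    qed
    have "?k a = (\<Sum>c\<in>Q \<times> Q. (\<lambda>a'. ?k c * \<delta> c a')) a" for a
    proof -
      have "(\<Sum>c\<in>Q \<times> Q. (\<lambda>a'. ?k c * \<delta> c a')) a = (\<Sum>c\<in>Q \<times> Q. if c = a then ?k a else 0)"
        unfolding sum_fun_apply by (rule sum.cong) (auto simp: \<delta>_def)
      also have "\<dots> = ?k a" using finite supp[of a] by simp
      finally show ?thesis by simp
    qed
    then have "?k = (\<Sum>c\<in>Q \<times> Q. (\<lambda>a'. ?k c * \<delta> c a'))" by (rule ext)
    also have "\<dots> \<in> fun_space.span T"
      by (intro fun_space.span_sum fun_space.span_scale fun_space.span_base) (simp add: T_def)
    finally show "(case i of (p, q) \<Rightarrow> \<lambda>(x, y). \<phi> (elementary p q) x y) \<in> fun_space.span T"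
      unfolding i(1) prod.case .
  next
    fix J and c :: "'p \<times> 'p \<Rightarrow> 'k" and i
    assume J: "finite J" "J \<subseteq> P \<times> P" "i \<in> J"
      and sum: "\<And>a. (\<Sum>i\<in>J. c i * (case i of (p, q) \<Rightarrow> \<lambda>(x, y). \<phi> (elementary p q) x y) a) = 0"
    define k where "k = (\<lambda>i :: 'p \<times> 'p. elementary (fst i) (snd i) :: 'p \<Rightarrow> 'p \<Rightarrow> 'k)"
    have k: "k i \<in> carrier B1" if "i \<in> J" for i
      using unit[of "fst i" "snd i"] that J(2) by (auto simp: k_def)
    have "(\<Sum>i\<in>J. c i * \<phi> (k i) x y) = 0" for x y
      using sum[of "(x, y)"] by (simp add: k_def case_prod_unfold)
    then have "\<phi> (\<lambda>x y. \<Sum>i\<in>J. c i * k i x y) = \<phi> (\<lambda>_ _. 0)"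
      using \<phi>_sum[OF J(1) k] by (simp add: \<phi>_zero fun_eq_iff)
    then have "(\<lambda>x y. \<Sum>i\<in>J. c i * k i x y) = (\<lambda>_ _. 0)"
      by (intro \<phi>_inj zero_carrier) (use \<phi>_sum[OF J(1) k] in auto)
    then have "(\<Sum>j\<in>J. c j * k j (fst i) (snd i)) = 0" by (simp add: fun_eq_iff)
    also have "(\<Sum>j\<in>J. c j * k j (fst i) (snd i)) = (\<Sum>j\<in>J. if j = i then c i else 0)"
      by (rule sum.cong) (auto simp: k_def elementary_def prod_eq_iff)
    also have "\<dots> = c i" using J by simp
    finally show "c i = 0" .
  qed
  then have "card (P \<times> P) \<le> card T" ..
  also have "card T \<le> card (Q \<times> Q)" unfolding T_def using finite by (intro card_image_le) simp
  finally have "card P * card P \<le> card Q * card Q" by (simp add: card_cartesian_product)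
  then have "card P \<le> card Q" by (simp add: power2_eq_square[symmetric] power2_nat_le_eq_le)
  then show ?thesis by (simp add: P_def Q_def)
qed

end

text \<open>
  The injections of blocks in both directions show that there are equally many blocks.  Then the disjoint
  unions of blocks that support the images of the units are single blocks, and the sizes of
  corresponding blocks agree because they bound each other.
\<close>

lemma block_matrix_algebra_iso_imp_bij:
  fixes \<Omega>1 :: "'p set" and b1 :: "'p \<Rightarrow> 'i" and \<Omega>2 :: "'q set" and b2 :: "'q \<Rightarrow> 'j"
  assumes fin: "finite \<Omega>1" "finite \<Omega>2"
    and iso: "algebra_isomorphic (class_ring :: 'k::field ring) (block_matrix_algebra \<Omega>1 b1) (block_matrix_algebra \<Omega>2 b2)"
  obtains h where "bij_betw h \<Omega>1 \<Omega>2" "\<And>x y. x \<in> \<Omega>1 \<Longrightarrow> y \<in> \<Omega>1 \<Longrightarrow> b1 x = b1 y \<longleftrightarrow> b2 (h x) = b2 (h y)"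
proof -
  obtain \<phi> where \<phi>: "algebra_iso (class_ring :: 'k ring) (block_matrix_algebra \<Omega>1 b1) (block_matrix_algebra \<Omega>2 b2) \<phi>"
    using iso by (auto simp: algebra_isomorphic_iff)
  interpret block_matrix_iso \<Omega>1 b1 \<Omega>2 b2 \<phi> by unfold_locales (use fin \<phi> in auto)
  let ?\<psi> = "inv_into (carrier B1) \<phi>"
  have \<psi>: "algebra_iso class_ring B2 B1 ?\<psi>"
    by (rule algebra_iso_inv_into[OF \<phi>]) (use block_matrix_algebra_closed in blast)+
  interpret inv: block_matrix_iso \<Omega>2 b2 \<Omega>1 b1 ?\<psi> by unfold_locales (use fin \<psi> in auto)
  let ?V1 = "b1 ` \<Omega>1" and ?V2 = "b2 ` \<Omega>2"
  obtain f where f: "inj_on f ?V1" "f ` ?V1 \<subseteq> ?V2"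
    "\<And>v x. v \<in> ?V1 \<Longrightarrow> x \<in> \<Omega>2 \<Longrightarrow> b2 x = f v \<Longrightarrow> e v x x \<noteq> 0"
    by (rule block_injection) (rule that)
  obtain g where "inj_on g ?V2" "g ` ?V2 \<subseteq> ?V1" by (rule inv.block_injection) (rule that)
  then have "card ?V2 \<le> card ?V1" using fin by (intro card_inj_on_le) auto
  then have "card (f ` ?V1) \<ge> card ?V2" using f(1) by (simp add: card_image)
  then have f_onto: "f ` ?V1 = ?V2" using f(2) fin by (intro card_seteq) auto
  have e_eq: "e v = block_unit \<Omega>2 b2 (f v)" if v: "v \<in> ?V1" for v
  proof (intro ext)
    fix x y
    show "e v x y = block_unit \<Omega>2 b2 (f v) x y"
    proof (cases "x = y \<and> x \<in> \<Omega>2")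
      case False
      then show ?thesis
        using e_diagonal[of x y v] block_matrix_algebra_carrierD(1)[OF e_carrier, of v x y]
        by (auto simp: block_unit_def)
    next
      case True
      then have xy: "y = x" "x \<in> \<Omega>2" by auto
      then obtain w where w: "w \<in> ?V1" "b2 x = f w" using f_onto by blast
      then have w_nz: "e w x x \<noteq> 0" using f(3) xy by blast
      show ?thesis
      proof (cases "v = w")
        case True
        then have "e v x x * e v x x = e v x x" "e v x x \<noteq> 0" using e_mult[of v x v] w_nz by simp_all
        then have "e v x x = 1" by simp
        moreover have "block_unit \<Omega>2 b2 (f v) x x = (1 :: 'k)"
          using w(2) True xy(2) unfolding block_unit_def by simp
        ultimately show ?thesis unfolding xy(1) by simp
      next
        case False
        then have "e v x x = 0" using e_mult[of v x w] w_nz by simp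
        moreover have "b2 x \<noteq> f v" using False f(1) v w by (auto dest: inj_onD)
        ultimately show ?thesis unfolding xy(1) by (simp add: block_unit_def)
      qed
    qed
  qed
  have card_eq: "card {x \<in> \<Omega>1. b1 x = v} = card {x \<in> \<Omega>2. b2 x = f v}" if v: "v \<in> ?V1" for v
  proof (rule antisym)
    show "card {x \<in> \<Omega>1. b1 x = v} \<le> card {x \<in> \<Omega>2. b2 x = f v}"
      by (rule block_size_le[OF e_eq[OF v]])
    have "?\<psi> (block_unit \<Omega>2 b2 (f v)) = block_unit \<Omega>1 b1 v"
      unfolding e_eq[OF v, symmetric] using algebra_isoD(1)[OF \<phi>] block_unit_carrier
      by (intro inv_into_f_f) (auto simp: bij_betw_def)
    then show "card {x \<in> \<Omega>2. b2 x = f v} \<le> card {x \<in> \<Omega>1. b1 x = v}"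
      by (rule inv.block_size_le)
  qed
  have "\<exists>g. bij_betw g {x \<in> \<Omega>1. b1 x = v} {x \<in> \<Omega>2. b2 x = f v}" if "v \<in> ?V1" for v
    using card_eq[OF that] fin by (intro finite_same_card_bij) auto
  then obtain G where G: "\<And>v. v \<in> ?V1 \<Longrightarrow> bij_betw (G v) {x \<in> \<Omega>1. b1 x = v} {x \<in> \<Omega>2. b2 x = f v}"
    by metis
  define h where "h x = G (b1 x) x" for x
  have h: "h x \<in> \<Omega>2 \<and> b2 (h x) = f (b1 x)" if "x \<in> \<Omega>1" for x
    using bij_betwE[OF G[of "b1 x"]] that by (auto simp: h_def)
  have same_block: "b1 x = b1 y \<longleftrightarrow> b2 (h x) = b2 (h y)" if "x \<in> \<Omega>1" "y \<in> \<Omega>1" for x y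
    using h that f(1) by (auto dest: inj_onD)
  have "bij_betw h \<Omega>1 \<Omega>2"
    unfolding bij_betw_def
  proof
    show "inj_on h \<Omega>1"
    proof (rule inj_onI)
      fix x y assume xy: "x \<in> \<Omega>1" "y \<in> \<Omega>1" "h x = h y"
      then have b: "b1 x = b1 y" using same_block by metis
      then have "G (b1 x) x = G (b1 x) y" using xy(3) by (simp add: h_def)
      moreover have "inj_on (G (b1 x)) {z \<in> \<Omega>1. b1 z = b1 x}"
        using G[of "b1 x"] xy(1) by (auto simp: bij_betw_def)
      ultimately show "x = y" using xy b by (auto dest: inj_onD)
    qed
    show "h ` \<Omega>1 = \<Omega>2"
    proof
      show "h ` \<Omega>1 \<subseteq> \<Omega>2" using h by blast
      show "\<Omega>2 \<subseteq> h ` \<Omega>1"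
      proof
        fix y assume y: "y \<in> \<Omega>2"
        then obtain v where v: "v \<in> ?V1" "b2 y = f v" using f_onto by blast
        then have "y \<in> G v ` {x \<in> \<Omega>1. b1 x = v}" using G[OF v(1)] y by (auto simp: bij_betw_def)
        then show "y \<in> h ` \<Omega>1" by (auto simp: h_def)
      qed
    qed
  qed
  then show ?thesis using that same_block by blast
qed

lemma block_matrix_algebra_reindex:
  fixes \<Omega>1 :: "'p set" and b1 :: "'p \<Rightarrow> 'i" and \<Omega>2 :: "'q set" and b2 :: "'q \<Rightarrow> 'j"
  assumes bij: "bij_betw h \<Omega>1 \<Omega>2"
    and blocks: "\<And>x y. x \<in> \<Omega>1 \<Longrightarrow> y \<in> \<Omega>1 \<Longrightarrow> b1 x = b1 y \<longleftrightarrow> b2 (h x) = b2 (h y)"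
  shows "algebra_isomorphic (class_ring :: 'r::comm_ring_1 ring) (block_matrix_algebra \<Omega>2 b2) (block_matrix_algebra \<Omega>1 b1)"
proof -
  define pull :: "('q \<Rightarrow> 'q \<Rightarrow> 'r) \<Rightarrow> 'p \<Rightarrow> 'p \<Rightarrow> 'r" where
    "pull l = (\<lambda>x y. if x \<in> \<Omega>1 \<and> y \<in> \<Omega>1 then l (h x) (h y) else 0)" for l
  define g where "g = inv_into \<Omega>1 h"
  define push :: "('p \<Rightarrow> 'p \<Rightarrow> 'r) \<Rightarrow> 'q \<Rightarrow> 'q \<Rightarrow> 'r" where
    "push k = (\<lambda>x y. if x \<in> \<Omega>2 \<and> y \<in> \<Omega>2 then k (g x) (g y) else 0)" for k
  have h: "x \<in> \<Omega>1 \<Longrightarrow> h x \<in> \<Omega>2" "x \<in> \<Omega>1 \<Longrightarrow> g (h x) = x" for x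
    using bij by (auto simp: bij_betw_def g_def)
  have g: "x \<in> \<Omega>2 \<Longrightarrow> g x \<in> \<Omega>1" "x \<in> \<Omega>2 \<Longrightarrow> h (g x) = x" for x
    using bij by (auto simp: bij_betw_def g_def inv_into_into f_inv_into_f)
  have "algebra_iso (class_ring :: 'r ring) (block_matrix_algebra \<Omega>2 b2) (block_matrix_algebra \<Omega>1 b1) pull"
  proof (rule algebra_isoI)
    show "bij_betw pull (carrier (block_matrix_algebra \<Omega>2 b2)) (carrier (block_matrix_algebra \<Omega>1 b1))"
    proof (rule bij_betwI[of _ _ _ push])
      show "pull \<in> carrier (block_matrix_algebra \<Omega>2 b2) \<rightarrow> carrier (block_matrix_algebra \<Omega>1 b1)"
      proof
        fix l :: "'q \<Rightarrow> 'q \<Rightarrow> 'r" assume l: "l \<in> carrier (block_matrix_algebra \<Omega>2 b2)"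
        show "pull l \<in> carrier (block_matrix_algebra \<Omega>1 b1)"
          unfolding block_matrix_algebra_carrier
        proof (intro allI impI)
          fix x y assume "pull l x y \<noteq> 0"
          then have "x \<in> \<Omega>1" "y \<in> \<Omega>1" "l (h x) (h y) \<noteq> 0" by (auto simp: pull_def split: if_splits)
          then show "x \<in> \<Omega>1 \<and> y \<in> \<Omega>1 \<and> b1 x = b1 y"
            using block_matrix_algebra_carrierD(3)[OF l] blocks by blast
        qed
      qed
      show "push \<in> carrier (block_matrix_algebra \<Omega>1 b1) \<rightarrow> carrier (block_matrix_algebra \<Omega>2 b2)"
      proof
        fix k :: "'p \<Rightarrow> 'p \<Rightarrow> 'r" assume k: "k \<in> carrier (block_matrix_algebra \<Omega>1 b1)"
        show "push k \<in> carrier (block_matrix_algebra \<Omega>2 b2)"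
          unfolding block_matrix_algebra_carrier
        proof (intro allI impI)
          fix x y assume "push k x y \<noteq> 0"
          then have xy: "x \<in> \<Omega>2" "y \<in> \<Omega>2" "k (g x) (g y) \<noteq> 0" by (auto simp: push_def split: if_splits)
          then have "b1 (g x) = b1 (g y)" using block_matrix_algebra_carrierD(3)[OF k] by blast
          then show "x \<in> \<Omega>2 \<and> y \<in> \<Omega>2 \<and> b2 x = b2 y"
            using blocks[of "g x" "g y"] g xy by simp
        qed
      qed
      show "push (pull l) = l" if "l \<in> carrier (block_matrix_algebra \<Omega>2 b2)" for l
        using block_matrix_algebra_carrierD[OF that] g unfolding push_def pull_def by (auto simp: fun_eq_iff)
      show "pull (push k) = k" if "k \<in> carrier (block_matrix_algebra \<Omega>1 b1)" for k
        using block_matrix_algebra_carrierD[OF that] h unfolding push_def pull_def by (auto simp: fun_eq_iff)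
    qed
    fix k l :: "'q \<Rightarrow> 'q \<Rightarrow> 'r"
    have "(\<Sum>z\<in>\<Omega>2. k (h x) z * l z (h y)) = (\<Sum>z\<in>\<Omega>1. k (h x) (h z) * l (h z) (h y))" for x y
      using sum.reindex_bij_betw[OF bij] by (rule sym)
    then show "pull (k \<otimes>\<^bsub>block_matrix_algebra \<Omega>2 b2\<^esub> l) = pull k \<otimes>\<^bsub>block_matrix_algebra \<Omega>1 b1\<^esub> pull l"
      by (auto simp: pull_def fun_eq_iff intro!: sum.cong)
  qed (auto simp: pull_def fun_eq_iff)
  then show ?thesis by (auto simp: algebra_isomorphic_iff)
qed

section \<open>Change of the coefficient field\<close>

text \<open>
  The intermediate bijection of indices is purely combinatorial and so remains available over any ring.
\<close>

lemma block_matrix_algebra_change_of_rings: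
  assumes "finite \<Omega>1" "finite \<Omega>2"
    and "algebra_isomorphic (class_ring :: 'k::field ring)
      (block_matrix_algebra \<Omega>1 b1) (block_matrix_algebra \<Omega>2 b2)"
  shows "algebra_isomorphic (class_ring :: 'r::comm_ring_1 ring)
    (block_matrix_algebra \<Omega>1 b1) (block_matrix_algebra \<Omega>2 b2)"
proof -
  obtain h where h: "bij_betw h \<Omega>1 \<Omega>2" "\<And>x y. x \<in> \<Omega>1 \<Longrightarrow> y \<in> \<Omega>1 \<Longrightarrow> b1 x = b1 y \<longleftrightarrow> b2 (h x) = b2 (h y)"
    using block_matrix_algebra_iso_imp_bij[OF assms] by blast
  have "algebra_isomorphic (class_ring :: 'r ring) (block_matrix_algebra \<Omega>2 b2) (block_matrix_algebra \<Omega>1 b1)"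
    using h by (rule block_matrix_algebra_reindex)
  then show ?thesis
    by (rule algebra_isomorphic_sym) (rule block_matrix_algebra_closed; assumption)+
qed

theorem corollary4p10:
  fixes E1 :: "('v1, 'e1) pre_digraph" and E2 :: "('v2, 'e2) pre_digraph"
    and X1 :: "'v1 set" and X2 :: "'v2 set"
    and \<iota> :: "(('k::field list \<times> nat) multiset \<Rightarrow> 'k) \<Rightarrow> 'l::field"
  assumes "wf_digraph E1" and "wf_digraph E2"
    and "X1 \<subseteq> regular_verts E1" and "X2 \<subseteq> regular_verts E2"
    and "vectorspace.fin_dim class_ring (cohn_path_algebra TYPE('k) E1 X1)"
    and "vectorspace.fin_dim class_ring (cohn_path_algebra TYPE('k) E2 X2)"
    and "algebra_isomorphic class_ring
           (cohn_path_algebra TYPE('k) E1 X1) (cohn_path_algebra TYPE('k) E2 X2)"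
    and "CHAR('l) = CHAR('k)"
    and "\<iota> \<in> Ring.ring_hom (field.alg_closure (prime_field (class_ring :: 'k ring))) (class_ring :: 'l ring)"
  shows "algebra_isomorphic class_ring
           (cohn_path_algebra TYPE('l) E1 X1) (cohn_path_algebra TYPE('l) E2 X2)"
proof -
  interpret E1: finitely_many_walks E1 X1
    using fin_dim_cohn_path_algebra_imp_finite_walks[OF assms(1,3,5)] assms(1,3)
    by (intro finitely_many_walks.intro finitely_many_walks_axioms.intro)
  interpret E2: finitely_many_walks E2 X2
    using fin_dim_cohn_path_algebra_imp_finite_walks[OF assms(2,4,6)] assms(2,4)
    by (intro finitely_many_walks.intro finitely_many_walks_axioms.intro)
  let ?B1 = "block_matrix_algebra E1.\<Omega> (walk_end E1)" and ?B2 = "block_matrix_algebra E2.\<Omega> (walk_end E2)"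
  have "algebra_isomorphic (class_ring :: 'k ring) ?B1 (cohn_path_algebra TYPE('k) E1 X1)"
    by (rule algebra_isomorphic_sym[OF E1.cohn_path_algebra_isomorphic_block_matrix_algebra])
      (rule cohn_path_algebra_closed[OF assms(1,3)]; assumption)+
  from algebra_isomorphic_trans[OF algebra_isomorphic_trans[OF this assms(7)]
      E2.cohn_path_algebra_isomorphic_block_matrix_algebra]
  have "algebra_isomorphic (class_ring :: 'k ring) ?B1 ?B2" .
  then have "algebra_isomorphic (class_ring :: 'l ring) ?B1 ?B2"
    by (rule block_matrix_algebra_change_of_rings[OF E1.finite_\<Omega> E2.finite_\<Omega>])
  moreover have "algebra_isomorphic (class_ring :: 'l ring) ?B2 (cohn_path_algebra TYPE('l) E2 X2)"
    by (rule algebra_isomorphic_sym[OF E2.cohn_path_algebra_isomorphic_block_matrix_algebra])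
      (rule cohn_path_algebra_closed[OF assms(2,4)]; assumption)+
  ultimately show ?thesis
    using algebra_isomorphic_trans[OF E1.cohn_path_algebra_isomorphic_block_matrix_algebra algebra_isomorphic_trans] by blast
qed

end
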